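(* Let $X=S^1\times(\Gamma\backslash\mathrm{Nil}^3)$ be the Kodaira--Thurston surface. For every real $a\neq0$, the almost complex structure $J_a$ on $X$ given by $$J_a\Bigl(\tfrac{\partial}{\partial t}\Bigr)=\tfrac{\partial}{\partial x},\quad J_a\Bigl(\tfrac{\partial}{\partial x}\Bigr)=-\tfrac{\partial}{\partial t},\quad J_a\Bigl(\tfrac{\partial}{\partial y}+x\tfrac{\partial}{\partial z}\Bigr)=\tfrac1a\tfrac{\partial}{\partial z},\quad J_a\Bigl(\tfrac{\partial}{\partial z}\Bigr)=-a\Bigl(\tfrac{\partial}{\partial y}+x\tfrac{\partial}{\partial z}\Bigr)$$ is non-integrable and satisfies $h^{1,0}(X)=1$ and $$\kappa^{J_a}(X)=\begin{cases}-\infty,& a\notin\pi\mathbb Q,\\ 0,& a\in\pi\mathbb Q\setminus\{0\}.\end{cases}$$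
   Context: $\mathrm{Nil}^3$ is the Heisenberg group of real matrices $\begin{pmatrix}1&x&z\\0&1&y\\0&0&1\end{pmatrix}$, $\Gamma$ is its subgroup of matrices with integer entries acting by left multiplication, and $S^1=\mathbb R/\mathbb Z$ has coordinate $t$. The vector fields $\frac{\partial}{\partial t},\frac{\partial}{\partial x},\frac{\partial}{\partial y}+x\frac{\partial}{\partial z},\frac{\partial}{\partial z}$ are invariant and give a global frame of $TX$. For a compact almost complex manifold $(X,J)$ of real dimension $2n$: split $T^*X\otimes\mathbb C=(T^*X)^{1,0}\oplus(T^*X)^{0,1}$; put $\Lambda^{p,q}=\Lambda^p((T^*X)^{1,0})\otimes\Lambda^q((T^*X)^{0,1})$, $\Omega^{p,q}(X)=\Gamma(X,\Lambda^{p,q})$, $\bar\partial=\pi^{p,q+1}\circ d$ on $(p,q)$-forms, where $\pi^{p,q}$ is the projection onto type $(p,q)$. Let $\mathcal K=\Lambda^{n,0}$. Using $\Lambda^{n,1}\cong(T^*X)^{0,1}\otimes\mathcal K$ regard $\bar\partial_1=\bar\partial$ as an operator $\Gamma(\mathcal K)\to\Gamma((T^*X)^{0,1}\otimes\mathcal K)$, and define $\bar\partial_m$ on $\mathcal K^{\otimes m}$ inductively by $\bar\partial_m(s_1\otimes s_2)=\bar\partial s_1\otimes s_2+s_1\otimes\bar\partial_{m-1}s_2$. $P_m(X,J)=\dim_{\mathbb C}\{s\in\Gamma(X,\mathcal K^{\otimes m}):\bar\partial_m s=0\}$. The Kodaira dimension $\kappa^J(X)$ is $-\infty$ if $P_m(X,J)=0$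 for all $m\ge1$, and otherwise $\limsup_{m\to\infty}\frac{\log P_m(X,J)}{\log m}$. $h^{1,0}(X)=\dim_{\mathbb C}\{\gamma\in\Omega^{1,0}(X):\bar\partial\gamma=0\}$, computed with respect to $J_a$. *)

theory Defs
  imports "HOL-Analysis.Analysis" "HOL-Library.Function_Algebras"
begin

section \<open>Smooth maps and smooth atlases\<close>

primrec Ck_on :: "nat \<Rightarrow> 'e::real_normed_vector set \<Rightarrow> ('e \<Rightarrow> 'b::real_normed_vector) \<Rightarrow> bool" where
  "Ck_on 0 S f \<longleftrightarrow> continuous_on S f"
| "Ck_on (Suc k) S f \<longleftrightarrow> (\<forall>x\<in>S. f differentiable (at x)) \<and>
     (\<forall>v. Ck_on k S (\<lambda>x. frechet_derivative f (at x) v))"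

text \<open>Only used for open \<open>S\<close> in a Euclidean space, where it is the usual notion of \<open>C\<^sup>\<infinity>\<close>.\<close>
definition smooth_on :: "'e::real_normed_vector set \<Rightarrow> ('e \<Rightarrow> 'b::real_normed_vector) \<Rightarrow> bool" where
  "smooth_on S f \<longleftrightarrow> (\<forall>k. Ck_on k S f)"

text \<open>A chart is a pair of a domain and a coordinate map; the values of the coordinate map
  outside the domain are irrelevant.\<close>
type_synonym ('x, 'e) chart = "'x set \<times> ('x \<Rightarrow> 'e)"

definition chart_image :: "('x, 'e) chart \<Rightarrow> 'e set" where
  "chart_image c = snd c ` fst c"

definition overlap :: "('x, 'e) chart \<Rightarrow> ('x, 'e) chart \<Rightarrow> 'e set" where
  "overlap c c' = snd c ` (fst c \<inter> fst c')"

definition transition :: "('x, 'e) chart \<Rightarrow> ('x, 'e) chart \<Rightarrow> 'e \<Rightarrow> 'e" where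
  "transition c c' = snd c' \<circ> inv_into (fst c) (snd c)"

definition smooth_atlas :: "'x set \<Rightarrow> ('x, 'e::euclidean_space) chart set \<Rightarrow> bool" where
  "smooth_atlas X A \<longleftrightarrow> (\<Union>c\<in>A. fst c) = X \<and>
     (\<forall>c\<in>A. inj_on (snd c) (fst c) \<and> open (chart_image c)) \<and>
     (\<forall>c\<in>A. \<forall>c'\<in>A. open (overlap c c') \<and> smooth_on (overlap c c') (transition c c'))"

section \<open>Almost complex structures\<close>

text \<open>A field of endomorphisms of the tangent bundle is given by its local expression
  \<open>J c x\<close> in every chart \<open>c\<close> at every \<open>x\<close> in the image of \<open>c\<close>, compatibly with the
  transition maps.\<close>
definition almost_complex_structure ::
    "('x, 'e::euclidean_space) chart set \<Rightarrow> (('x, 'e) chart \<Rightarrow> 'e \<Rightarrow> 'e \<Rightarrow> 'e) \<Rightarrow> bool" where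
  "almost_complex_structure A J \<longleftrightarrow>
     (\<forall>c\<in>A. (\<forall>x\<in>chart_image c. linear (J c x) \<and> (\<forall>v. J c x (J c x v) = - v)) \<and>
             (\<forall>v. smooth_on (chart_image c) (\<lambda>x. J c x v))) \<and>
     (\<forall>c\<in>A. \<forall>c'\<in>A. \<forall>x\<in>overlap c c'. \<forall>v.
        frechet_derivative (transition c c') (at x) (J c x v) =
        J c' (transition c c' x) (frechet_derivative (transition c c') (at x) v))"

text \<open>\<open>J\<close> is integrable if it is induced by a complex structure: around every point there are
  holomorphic coordinates \<open>w\<^sub>0, \<dots>, w\<^sub>n\<^sub>-\<^sub>1\<close>, where \<open>2 * n\<close> is the real dimension. The two
  injectivity conditions say that \<open>(w\<^sub>0, \<dots>, w\<^sub>n\<^sub>-\<^sub>1)\<close> is a diffeomorphism from \<open>U\<close> onto an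
  open subset of complex \<open>n\<close>-space.\<close>
definition integrable_structure ::
    "('x, 'e::euclidean_space) chart set \<Rightarrow> (('x, 'e) chart \<Rightarrow> 'e \<Rightarrow> 'e \<Rightarrow> 'e) \<Rightarrow> bool" where
  "integrable_structure A J \<longleftrightarrow>
     (\<forall>c\<in>A. \<forall>x\<in>chart_image c. \<exists>U. open U \<and> x \<in> U \<and> U \<subseteq> chart_image c \<and>
        (\<exists>w :: nat \<Rightarrow> 'e \<Rightarrow> complex. let n = DIM('e) div 2 in
           (\<forall>i<n. smooth_on U (w i)) \<and>
           (\<forall>i<n. \<forall>y\<in>U. \<forall>v. frechet_derivative (w i) (at y) (J c y v) =
                              \<i> * frechet_derivative (w i) (at y) v) \<and>
           (\<forall>y\<in>U. \<forall>z\<in>U. (\<forall>i<n. w i y = w i z) \<longrightarrow> y = z) \<and>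
           (\<forall>y\<in>U. \<forall>v. (\<forall>i<n. frechet_derivative (w i) (at y) v = 0) \<longrightarrow> v = 0)))"

section \<open>Complex-valued covariant tensors at a point\<close>

text \<open>A complex-valued covariant tensor of degree \<open>k\<close> on \<open>'e\<close>, i.e. an element of the \<open>k\<close>-th
  tensor power of the complexified dual of \<open>'e\<close>, is represented as a function on lists of
  vectors that is multilinear on lists of length \<open>k\<close> and vanishes on all other lists.\<close>
type_synonym 'e tensor = "'e list \<Rightarrow> complex"

global_interpretation tensor: vector_space "\<lambda>(a::complex) (\<eta> :: 'i \<Rightarrow> complex) i. a * \<eta> i"
  by unfold_locales
    (simp_all only: fun_eq_iff plus_fun_apply distrib_left distrib_right mult.assoc mult_1_left simp_thms)

definition wedge :: "('e \<Rightarrow> complex) list \<Rightarrow> 'e tensor" where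
  "wedge \<alpha>s = (\<lambda>vs. if length vs = length \<alpha>s
     then \<Sum>\<sigma> | \<sigma> permutes {..<length \<alpha>s}.
            of_int (sign \<sigma>) * (\<Prod>i<length \<alpha>s. (\<alpha>s ! i) (vs ! \<sigma> i))
     else 0)"

definition tensor_product :: "nat \<Rightarrow> 'e tensor \<Rightarrow> 'e tensor \<Rightarrow> 'e tensor" where
  "tensor_product k \<eta> \<theta> = (\<lambda>vs. \<eta> (take k vs) * \<theta> (drop k vs))"

text \<open>In the following, \<open>j\<close> is the almost complex structure at the point.\<close>

definition covectors10 :: "('e::euclidean_space \<Rightarrow> 'e) \<Rightarrow> ('e \<Rightarrow> complex) set" where
  "covectors10 j = {\<alpha>. linear \<alpha> \<and> (\<forall>v. \<alpha> (j v) = \<i> * \<alpha> v)}"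

definition covectors01 :: "('e::euclidean_space \<Rightarrow> 'e) \<Rightarrow> ('e \<Rightarrow> complex) set" where
  "covectors01 j = {\<alpha>. linear \<alpha> \<and> (\<forall>v. \<alpha> (j v) = - \<i> * \<alpha> v)}"

definition Lambda :: "nat \<Rightarrow> nat \<Rightarrow> ('e::euclidean_space \<Rightarrow> 'e) \<Rightarrow> 'e tensor set" where
  "Lambda p q j = tensor.span {wedge (\<alpha>s @ \<beta>s) | \<alpha>s \<beta>s. length \<alpha>s = p \<and> length \<beta>s = q \<and>
     set \<alpha>s \<subseteq> covectors10 j \<and> set \<beta>s \<subseteq> covectors01 j}"

definition type_projection ::
    "nat \<Rightarrow> nat \<Rightarrow> ('e::euclidean_space \<Rightarrow> 'e) \<Rightarrow> 'e tensor \<Rightarrow> 'e tensor" where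
  "type_projection p q j \<eta> = (THE \<zeta>. \<zeta> \<in> Lambda p q j \<and>
     \<eta> - \<zeta> \<in> tensor.span (\<Union>{Lambda p' q' j | p' q'. p' + q' = p + q \<and> (p', q') \<noteq> (p, q)}))"

definition canonical :: "('e::euclidean_space \<Rightarrow> 'e) \<Rightarrow> 'e tensor set" where
  "canonical j = Lambda (DIM('e) div 2) 0 j"

primrec canonical_power :: "nat \<Rightarrow> ('e::euclidean_space \<Rightarrow> 'e) \<Rightarrow> 'e tensor set" where
  "canonical_power 0 j = tensor.span {\<lambda>vs. if vs = [] then 1 else 0}"
| "canonical_power (Suc m) j = tensor.span
     {tensor_product (DIM('e) div 2) \<eta> \<theta> | \<eta> \<theta>. \<eta> \<in> canonical j \<and> \<theta> \<in> canonical_power m j}"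

section \<open>Cauchy--Riemann operators in a chart\<close>

text \<open>Here \<open>s, \<omega> :: 'e \<Rightarrow> 'e tensor\<close> are tensor fields and \<open>j :: 'e \<Rightarrow> 'e \<Rightarrow> 'e\<close> is the almost
  complex structure on an open subset of the coordinate space; all operators are local.\<close>

definition omit :: "nat \<Rightarrow> 'a list \<Rightarrow> 'a list" where
  "omit i vs = take i vs @ drop (Suc i) vs"

definition ext_deriv ::
    "nat \<Rightarrow> ('e::euclidean_space \<Rightarrow> 'e tensor) \<Rightarrow> 'e \<Rightarrow> 'e tensor" where
  "ext_deriv k \<omega> x = (\<lambda>vs. if length vs = Suc k
     then \<Sum>i\<le>k. (-1) ^ i * frechet_derivative (\<lambda>y. \<omega> y (omit i vs)) (at x) (vs ! i)
     else 0)"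

definition dbar :: "nat \<Rightarrow> nat \<Rightarrow> ('e::euclidean_space \<Rightarrow> 'e \<Rightarrow> 'e) \<Rightarrow>
    ('e \<Rightarrow> 'e tensor) \<Rightarrow> 'e \<Rightarrow> 'e tensor" where
  "dbar p q j \<omega> x = type_projection p (Suc q) (j x) (ext_deriv (p + q) \<omega> x)"

text \<open>The map \<open>\<beta> \<otimes> \<eta> \<mapsto> \<beta> \<and> \<eta>\<close> for a covector \<open>\<beta>\<close> and an alternating \<open>\<eta>\<close> of degree \<open>k\<close>.\<close>
definition alternate :: "nat \<Rightarrow> 'e tensor \<Rightarrow> 'e tensor" where
  "alternate k \<tau> = (\<lambda>vs. if length vs = Suc k
     then \<Sum>i\<le>k. (-1) ^ i * \<tau> (vs ! i # omit i vs) else 0)"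

definition dbar_canonical :: "('e::euclidean_space \<Rightarrow> 'e \<Rightarrow> 'e) \<Rightarrow>
    ('e \<Rightarrow> 'e tensor) \<Rightarrow> 'e \<Rightarrow> 'e tensor" where
  "dbar_canonical j s x = (THE \<tau>.
     \<tau> \<in> tensor.span {tensor_product 1 \<beta> \<eta> | \<beta> \<eta>. \<beta> \<in> Lambda 0 1 (j x) \<and> \<eta> \<in> canonical (j x)} \<and>
     alternate (DIM('e) div 2) \<tau> = dbar (DIM('e) div 2) 0 j s x)"

definition local_sections :: "'e::euclidean_space set \<Rightarrow> ('e \<Rightarrow> 'e \<Rightarrow> 'e) \<Rightarrow>
    (('e \<Rightarrow> 'e) \<Rightarrow> 'e tensor set) \<Rightarrow> ('e \<Rightarrow> 'e tensor) set" where
  "local_sections U j F =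
     {s. (\<forall>x\<in>U. s x \<in> F (j x)) \<and> (\<forall>vs. smooth_on U (\<lambda>x. s x vs))}"

text \<open>The right-hand side of the Leibniz rule \<open>\<tau>\<^sub>1 \<otimes> \<theta>\<^sub>2 + \<theta>\<^sub>1 \<otimes> \<tau>\<^sub>2\<close>, where \<open>\<theta>\<^sub>1\<close> has degree \<open>n\<close>, and
  \<open>\<tau>\<^sub>1\<close>, \<open>\<tau>\<^sub>2\<close> have an additional (0,1)-covector slot in first position, which is kept in first
  position.\<close>
definition leibniz ::
    "nat \<Rightarrow> 'e tensor \<Rightarrow> 'e tensor \<Rightarrow> 'e tensor \<Rightarrow> 'e tensor \<Rightarrow> 'e tensor" where
  "leibniz n \<tau>\<^sub>1 \<theta>\<^sub>2 \<theta>\<^sub>1 \<tau>\<^sub>2 = (\<lambda>us. case us of [] \<Rightarrow> 0 | v # vs \<Rightarrow>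
     \<tau>\<^sub>1 (v # take n vs) * \<theta>\<^sub>2 (drop n vs) + \<theta>\<^sub>1 (take n vs) * \<tau>\<^sub>2 (v # drop n vs))"

text \<open>Since the canonical bundle is a line bundle, every section of its power \<open>m + 1\<close> is near every
  point of the form \<open>s\<^sub>1 \<otimes> s\<^sub>2\<close>, so the Leibniz rule for such products determines the operator.
  The value for \<open>m = 0\<close> is a dummy.\<close>
fun dbar_power :: "nat \<Rightarrow> ('e::euclidean_space \<Rightarrow> 'e \<Rightarrow> 'e) \<Rightarrow>
    ('e \<Rightarrow> 'e tensor) \<Rightarrow> 'e \<Rightarrow> 'e tensor" where
  "dbar_power 0 j s x = (\<lambda>_. 0)"
| "dbar_power (Suc 0) j s x = dbar_canonical j s x"
| "dbar_power (Suc (Suc m)) j s x = (THE \<tau>. \<exists>U s\<^sub>1 s\<^sub>2. open U \<and> x \<in> U \<and>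
     s\<^sub>1 \<in> local_sections U j canonical \<and>
     s\<^sub>2 \<in> local_sections U j (canonical_power (Suc m)) \<and>
     (\<forall>y\<in>U. s y = tensor_product (DIM('e) div 2) (s\<^sub>1 y) (s\<^sub>2 y)) \<and>
     \<tau> = leibniz (DIM('e) div 2)
           (dbar_canonical j s\<^sub>1 x) (s\<^sub>2 x) (s\<^sub>1 x) (dbar_power (Suc m) j s\<^sub>2 x))"

section \<open>Global sections, plurigenera and Kodaira dimension\<close>

type_synonym ('x, 'e) tensor_field = "('x, 'e) chart \<Rightarrow> 'e \<Rightarrow> 'e tensor"

global_interpretation tensor_field:
  vector_space "\<lambda>(a::complex) (s :: ('x, 'e) tensor_field) c x vs. a * s c x vs"
  by unfold_locales
    (simp_all only: fun_eq_iff plus_fun_apply distrib_left distrib_right mult.assoc mult_1_left simp_thms)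

text \<open>Smooth sections of the bundle of covariant tensors with fibre \<open>F (J c x)\<close>: local sections
  in all charts that are related by pull-back along the transition maps. They are normalised
  to be zero where they carry no information.\<close>
definition sections :: "('x, 'e::euclidean_space) chart set \<Rightarrow>
    (('x, 'e) chart \<Rightarrow> 'e \<Rightarrow> 'e \<Rightarrow> 'e) \<Rightarrow> (('e \<Rightarrow> 'e) \<Rightarrow> 'e tensor set) \<Rightarrow>
    ('x, 'e) tensor_field set" where
  "sections A J F = {s.
     (\<forall>c x. c \<notin> A \<or> x \<notin> chart_image c \<longrightarrow> s c x = (\<lambda>_. 0)) \<and>
     (\<forall>c\<in>A. s c \<in> local_sections (chart_image c) (J c) F) \<and>
     (\<forall>c\<in>A. \<forall>c'\<in>A. \<forall>x\<in>overlap c c'. \<forall>vs.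
        s c x vs = s c' (transition c c' x)
                     (map (frechet_derivative (transition c c') (at x)) vs))}"

text \<open>Complex dimension of a space of tensor fields.\<close>
definition cdim :: "('x, 'e) tensor_field set \<Rightarrow> enat" where
  "cdim V = (if \<exists>B. finite B \<and> V \<subseteq> tensor_field.span B then enat (tensor_field.dim V) else \<infinity>)"

definition hodge10 :: "('x, 'e::euclidean_space) chart set \<Rightarrow>
    (('x, 'e) chart \<Rightarrow> 'e \<Rightarrow> 'e \<Rightarrow> 'e) \<Rightarrow> enat" where
  "hodge10 A J = cdim {\<gamma> \<in> sections A J (Lambda 1 0).
     \<forall>c\<in>A. \<forall>x\<in>chart_image c. dbar 1 0 (J c) (\<gamma> c) x = (\<lambda>_. 0)}"

definition plurigenus :: "('x, 'e::euclidean_space) chart set \<Rightarrow>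
    (('x, 'e) chart \<Rightarrow> 'e \<Rightarrow> 'e \<Rightarrow> 'e) \<Rightarrow> nat \<Rightarrow> enat" where
  "plurigenus A J m = cdim {s \<in> sections A J (canonical_power m).
     \<forall>c\<in>A. \<forall>x\<in>chart_image c. dbar_power m (J c) (s c) x = (\<lambda>_. 0)}"

text \<open>The logarithm with \<open>log 0 = -\<infinity>\<close>: some plurigenera may vanish even if not all of them do.\<close>
definition log_enat :: "enat \<Rightarrow> ereal" where
  "log_enat N = (case N of enat k \<Rightarrow> if k = 0 then -\<infinity> else ereal (ln (real k)) | \<infinity> \<Rightarrow> \<infinity>)"

definition kodaira_dim :: "('x, 'e::euclidean_space) chart set \<Rightarrow>
    (('x, 'e) chart \<Rightarrow> 'e \<Rightarrow> 'e \<Rightarrow> 'e) \<Rightarrow> ereal" where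
  "kodaira_dim A J = (if \<forall>m\<ge>1. plurigenus A J m = 0 then -\<infinity>
     else limsup (\<lambda>m. log_enat (plurigenus A J m) / ereal (ln (real m))))"

section \<open>The Kodaira--Thurston surface\<close>

definition circle_point :: "real \<Rightarrow> real set" where
  "circle_point t = {s. s - t \<in> \<int>}"

definition heis :: "real \<Rightarrow> real \<Rightarrow> real \<Rightarrow> real^3^3" where
  "heis x y z = vector [vector [1, x, z], vector [0, 1, y], vector [0, 0, 1]]"

definition Nil3 :: "(real^3^3) set" where
  "Nil3 = {heis x y z | x y z. True}"

definition Gamma :: "(real^3^3) set" where
  "Gamma = {M \<in> Nil3. \<forall>i k. M $ i $ k \<in> \<int>}"

definition nil_orbit :: "real^3^3 \<Rightarrow> (real^3^3) set" where
  "nil_orbit M = {N ** M | N. N \<in> Gamma}"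

type_synonym coords = "real \<times> real \<times> real \<times> real"

definition KT :: "(real set \<times> (real^3^3) set) set" where
  "KT = (circle_point ` UNIV) \<times> (nil_orbit ` Nil3)"

definition KT_cover :: "coords \<Rightarrow> real set \<times> (real^3^3) set" where
  "KT_cover = (\<lambda>(t, x, y, z). (circle_point t, nil_orbit (heis x y z)))"

text \<open>The smooth structure for which the covering map is a local diffeomorphism: the charts are its
  local inverses, with coordinates \<open>(t, x, y, z)\<close>.\<close>
definition KT_atlas :: "(real set \<times> (real^3^3) set, coords) chart set" where
  "KT_atlas = {(KT_cover ` V, inv_into V KT_cover) | V. open V \<and> inj_on KT_cover V}"

text \<open>The invariant frame; its expression in the coordinates is the same in all charts.\<close>

definition D_t :: "coords \<Rightarrow> coords" where "D_t = (\<lambda>(t, x, y, z). (1, 0, 0, 0))"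
definition D_x :: "coords \<Rightarrow> coords" where "D_x = (\<lambda>(t, x, y, z). (0, 1, 0, 0))"
definition D_y_plus_xD_z :: "coords \<Rightarrow> coords" where
  "D_y_plus_xD_z = (\<lambda>(t, x, y, z). (0, 0, 1, x))"
definition D_z :: "coords \<Rightarrow> coords" where "D_z = (\<lambda>(t, x, y, z). (0, 0, 0, 1))"

definition KT_J :: "real \<Rightarrow> (real set \<times> (real^3^3) set, coords) chart \<Rightarrow>
    coords \<Rightarrow> coords \<Rightarrow> coords" where
  "KT_J a c p = (THE L. linear L \<and>
     L (D_t p) = D_x p \<and>
     L (D_x p) = - D_t p \<and>
     L (D_y_plus_xD_z p) = (1 / a) *\<^sub>R D_z p \<and>
     L (D_z p) = - (a *\<^sub>R D_y_plus_xD_z p))"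

lemma KT_J_eq:
  "KT_J a c (t, x, y, z) (vt, vx, vy, vz) =
     (- vx, vt, - (a * (vz - x * vy)), vy / a - a * x * (vz - x * vy))"
proof -
  let ?p = "(t, x, y, z) :: coords"
  define L :: "coords \<Rightarrow> coords" where "L = (\<lambda>(vt, vx, vy, vz).
    (- vx, vt, - (a * (vz - x * vy)), vy / a - a * x * (vz - x * vy)))"
  have "KT_J a c ?p = L"
    unfolding KT_J_def
  proof (rule the_equality)
    have "linear L"
      by (rule linearI) (auto simp: L_def algebra_simps add_divide_distrib)
    then show "linear L \<and> L (D_t ?p) = D_x ?p \<and> L (D_x ?p) = - D_t ?p \<and>
      L (D_y_plus_xD_z ?p) = (1 / a) *\<^sub>R D_z ?p \<and> L (D_z ?p) = - (a *\<^sub>R D_y_plus_xD_z ?p)"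
      by (simp add: L_def D_t_def D_x_def D_y_plus_xD_z_def D_z_def)
  next
    fix M :: "coords \<Rightarrow> coords"
    assume M: "linear M \<and> M (D_t ?p) = D_x ?p \<and> M (D_x ?p) = - D_t ?p \<and>
      M (D_y_plus_xD_z ?p) = (1 / a) *\<^sub>R D_z ?p \<and> M (D_z ?p) = - (a *\<^sub>R D_y_plus_xD_z ?p)"
    show "M = L"
    proof
      fix v :: coords
      obtain vt vx vy vz where v: "v = (vt, vx, vy, vz)" by (cases v) auto
      have "v = vt *\<^sub>R D_t ?p + vx *\<^sub>R D_x ?p + vy *\<^sub>R D_y_plus_xD_z ?p + (vz - x * vy) *\<^sub>R D_z ?p"
        by (simp add: v D_t_def D_x_def D_y_plus_xD_z_def D_z_def)
      then have "M v = vt *\<^sub>R M (D_t ?p) + vx *\<^sub>R M (D_x ?p) + vy *\<^sub>R M (D_y_plus_xD_z ?p)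
          + (vz - x * vy) *\<^sub>R M (D_z ?p)"
        using M by (simp only: linear_add linear_scale)
      also have "\<dots> = L v"
        using M by (simp add: v L_def D_t_def D_x_def D_y_plus_xD_z_def D_z_def algebra_simps)
      finally show "M v = L v" .
    qed
  qed
  then show ?thesis by (simp add: L_def)
qed

lemma KT_J_frame:
  shows "linear (KT_J a c p)"
    and "KT_J a c p (D_t p) = D_x p"
    and "KT_J a c p (D_x p) = - D_t p"
    and "KT_J a c p (D_y_plus_xD_z p) = (1 / a) *\<^sub>R D_z p"
    and "KT_J a c p (D_z p) = - (a *\<^sub>R D_y_plus_xD_z p)"
proof -
  obtain t x y z where p: "p = (t, x, y, z)" by (cases p) auto
  show "linear (KT_J a c p)"
    by (rule linearI) (auto simp: p KT_J_eq algebra_simps add_divide_distrib)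
  show "KT_J a c p (D_t p) = D_x p" "KT_J a c p (D_x p) = - D_t p"
    "KT_J a c p (D_y_plus_xD_z p) = (1 / a) *\<^sub>R D_z p"
    "KT_J a c p (D_z p) = - (a *\<^sub>R D_y_plus_xD_z p)"
    by (simp_all add: p KT_J_eq D_t_def D_x_def D_y_plus_xD_z_def D_z_def)
qed

end

theory Submission
  imports Defs "HOL-Complex_Analysis.Complex_Analysis"
begin

text \<open>Write \<open>\<phi>\<^sub>1 = dt + i dx\<close>, \<open>\<phi>\<^sub>2 = dy + i a (dz - x dy)\<close> for the invariant (1,0)-coframe and
  \<open>\<Omega> = \<phi>\<^sub>1 \<and> \<phi>\<^sub>2\<close>. The structure equations give
  \<open>\<partial>\<bar>(f \<Omega>\<^sup>m) = (\<partial>\<bar>f + (m a / 4) f \<phi>\<bar>\<^sub>1) \<otimes> \<Omega>\<^sup>m\<close>, so a pluricanonical section is a function \<open>f\<close> on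
  the covering space \<open>\<real>\<^sup>4\<close>, invariant under deck transformations, with \<open>f\<^sub>y + (x + i/a) f\<^sub>z = 0\<close> and
  \<open>f\<^sub>t + i f\<^sub>x + (m a / 2) f = 0\<close>. The first equation makes \<open>f\<close> a bounded entire function on every
  \<open>(y, z)\<close>-plane, hence constant there; the second one makes \<open>f exp (- i m a x / 2)\<close> a bounded entire
  function of \<open>t + i x\<close>, hence \<open>f = C exp (i m a x / 2)\<close>. Periodicity in \<open>x\<close> forces \<open>C = 0\<close> unless
  \<open>m a \<in> 4 \<pi> \<int>\<close>. A form \<open>f \<phi>\<^sub>1 + g \<phi>\<^sub>2\<close> in the kernel of \<open>\<partial>\<bar>\<close> leads to the same equations for \<open>g\<close> with
  \<open>m = 1\<close>, and to \<open>f\<^sub>y + (x + i/a) f\<^sub>z = - (a / 2) g\<close>; boundedness of \<open>f\<close> gives \<open>g = 0\<close>, and then \<open>f\<close> is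
  constant. Finally, the commutator of the (0,1)-fields \<open>\<partial>\<^sub>t + i \<partial>\<^sub>x\<close> and
  \<open>\<partial>\<^sub>y + (x + i/a) \<partial>\<^sub>z\<close> is \<open>i \<partial>\<^sub>z\<close>, so the differential of every holomorphic function vanishes on
  \<open>\<partial>\<^sub>z\<close>, which excludes holomorphic coordinates.\<close>

section \<open>Smooth calculus\<close>

text \<open>Since \<open>S\<close> is open, the values on \<open>S\<close> alone determine
  derivatives at its points, although \<open>Ck_on\<close> differentiates along the full filter
  \<open>at x\<close>.\<close>

lemma Ck_on_cong:
  assumes "open S" "\<And>x. x \<in> S \<Longrightarrow> f x = g x" "Ck_on k S f"
  shows "Ck_on k S g"
  using assms(2,3)
proof (induction k arbitrary: f g)
  case 0
  then show ?case by (simp cong: continuous_on_cong)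
next
  case (Suc k)
  have diff: "f differentiable (at x)" if "x \<in> S" for x
    using Suc.prems that by simp
  have "g differentiable (at x)" if "x \<in> S" for x
    using diff[OF that] has_derivative_transform_within_open[OF _ assms(1) that] Suc.prems(1)
    unfolding differentiable_def by metis
  moreover have "frechet_derivative f (at x) = frechet_derivative g (at x)" if "x \<in> S" for x
    using frechet_derivative_transform_within_open[OF diff[OF that] assms(1) that] Suc.prems(1) by auto
  ultimately show ?case
    using Suc.prems(2) Suc.IH[where f = "\<lambda>x. frechet_derivative f (at x) v"
      and g = "\<lambda>x. frechet_derivative g (at x) v" for v] by simp
qed

text \<open>The product rule leaves one factor undifferentiated, so inductions on the order must be
  able to lower it by one.\<close>

lemma Ck_on_SucD: "Ck_on (Suc k) S f \<Longrightarrow> Ck_on k S f"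
proof (induction k arbitrary: f)
  case 0
  then show ?case
    by (auto intro!: continuous_at_imp_continuous_on differentiable_imp_continuous_within)
next
  case (Suc k)
  then show ?case by (metis Ck_on.simps(2))
qed

lemma Ck_on_subset: "Ck_on k S f \<Longrightarrow> T \<subseteq> S \<Longrightarrow> Ck_on k T f"
  by (induction k arbitrary: f) (auto intro: continuous_on_subset)

lemma Ck_on_local:
  assumes "\<And>x. x \<in> S \<Longrightarrow> \<exists>U. open U \<and> x \<in> U \<and> Ck_on k U f"
  shows "Ck_on k S f"
  using assms
proof (induction k arbitrary: f)
  case 0
  then show ?case
    by (auto intro!: continuous_at_imp_continuous_on simp: continuous_on_eq_continuous_at)
       (meson continuous_on_eq_continuous_at)
next
  case (Suc k)
  show ?case
    unfolding Ck_on.simps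
  proof (intro conjI ballI allI)
    show "f differentiable (at x)" if "x \<in> S" for x
      using Suc.prems[OF that] by auto
    show "Ck_on k S (\<lambda>x. frechet_derivative f (at x) v)" for v
    proof (rule Suc.IH)
      show "\<exists>U. open U \<and> x \<in> U \<and> Ck_on k U (\<lambda>x. frechet_derivative f (at x) v)" if "x \<in> S" for x
        using Suc.prems[OF that] by auto
    qed
  qed
qed

text \<open>Uniqueness of Frechet derivatives allows an explicit family \<open>f'\<close> in place
  of \<open>frechet_derivative\<close>, so that the usual rules of differentiation apply.\<close>

lemma Ck_on_SucI:
  assumes "open S" "\<And>x. x \<in> S \<Longrightarrow> (f has_derivative f' x) (at x)" "\<And>v. Ck_on k S (\<lambda>x. f' x v)"
  shows "Ck_on (Suc k) S f"
proof -
  have "frechet_derivative f (at x) = f' x" if "x \<in> S" for x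
    using frechet_derivative_at[OF assms(2)[OF that]] by simp
  then show ?thesis
    using assms by (auto simp: differentiable_def intro!: Ck_on_cong[OF assms(1) _ assms(3)])
qed

lemma Ck_on_const: "open S \<Longrightarrow> Ck_on k S (\<lambda>x. c)"
proof (induction k arbitrary: c)
  case (Suc k)
  then show ?case by (intro Ck_on_SucI[where f' = "\<lambda>x v. 0"]) auto
qed auto

lemma Ck_on_bounded_linear:
  assumes "open S" "bounded_linear L"
  shows "Ck_on k S L"
proof (cases k)
  case 0
  then show ?thesis using assms(2) by (simp add: linear_continuous_on)
next
  case (Suc n)
  show ?thesis
    unfolding Suc
    by (rule Ck_on_SucI[where f' = "\<lambda>x v. L v", OF assms(1)])
      (intro Ck_on_const assms bounded_linear_imp_has_derivative)+
qed

lemma Ck_on_has_derivative: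
  "Ck_on (Suc k) S f \<Longrightarrow> x \<in> S \<Longrightarrow> (f has_derivative frechet_derivative f (at x)) (at x)"
  by (simp add: frechet_derivative_works)

lemma Ck_on_add:
  assumes "open S" "Ck_on k S f" "Ck_on k S g"
  shows "Ck_on k S (\<lambda>x. f x + g x)"
  using assms(2,3)
proof (induction k arbitrary: f g)
  case 0
  then show ?case by (auto intro: continuous_on_add)
next
  case (Suc k)
  show ?case
  proof (rule Ck_on_SucI[OF assms(1)])
    show "((\<lambda>x. f x + g x) has_derivative
        (\<lambda>v. frechet_derivative f (at x) v + frechet_derivative g (at x) v)) (at x)" if "x \<in> S" for x
      using Suc.prems that by (intro has_derivative_add Ck_on_has_derivative)
  qed (use Suc in auto)
qed

lemma (in bounded_bilinear) Ck_on_prod: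
  assumes "open S" "Ck_on k S f" "Ck_on k S g"
  shows "Ck_on k S (\<lambda>x. prod (f x) (g x))"
  using assms(2,3)
proof (induction k arbitrary: f g)
  case 0
  then show ?case by (auto intro: continuous_on)
next
  case (Suc k)
  show ?case
  proof (rule Ck_on_SucI[OF assms(1)])
    show "((\<lambda>x. prod (f x) (g x)) has_derivative
        (\<lambda>v. prod (f x) (frechet_derivative g (at x) v) + prod (frechet_derivative f (at x) v) (g x))) (at x)"
      if "x \<in> S" for x
      using Suc.prems that by (intro FDERIV Ck_on_has_derivative)
    show "Ck_on k S (\<lambda>x. prod (f x) (frechet_derivative g (at x) v) + prod (frechet_derivative f (at x) v) (g x))" for v
      using Suc.prems Ck_on_SucD[OF Suc.prems(1)] Ck_on_SucD[OF Suc.prems(2)]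
      by (auto intro!: Ck_on_add[OF assms(1)] Suc.IH)
  qed
qed

lemma smooth_on_const: "open S \<Longrightarrow> smooth_on S (\<lambda>x. c)"
  by (simp add: smooth_on_def Ck_on_const)

lemma smooth_on_bounded_linear: "open S \<Longrightarrow> bounded_linear L \<Longrightarrow> smooth_on S L"
  by (simp add: smooth_on_def Ck_on_bounded_linear)

lemma smooth_on_add: "open S \<Longrightarrow> smooth_on S f \<Longrightarrow> smooth_on S g \<Longrightarrow> smooth_on S (\<lambda>x. f x + g x)"
  by (simp add: smooth_on_def Ck_on_add)

lemma smooth_on_mult:
  fixes f g :: "_ \<Rightarrow> 'b::real_normed_algebra"
  shows "open S \<Longrightarrow> smooth_on S f \<Longrightarrow> smooth_on S g \<Longrightarrow> smooth_on S (\<lambda>x. f x * g x)"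
  by (simp add: smooth_on_def bounded_bilinear.Ck_on_prod[OF bounded_bilinear_mult])

lemma smooth_on_scaleR:
  "open S \<Longrightarrow> smooth_on S f \<Longrightarrow> smooth_on S g \<Longrightarrow> smooth_on S (\<lambda>x. f x *\<^sub>R g x)"
  by (simp add: smooth_on_def bounded_bilinear.Ck_on_prod[OF bounded_bilinear_scaleR])

lemma smooth_on_subset: "smooth_on S f \<Longrightarrow> T \<subseteq> S \<Longrightarrow> smooth_on T f"
  by (auto simp: smooth_on_def intro: Ck_on_subset)

lemma smooth_on_cong:
  "open S \<Longrightarrow> (\<And>x. x \<in> S \<Longrightarrow> f x = g x) \<Longrightarrow> smooth_on S f \<Longrightarrow> smooth_on S g"
  unfolding smooth_on_def using Ck_on_cong by blast

text \<open>Transition maps and glued tensor fields are given by a single formula only near each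
  point, so their smoothness is checked locally.\<close>

lemma smooth_on_local:
  assumes "\<And>x. x \<in> S \<Longrightarrow> \<exists>U. open U \<and> x \<in> U \<and> smooth_on U f"
  shows "smooth_on S f"
  unfolding smooth_on_def
proof
  show "Ck_on k S f" for k
    by (rule Ck_on_local) (metis assms smooth_on_def)
qed

lemma smooth_on_imp_has_derivative:
  "smooth_on S f \<Longrightarrow> x \<in> S \<Longrightarrow> (f has_derivative frechet_derivative f (at x)) (at x)"
  unfolding smooth_on_def by (meson Ck_on_has_derivative)

text \<open>Each directional derivative is the constant \<open>L v\<close> times the function
  itself, so the induction on the order reproduces its own hypothesis.\<close>

lemma smooth_on_exp_linear:
  fixes L :: "'a::real_normed_vector \<Rightarrow> complex"
  assumes "open S" "bounded_linear L"
  shows "smooth_on S (\<lambda>x. exp (L x))"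
proof -
  have exp_deriv: "((\<lambda>x. exp (L x)) has_derivative (\<lambda>v. L v * exp (L x))) (at x)" for x
  proof -
    have "(exp has_derivative (\<lambda>h. exp (L x) * h)) (at (L x))"
      using DERIV_exp[of "L x"] by (simp add: has_field_derivative_def)
    from has_derivative_compose[OF bounded_linear_imp_has_derivative[OF assms(2)] this]
    show ?thesis by (simp add: mult.commute)
  qed
  have "Ck_on k S (\<lambda>x. exp (L x))" for k
  proof (induction k)
    case 0
    then show ?case using assms by (auto intro!: continuous_intros intro: linear_continuous_on)
  next
    case (Suc k)
    show ?case
      by (rule Ck_on_SucI[OF assms(1) exp_deriv])
        (rule bounded_bilinear.Ck_on_prod[OF bounded_bilinear_mult assms(1) Ck_on_const[OF assms(1)] Suc])
  qed
  then show ?thesis by (simp add: smooth_on_def)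
qed

section \<open>Symmetry of mixed second derivatives\<close>

lemma second_difference_mean_value:
  fixes f :: "'a::real_normed_vector \<Rightarrow> real"
  assumes h: "0 < h"
    and S: "\<And>s t. 0 \<le> s \<Longrightarrow> s \<le> h \<Longrightarrow> 0 \<le> t \<Longrightarrow> t \<le> h \<Longrightarrow> x + s *\<^sub>R u + t *\<^sub>R v \<in> S"
    and fu: "\<And>y. y \<in> S \<Longrightarrow> (f has_derivative f' y) (at y)"
    and fuv: "\<And>y. y \<in> S \<Longrightarrow> ((\<lambda>z. f' z u) has_derivative f'' y) (at y)"
  shows "\<exists>s t. 0 < s \<and> s < h \<and> 0 < t \<and> t < h \<and>
    f (x + h *\<^sub>R u + h *\<^sub>R v) - f (x + h *\<^sub>R u) - f (x + h *\<^sub>R v) + f x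
      = h * h * f'' (x + s *\<^sub>R u + t *\<^sub>R v) v"
proof -
  let ?p = "\<lambda>s t. x + s *\<^sub>R u + t *\<^sub>R v"
  have D1: "DERIV (\<lambda>s. f (x + s *\<^sub>R u + t *\<^sub>R v)) s :> f' (x + s *\<^sub>R u + t *\<^sub>R v) u"
    if "0 \<le> s" "s \<le> h" "0 \<le> t" "t \<le> h" for s t
  proof -
    have "((\<lambda>s. f (x + s *\<^sub>R u + t *\<^sub>R v)) has_derivative
        (\<lambda>r. f' (x + s *\<^sub>R u + t *\<^sub>R v) (r *\<^sub>R u))) (at s)"
      by (rule has_derivative_compose[where f = "\<lambda>s. ?p s t" and g = f, OF _ fu]) (use that S in \<open>auto intro!: derivative_eq_intros\<close>)
    then show ?thesis
      using linear_scale[OF has_derivative_linear[OF fu[of "?p s t"]]] S[OF that]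
      by (simp add: has_field_derivative_def mult_commute_abs)
  qed
  have D2: "DERIV (\<lambda>t. f' (x + s *\<^sub>R u + t *\<^sub>R v) u) t :> f'' (x + s *\<^sub>R u + t *\<^sub>R v) v"
    if "0 \<le> s" "s \<le> h" "0 \<le> t" "t \<le> h" for s t
  proof -
    have "((\<lambda>t. f' (x + s *\<^sub>R u + t *\<^sub>R v) u) has_derivative
        (\<lambda>r. f'' (x + s *\<^sub>R u + t *\<^sub>R v) (r *\<^sub>R v))) (at t)"
      by (rule has_derivative_compose[where f = "\<lambda>t. ?p s t" and g = "\<lambda>y. f' y u", OF _ fuv]) (use that S in \<open>auto intro!: derivative_eq_intros\<close>)
    then show ?thesis
      using linear_scale[OF has_derivative_linear[OF fuv[of "?p s t"]]] S[OF that]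
      by (simp add: has_field_derivative_def mult_commute_abs)
  qed
  \<comment> \<open>Mean value theorem in \<open>s\<close> for the difference between the sides
    \<open>t = h\<close> and \<open>t = 0\<close> of the square; the terms
    \<open>0 *\<^sub>R\<close> bring the corners into the shape used in \<open>D1\<close>.\<close>
  have "\<exists>s>0. s < h \<and>
      (f (x + h *\<^sub>R u + h *\<^sub>R v) - f (x + h *\<^sub>R u + 0 *\<^sub>R v)) - (f (x + 0 *\<^sub>R u + h *\<^sub>R v) - f (x + 0 *\<^sub>R u + 0 *\<^sub>R v))
      = (h - 0) * (f' (x + s *\<^sub>R u + h *\<^sub>R v) u - f' (x + s *\<^sub>R u + 0 *\<^sub>R v) u)"
    using h by (intro MVT2 DERIV_diff D1) auto
  then obtain s where s: "0 < s" "s < h" and s_eq: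
      "f (x + h *\<^sub>R u + h *\<^sub>R v) - f (x + h *\<^sub>R u) - f (x + h *\<^sub>R v) + f x
      = h * (f' (x + s *\<^sub>R u + h *\<^sub>R v) u - f' (x + s *\<^sub>R u + 0 *\<^sub>R v) u)"
    by (auto simp: algebra_simps)
  have "\<exists>t>0. t < h \<and> f' (x + s *\<^sub>R u + h *\<^sub>R v) u - f' (x + s *\<^sub>R u + 0 *\<^sub>R v) u
      = (h - 0) * f'' (x + s *\<^sub>R u + t *\<^sub>R v) v"
    using h s by (intro MVT2 D2) auto
  then show ?thesis using s s_eq by auto
qed

text \<open>The mean value theorem, taken in either order, writes the same second difference as
  \<open>h * h\<close> times either mixed derivative at some point of a small square; continuity at
  \<open>x\<close> then forces the two to agree.\<close>

lemma second_derivative_symmetric_real: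
  fixes f :: "'a::real_normed_vector \<Rightarrow> real"
  assumes S: "open S" "x \<in> S"
    and f': "\<And>y. y \<in> S \<Longrightarrow> (f has_derivative f' y) (at y)"
    and fu: "\<And>y. y \<in> S \<Longrightarrow> ((\<lambda>z. f' z u) has_derivative fu y) (at y)"
    and fv: "\<And>y. y \<in> S \<Longrightarrow> ((\<lambda>z. f' z v) has_derivative fv y) (at y)"
    and cont: "continuous_on S (\<lambda>y. fu y v)" "continuous_on S (\<lambda>y. fv y u)"
  shows "fu x v = fv x u"
proof (rule ccontr)
  assume "fu x v \<noteq> fv x u"
  \<comment> \<open>Half the gap: no number is closer than \<open>e\<close> to both
    \<open>fu x v\<close> and \<open>fv x u\<close>.\<close>
  define e where "e = \<bar>fu x v - fv x u\<bar> / 2"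
  have e: "e > 0" using \<open>fu x v \<noteq> fv x u\<close> by (simp add: e_def)
  have "isCont (\<lambda>y. fu y v) x" "isCont (\<lambda>y. fv y u) x"
    using cont S by (auto simp: continuous_on_eq_continuous_at)
  then have "\<forall>e>0. \<exists>d>0. \<forall>y. dist y x < d \<longrightarrow> dist (fu y v) (fu x v) < e"
    "\<forall>e>0. \<exists>d>0. \<forall>y. dist y x < d \<longrightarrow> dist (fv y u) (fv x u) < e"
    by (simp_all add: continuous_at_eps_delta)
  then obtain d1 d2 where d: "d1 > 0" "d2 > 0"
    "\<And>y. dist y x < d1 \<Longrightarrow> dist (fu y v) (fu x v) < e"
    "\<And>y. dist y x < d2 \<Longrightarrow> dist (fv y u) (fv x u) < e"
    using e by metis
  obtain d3 where d3: "d3 > 0" "ball x d3 \<subseteq> S"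
    using S open_contains_ball by metis
  define d where "d = min d1 (min d2 d3)"
  \<comment> \<open>Chosen so that the square of side \<open>h\<close> spanned by \<open>u\<close>
    and \<open>v\<close> stays within distance \<open>d\<close> of \<open>x\<close>; the summand 1
    covers \<open>u = v = 0\<close>.\<close>
  define h where "h = d / (2 * (norm u + norm v + 1))"
  have h: "h > 0" "h * (norm u + norm v) < d"
  proof -
    have N: "norm u + norm v + 1 > 0" using norm_ge_zero[of u] norm_ge_zero[of v] by linarith
    have "d > 0" using d d3 by (simp add: d_def)
    then show "h > 0" using N by (simp add: h_def)
    have "h * (norm u + norm v) < h * (2 * (norm u + norm v + 1))"
      using N \<open>h > 0\<close> by (intro mult_strict_left_mono) auto
    also have "\<dots> = d" using N by (simp add: h_def)
    finally show "h * (norm u + norm v) < d" .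
  qed
  \<comment> \<open>Phrased with the sum of the norms, which is symmetric, so that it serves both
    orders \<open>(u, v)\<close> and \<open>(v, u)\<close>.\<close>
  have near: "dist (x + s *\<^sub>R u' + t *\<^sub>R v') x < d"
    if "0 \<le> s" "s \<le> h" "0 \<le> t" "t \<le> h" "norm u' + norm v' = norm u + norm v" for s t u' v'
  proof -
    have "norm (s *\<^sub>R u' + t *\<^sub>R v') \<le> s * norm u' + t * norm v'"
      using norm_triangle_ineq[of "s *\<^sub>R u'" "t *\<^sub>R v'"] that by simp
    also have "\<dots> \<le> h * norm u' + h * norm v'"
      using that by (intro add_mono mult_right_mono) auto
    also have "\<dots> = h * (norm u + norm v)"
      using that(5) by (simp flip: distrib_left)
    finally show ?thesis using h(2) by (simp add: dist_norm add.assoc)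
  qed
  have inS: "x + s *\<^sub>R u' + t *\<^sub>R v' \<in> S"
    if "0 \<le> s" "s \<le> h" "0 \<le> t" "t \<le> h" "norm u' + norm v' = norm u + norm v" for s t u' v'
    using near[OF that] d3(2) by (auto simp: d_def dist_commute)
  have "\<exists>s t. 0 < s \<and> s < h \<and> 0 < t \<and> t < h \<and>
      f (x + h *\<^sub>R u + h *\<^sub>R v) - f (x + h *\<^sub>R u) - f (x + h *\<^sub>R v) + f x
      = h * h * fu (x + s *\<^sub>R u + t *\<^sub>R v) v"
    by (rule second_difference_mean_value[where S = S, OF h(1) inS f' fu]) auto
  then obtain s t where st: "0 < s" "s < h" "0 < t" "t < h"
    and st_eq: "f (x + h *\<^sub>R u + h *\<^sub>R v) - f (x + h *\<^sub>R u) - f (x + h *\<^sub>R v) + f x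
      = h * h * fu (x + s *\<^sub>R u + t *\<^sub>R v) v"
    by auto
  have "\<exists>s t. 0 < s \<and> s < h \<and> 0 < t \<and> t < h \<and>
      f (x + h *\<^sub>R v + h *\<^sub>R u) - f (x + h *\<^sub>R v) - f (x + h *\<^sub>R u) + f x
      = h * h * fv (x + s *\<^sub>R v + t *\<^sub>R u) u"
    by (rule second_difference_mean_value[where S = S, OF h(1) inS f' fv]) auto
  then obtain s' t' where st': "0 < s'" "s' < h" "0 < t'" "t' < h"
    and st'_eq: "f (x + h *\<^sub>R v + h *\<^sub>R u) - f (x + h *\<^sub>R v) - f (x + h *\<^sub>R u) + f x
      = h * h * fv (x + s' *\<^sub>R v + t' *\<^sub>R u) u"
    by auto
  have "fu (x + s *\<^sub>R u + t *\<^sub>R v) v = fv (x + s' *\<^sub>R v + t' *\<^sub>R u) u"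
  proof -
    have "f (x + h *\<^sub>R v + h *\<^sub>R u) = f (x + h *\<^sub>R u + h *\<^sub>R v)" by (simp add: ac_simps)
    then have "h * h * fu (x + s *\<^sub>R u + t *\<^sub>R v) v = h * h * fv (x + s' *\<^sub>R v + t' *\<^sub>R u) u"
      using st_eq st'_eq by linarith
    then show ?thesis using h(1) by simp
  qed
  moreover have "dist (fu (x + s *\<^sub>R u + t *\<^sub>R v) v) (fu x v) < e"
    using near[of s t u v] st d(3) by (auto simp: d_def)
  moreover have "dist (fv (x + s' *\<^sub>R v + t' *\<^sub>R u) u) (fv x u) < e"
    using near[of s' t' v u] st' d(4) by (auto simp: d_def)
  ultimately show False
    unfolding e_def dist_real_def by argo
qed

text \<open>The mean value argument is real, hence it is applied to real and imaginary parts
  separately.\<close>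

lemma second_derivative_symmetric:
  fixes f :: "'a::real_normed_vector \<Rightarrow> complex"
  assumes S: "open S" "x \<in> S"
    and f': "\<And>y. y \<in> S \<Longrightarrow> (f has_derivative f' y) (at y)"
    and fu: "\<And>y. y \<in> S \<Longrightarrow> ((\<lambda>z. f' z u) has_derivative fu y) (at y)"
    and fv: "\<And>y. y \<in> S \<Longrightarrow> ((\<lambda>z. f' z v) has_derivative fv y) (at y)"
    and cont: "continuous_on S (\<lambda>y. fu y v)" "continuous_on S (\<lambda>y. fv y u)"
  shows "fu x v = fv x u"
proof (rule complex_eqI)
  show "Re (fu x v) = Re (fv x u)"
    by (rule second_derivative_symmetric_real[OF S, where f = "\<lambda>y. Re (f y)" and f' = "\<lambda>y v. Re (f' y v)"
        and fu = "\<lambda>y v. Re (fu y v)" and fv = "\<lambda>y v. Re (fv y v)"])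
      (use assms in \<open>auto intro!: has_derivative_Re continuous_on_Re\<close>)
  show "Im (fu x v) = Im (fv x u)"
    by (rule second_derivative_symmetric_real[OF S, where f = "\<lambda>y. Im (f y)" and f' = "\<lambda>y v. Im (f' y v)"
        and fu = "\<lambda>y v. Im (fu y v)" and fv = "\<lambda>y v. Im (fv y v)"])
      (use assms in \<open>auto intro!: has_derivative_Im continuous_on_Im\<close>)
qed

section \<open>The covering and the atlas\<close>

lemma heis_mult: "heis k l n ** heis x y z = heis (k + x) (l + y) (n + k * y + z)"
  by (simp add: heis_def matrix_matrix_mult_def vec_eq_iff forall_3 sum_3)

lemma heis_inject: "heis x y z = heis x' y' z' \<longleftrightarrow> x = x' \<and> y = y' \<and> z = z'"
  by (auto simp: heis_def vec_eq_iff forall_3)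

lemma Gamma_eq: "Gamma = {heis (of_int k) (of_int l) (of_int n) | k l n. True}"
proof -
  have "heis x y z \<in> Gamma \<longleftrightarrow> x \<in> \<int> \<and> y \<in> \<int> \<and> z \<in> \<int>" for x y z
  proof
    assume "heis x y z \<in> Gamma"
    then have "heis x y z $ 1 $ 2 \<in> \<int>" "heis x y z $ 2 $ 3 \<in> \<int>" "heis x y z $ 1 $ 3 \<in> \<int>"
      by (auto simp: Gamma_def)
    then show "x \<in> \<int> \<and> y \<in> \<int> \<and> z \<in> \<int>" by (simp add: heis_def)
  next
    assume "x \<in> \<int> \<and> y \<in> \<int> \<and> z \<in> \<int>"
    then have "\<forall>i k. heis x y z $ i $ k \<in> \<int>" by (simp add: heis_def forall_3)
    then show "heis x y z \<in> Gamma" by (auto simp: Gamma_def Nil3_def)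
  qed
  moreover have "M \<in> Gamma \<Longrightarrow> \<exists>x y z. M = heis x y z" for M
    by (auto simp: Gamma_def Nil3_def)
  ultimately have "M \<in> Gamma \<longleftrightarrow> (\<exists>x\<in>\<int>. \<exists>y\<in>\<int>. \<exists>z\<in>\<int>. M = heis x y z)" for M
    by metis
  then show ?thesis unfolding Ints_def by blast
qed

text \<open>The action on the universal cover: an integer translation in \<open>t\<close> and left
  multiplication by \<open>heis k l n\<close> in \<open>(x, y, z)\<close>, whence the shear term
  \<open>k * y\<close>.\<close>

definition deck :: "int \<times> int \<times> int \<times> int \<Rightarrow> coords \<Rightarrow> coords" where
  "deck = (\<lambda>(d, k, l, n) (t, x, y, z). (t + of_int d, x + of_int k, y + of_int l, z + of_int n + of_int k * y))"

text \<open>The linear part of the affine map \<open>deck g\<close>, and therefore its derivative at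
  every point.\<close>

definition deck_linear :: "int \<times> int \<times> int \<times> int \<Rightarrow> coords \<Rightarrow> coords" where
  "deck_linear = (\<lambda>(d, k, l, n) (t, x, y, z). (t, x, y, z + of_int k * y))"

lemma deck_eq [simp]:
  "deck (d, k, l, n) (t, x, y, z) = (t + of_int d, x + of_int k, y + of_int l, z + of_int n + of_int k * y)"
  by (simp add: deck_def)

lemma deck_linear_eq [simp]: "deck_linear (d, k, l, n) (t, x, y, z) = (t, x, y, z + of_int k * y)"
  by (simp add: deck_linear_def)

lemma bounded_linear_deck_linear: "bounded_linear (deck_linear g)"
proof -
  obtain d k l n where g: "g = (d, k, l, n)" by (cases g) auto
  have "linear (deck_linear g)"
    by (rule linearI) (auto simp: g algebra_simps)
  then show ?thesis by (simp add: linear_conv_bounded_linear)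
qed

lemma deck_conv_linear: "deck g = (\<lambda>p. deck_linear g p + deck g 0)"
proof
  fix p :: coords
  obtain d k l n t x y z where "g = (d, k, l, n)" "p = (t, x, y, z)" by (cases g, cases p) auto
  then show "deck g p = deck_linear g p + deck g 0" by (simp add: zero_prod_def)
qed

lemma has_derivative_deck: "(deck g has_derivative deck_linear g) (at p)"
proof -
  have "((\<lambda>p. deck_linear g p + deck g 0) has_derivative deck_linear g) (at p)"
    by (auto intro!: derivative_eq_intros bounded_linear.has_derivative[OF bounded_linear_deck_linear])
  then show ?thesis by (subst deck_conv_linear)
qed

lemma smooth_on_deck: "open S \<Longrightarrow> smooth_on S (deck g)"
  by (subst deck_conv_linear)
    (intro smooth_on_add smooth_on_const smooth_on_bounded_linear bounded_linear_deck_linear)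

lemma continuous_on_deck: "continuous_on S (deck g)"
  by (meson continuous_at_imp_continuous_on has_derivative_continuous has_derivative_deck)

lemma circle_point_eq_iff: "circle_point t = circle_point t' \<longleftrightarrow> (\<exists>d::int. t' = t + of_int d)"
proof
  assume "circle_point t = circle_point t'"
  moreover have "t' \<in> circle_point t'" by (simp add: circle_point_def)
  ultimately have "t' - t \<in> \<int>" by (auto simp: circle_point_def)
  then show "\<exists>d::int. t' = t + of_int d" by (auto elim!: Ints_cases simp: algebra_simps)
next
  assume "\<exists>d::int. t' = t + of_int d"
  then obtain d :: int where d: "t' = t + of_int d" ..
  have "s - t \<in> \<int> \<longleftrightarrow> s - t' \<in> \<int>" for s
    using Ints_add[of "s - t'" "of_int d"] Ints_diff[of "s - t" "of_int d"] d by (auto simp: algebra_simps)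
  then show "circle_point t = circle_point t'" by (simp add: circle_point_def)
qed

lemma nil_orbit_eq_iff:
  "nil_orbit (heis x y z) = nil_orbit (heis x' y' z') \<longleftrightarrow>
    (\<exists>k l n :: int. heis x' y' z' = heis (of_int k) (of_int l) (of_int n) ** heis x y z)"
proof
  assume eq: "nil_orbit (heis x y z) = nil_orbit (heis x' y' z')"
  have "heis 0 0 0 \<in> Gamma"
    unfolding Gamma_eq by (rule CollectI, intro exI[of _ 0]) simp
  then have "heis x' y' z' \<in> nil_orbit (heis x' y' z')"
    unfolding nil_orbit_def by (intro CollectI exI[of _ "heis 0 0 0"]) (simp add: heis_mult)
  then have "heis x' y' z' \<in> nil_orbit (heis x y z)" by (simp add: eq)
  then show "\<exists>k l n :: int. heis x' y' z' = heis (of_int k) (of_int l) (of_int n) ** heis x y z"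
    unfolding nil_orbit_def Gamma_eq by blast
next
  assume "\<exists>k l n :: int. heis x' y' z' = heis (of_int k) (of_int l) (of_int n) ** heis x y z"
  then obtain k l n :: int where eq: "heis x' y' z' = heis (of_int k) (of_int l) (of_int n) ** heis x y z"
    by blast
  have "N ** heis x' y' z' \<in> nil_orbit (heis x y z)" if N: "N \<in> Gamma" for N
  proof -
    obtain k' l' n' :: int where N': "N = heis (of_int k') (of_int l') (of_int n')"
      using N by (auto simp: Gamma_eq)
    have "N ** heis (of_int k) (of_int l) (of_int n) = heis (of_int (k' + k)) (of_int (l' + l)) (of_int (n' + k' * l + n))"
      by (simp add: N' heis_mult)
    then have "N ** heis (of_int k) (of_int l) (of_int n) \<in> Gamma" unfolding Gamma_eq by blast
    then show ?thesis
      unfolding nil_orbit_def eq matrix_mul_assoc by blast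
  qed
  moreover have "N ** heis x y z \<in> nil_orbit (heis x' y' z')" if N: "N \<in> Gamma" for N
  proof -
    obtain k' l' n' :: int where N': "N = heis (of_int k') (of_int l') (of_int n')"
      using N by (auto simp: Gamma_eq)
    \<comment> \<open>\<open>M\<close> is \<open>N\<close> times the inverse of
      \<open>heis k l n\<close>, written out in integer coordinates.\<close>
    define M where "M = heis (of_int (k' - k)) (of_int (l' - l)) (of_int (n' - n - (k' - k) * l))"
    have "M \<in> Gamma" unfolding Gamma_eq M_def by blast
    moreover have "N ** heis x y z = M ** heis x' y' z'"
      unfolding eq matrix_mul_assoc M_def N' heis_mult by (simp add: algebra_simps)
    ultimately show ?thesis unfolding nil_orbit_def by blast
  qed
  ultimately show "nil_orbit (heis x y z) = nil_orbit (heis x' y' z')"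
    unfolding nil_orbit_def by blast
qed

text \<open>The fibres of the covering are the deck orbits; from here on the quotient is handled
  through \<open>deck\<close> alone.\<close>

lemma KT_cover_eq_iff: "KT_cover p = KT_cover q \<longleftrightarrow> (\<exists>g. q = deck g p)"
proof -
  obtain t x y z t' x' y' z' where pq: "p = (t, x, y, z)" "q = (t', x', y', z')"
    by (cases p, cases q) auto
  have "KT_cover p = KT_cover q \<longleftrightarrow> (\<exists>d::int. t' = t + of_int d) \<and>
      (\<exists>k l n :: int. x' = x + of_int k \<and> y' = y + of_int l \<and> z' = z + of_int n + of_int k * y)"
    by (simp add: pq KT_cover_def circle_point_eq_iff nil_orbit_eq_iff heis_mult heis_inject algebra_simps)
  also have "\<dots> \<longleftrightarrow> (\<exists>g. q = deck g p)"
    unfolding split_paired_Ex pq deck_eq prod.inject by blast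
  finally show ?thesis .
qed

text \<open>Two points of a ball of radius 1/2 are less than 1 apart, which leaves no room for a
  nonzero integer shift.\<close>

lemma inj_on_KT_cover_ball: "inj_on KT_cover (ball p (1/2))"
proof (rule inj_onI)
  fix q r assume qr: "q \<in> ball p (1/2)" "r \<in> ball p (1/2)" "KT_cover q = KT_cover r"
  obtain d k l n where g: "r = deck (d, k, l, n) q"
    using qr(3) by (auto simp: KT_cover_eq_iff)
  obtain t x y z where q: "q = (t, x, y, z)" by (cases q) auto
  have near: "dist q r < 1"
    using dist_triangle_half_r[of p q 1 r] qr by simp
  have "dist (fst q) (fst r) < 1" "dist (fst (snd q)) (fst (snd r)) < 1"
    "dist (fst (snd (snd q))) (fst (snd (snd r))) < 1" "dist (snd (snd (snd q))) (snd (snd (snd r))) < 1"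
    using near dist_fst_le[of q r] dist_snd_le[of q r]
      dist_fst_le[of "snd q" "snd r"] dist_snd_le[of "snd q" "snd r"]
      dist_fst_le[of "snd (snd q)" "snd (snd r)"] dist_snd_le[of "snd (snd q)" "snd (snd r)"]
    by linarith+
  then have *: "\<bar>real_of_int d\<bar> < 1" "\<bar>real_of_int k\<bar> < 1" "\<bar>real_of_int l\<bar> < 1"
    "\<bar>real_of_int n + real_of_int k * y\<bar> < 1"
    by (simp_all add: g q dist_real_def)
  then have "d = 0" "k = 0" "l = 0" by linarith+
  \<comment> \<open>The displacement in \<open>z\<close> is \<open>n + k * y\<close>, so it bounds
    \<open>n\<close> only once \<open>k = 0\<close> is known.\<close>
  moreover from * \<open>k = 0\<close> have "n = 0" by simp
  ultimately show "q = r" by (simp add: g q)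
qed

section \<open>Charts as local inverses of the covering, with deck transformations as transition
  maps\<close>

definition KT_chart :: "coords set \<Rightarrow> (real set \<times> (real^3^3) set, coords) chart" where
  "KT_chart V = (KT_cover ` V, inv_into V KT_cover)"

lemma KT_atlas_iff: "c \<in> KT_atlas \<longleftrightarrow> (\<exists>V. c = KT_chart V \<and> open V \<and> inj_on KT_cover V)"
  by (auto simp: KT_atlas_def KT_chart_def)

lemma chart_image_KT_chart: "inj_on KT_cover V \<Longrightarrow> chart_image (KT_chart V) = V"
  by (force simp: chart_image_def KT_chart_def image_iff)

lemma inj_on_KT_chart: "inj_on KT_cover V \<Longrightarrow> inj_on (snd (KT_chart V)) (fst (KT_chart V))"
  by (simp add: KT_chart_def inj_on_inv_into)

lemma overlap_KT_chart:
  assumes "inj_on KT_cover V" "inj_on KT_cover V'"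
  shows "overlap (KT_chart V) (KT_chart V') = {p \<in> V. \<exists>g. deck g p \<in> V'}"
proof -
  have "overlap (KT_chart V) (KT_chart V') = {p \<in> V. KT_cover p \<in> KT_cover ` V'}"
  proof (intro set_eqI iffI)
    fix p assume "p \<in> overlap (KT_chart V) (KT_chart V')"
    then obtain X where "X \<in> KT_cover ` V" "X \<in> KT_cover ` V'" "p = inv_into V KT_cover X"
      by (auto simp: overlap_def KT_chart_def)
    then show "p \<in> {p \<in> V. KT_cover p \<in> KT_cover ` V'}"
      by (simp add: inv_into_into f_inv_into_f)
  next
    fix p assume "p \<in> {p \<in> V. KT_cover p \<in> KT_cover ` V'}"
    then have "KT_cover p \<in> KT_cover ` V \<inter> KT_cover ` V'" "inv_into V KT_cover (KT_cover p) = p"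
      using assms by auto
    then show "p \<in> overlap (KT_chart V) (KT_chart V')"
      unfolding overlap_def KT_chart_def fst_conv snd_conv by (metis imageI)
  qed
  also have "\<dots> = {p \<in> V. \<exists>g. deck g p \<in> V'}"
    unfolding image_iff Bex_def KT_cover_eq_iff by blast
  finally show ?thesis .
qed

text \<open>The points \<open>p\<close> and \<open>deck g p\<close> have the same image in the
  quotient, and the two charts invert the covering on \<open>V\<close> and \<open>V'\<close>. The
  element \<open>g\<close> may depend on \<open>p\<close>.\<close>

lemma transition_KT_chart:
  assumes "inj_on KT_cover V" "inj_on KT_cover V'" "p \<in> V" "deck g p \<in> V'"
  shows "transition (KT_chart V) (KT_chart V') p = deck g p"
proof -
  have "inv_into (fst (KT_chart V)) (snd (KT_chart V)) p = KT_cover p"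
    using assms by (intro inv_into_f_eq inj_on_KT_chart) (auto simp: KT_chart_def)
  then have "transition (KT_chart V) (KT_chart V') p = inv_into V' KT_cover (KT_cover p)"
    by (simp add: transition_def KT_chart_def)
  also have "KT_cover p = KT_cover (deck g p)" unfolding KT_cover_eq_iff by blast
  also have "inv_into V' KT_cover (KT_cover (deck g p)) = deck g p"
    using assms by simp
  finally show ?thesis .
qed

text \<open>On this set the transition map is the single affine map \<open>deck g\<close>; its
  openness is what makes derivatives computable from \<open>g\<close>.\<close>

lemma open_overlap_nbhd: "open V \<Longrightarrow> open V' \<Longrightarrow> open (V \<inter> deck g -` V')"
  by (simp add: continuous_on_deck open_Int open_vimage)

lemma has_derivative_transition:
  assumes V: "open V" "inj_on KT_cover V" "open V'" "inj_on KT_cover V'" and p: "p \<in> V" "deck g p \<in> V'"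
  shows "(transition (KT_chart V) (KT_chart V') has_derivative deck_linear g) (at p)"
  by (rule has_derivative_transform_within_open[OF has_derivative_deck open_overlap_nbhd[OF V(1,3), of g]])
    (use p transition_KT_chart[OF V(2,4), of _ g] in \<open>simp_all del: split_paired_All\<close>)

lemma frechet_derivative_transition:
  assumes "open V" "inj_on KT_cover V" "open V'" "inj_on KT_cover V'" "p \<in> V" "deck g p \<in> V'"
  shows "frechet_derivative (transition (KT_chart V) (KT_chart V')) (at p) = deck_linear g"
  using frechet_derivative_at[OF has_derivative_transition[OF assms]] by simp

lemma smooth_atlas_KT: "smooth_atlas KT KT_atlas"
  unfolding smooth_atlas_def
proof (intro conjI ballI)
  show "(\<Union>c\<in>KT_atlas. fst c) = KT"
  proof
    have "KT_cover p \<in> KT" for p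
      by (cases p) (auto simp: KT_cover_def KT_def Nil3_def)
    then show "(\<Union>c\<in>KT_atlas. fst c) \<subseteq> KT" by (auto simp: KT_atlas_iff KT_chart_def)
  next
    show "KT \<subseteq> (\<Union>c\<in>KT_atlas. fst c)"
    proof
      fix X assume "X \<in> KT"
      then obtain t x y z where X: "X = KT_cover (t, x, y, z)"
        by (auto simp: KT_def Nil3_def KT_cover_def)
      have "KT_chart (ball (t, x, y, z) (1/2)) \<in> KT_atlas"
        using inj_on_KT_cover_ball by (auto simp: KT_atlas_iff)
      moreover have "X \<in> fst (KT_chart (ball (t, x, y, z) (1/2)))"
        by (simp add: X KT_chart_def)
      ultimately show "X \<in> (\<Union>c\<in>KT_atlas. fst c)" by blast
    qed
  qed
next
  fix c assume "c \<in> KT_atlas"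
  then show "inj_on (snd c) (fst c)" "open (chart_image c)"
    by (auto simp: KT_atlas_iff inj_on_KT_chart chart_image_KT_chart)
next
  fix c c' assume "c \<in> KT_atlas" "c' \<in> KT_atlas"
  then obtain V V' where V: "open V" "inj_on KT_cover V" "open V'" "inj_on KT_cover V'"
    and c: "c = KT_chart V" "c' = KT_chart V'"
    by (auto simp: KT_atlas_iff)
  \<comment> \<open>Different points of the overlap may need different \<open>g\<close>, but each
    \<open>g\<close> remains valid on a neighbourhood, which suffices for openness and
    smoothness.\<close>
  have nbhd: "\<exists>U g. open U \<and> p \<in> U \<and> U \<subseteq> overlap c c' \<and> (\<forall>q\<in>U. transition c c' q = deck g q)"
    if p: "p \<in> overlap c c'" for p
  proof -
    obtain g where "p \<in> V" "deck g p \<in> V'"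
      using p unfolding c overlap_KT_chart[OF V(2,4)] by blast
    then show ?thesis
      using open_overlap_nbhd[OF V(1,3), of g] transition_KT_chart[OF V(2,4), of _ g]
      unfolding c overlap_KT_chart[OF V(2,4)]
      by (intro exI[of _ "V \<inter> deck g -` V'"] exI[of _ g]) blast
  qed
  show "open (overlap c c')"
    by (subst open_subopen) (use nbhd in blast)
  show "smooth_on (overlap c c') (transition c c')"
  proof (rule smooth_on_local)
    fix p assume "p \<in> overlap c c'"
    from nbhd[OF this] obtain U g where U: "open U" "p \<in> U" "\<forall>q\<in>U. transition c c' q = deck g q"
      by blast
    then have "smooth_on U (transition c c')"
      by (intro smooth_on_cong[OF U(1) _ smooth_on_deck[OF U(1), of g]]) auto
    then show "\<exists>U. open U \<and> p \<in> U \<and> smooth_on U (transition c c')" using U by blast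
  qed
qed

section \<open>Types of forms\<close>

text \<open>If \<open>j\<close> squares to \<open>-1\<close>, this is multiplication by the unit
  complex number \<open>cis \<theta>\<close> for the complex structure \<open>j\<close>.\<close>

definition rot :: "('e::real_vector \<Rightarrow> 'e) \<Rightarrow> real \<Rightarrow> 'e \<Rightarrow> 'e" where
  "rot j \<theta> v = cos \<theta> *\<^sub>R v + sin \<theta> *\<^sub>R j v"

lemma covectors10_rot: "\<alpha> \<in> covectors10 j \<Longrightarrow> \<alpha> (rot j \<theta> v) = cis \<theta> * \<alpha> v"
proof -
  have cis: "cis \<theta> = of_real (cos \<theta>) + \<i> * of_real (sin \<theta>)" by (simp add: complex_eq_iff)
  assume "\<alpha> \<in> covectors10 j"
  then show ?thesis
    by (simp add: cis covectors10_def rot_def linear_add linear_scale scaleR_conv_of_real algebra_simps)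
qed

lemma covectors01_rot: "\<alpha> \<in> covectors01 j \<Longrightarrow> \<alpha> (rot j \<theta> v) = cis (- \<theta>) * \<alpha> v"
proof -
  have cis: "cis (- \<theta>) = of_real (cos \<theta>) - \<i> * of_real (sin \<theta>)" by (simp add: complex_eq_iff)
  assume "\<alpha> \<in> covectors01 j"
  then show ?thesis
    by (simp add: cis covectors01_def rot_def linear_add linear_scale scaleR_conv_of_real algebra_simps)
qed

lemma prod_lessThan_add_if:
  "(\<Prod>i<p + q. if i < p then a else b) = a ^ p * (b ^ q :: 'a::comm_monoid_mult)"
  by (induction q) (auto simp: ac_simps)

text \<open>Every summand of the alternating sum uses each covector exactly once, so it acquires
  \<open>p\<close> factors \<open>cis \<theta>\<close> and \<open>q\<close> factors
  \<open>cis (- \<theta>)\<close>, whatever the permutation.\<close>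

lemma wedge_rot:
  assumes "length \<alpha>s = p" "length \<beta>s = q" "set \<alpha>s \<subseteq> covectors10 j" "set \<beta>s \<subseteq> covectors01 j"
  shows "wedge (\<alpha>s @ \<beta>s) (map (rot j \<theta>) vs) = cis (\<theta> * (real p - real q)) * wedge (\<alpha>s @ \<beta>s) vs"
proof (cases "length vs = p + q")
  case True
  have *: "(\<Prod>i<p + q. ((\<alpha>s @ \<beta>s) ! i) (map (rot j \<theta>) vs ! \<sigma> i)) =
      cis (\<theta> * (real p - real q)) * (\<Prod>i<p + q. ((\<alpha>s @ \<beta>s) ! i) (vs ! \<sigma> i))"
    if "\<sigma> permutes {..<p + q}" for \<sigma>
  proof -
    have "(\<Prod>i<p + q. ((\<alpha>s @ \<beta>s) ! i) (map (rot j \<theta>) vs ! \<sigma> i)) =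
        (\<Prod>i<p + q. (if i < p then cis \<theta> else cis (- \<theta>)) * ((\<alpha>s @ \<beta>s) ! i) (vs ! \<sigma> i))"
    proof (rule prod.cong)
      fix i assume i: "i \<in> {..<p + q}"
      then have "\<sigma> i < length vs" using permutes_in_image[OF that, of i] True by simp
      moreover have "i < p \<Longrightarrow> \<alpha>s ! i \<in> covectors10 j" "\<not> i < p \<Longrightarrow> \<beta>s ! (i - p) \<in> covectors01 j"
        using assms i nth_mem by fastforce+
      ultimately show "((\<alpha>s @ \<beta>s) ! i) (map (rot j \<theta>) vs ! \<sigma> i) =
          (if i < p then cis \<theta> else cis (- \<theta>)) * ((\<alpha>s @ \<beta>s) ! i) (vs ! \<sigma> i)"
        using assms by (auto simp: nth_append covectors10_rot covectors01_rot)
    qed simp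
    also have "\<dots> = cis \<theta> ^ p * cis (- \<theta>) ^ q * (\<Prod>i<p + q. ((\<alpha>s @ \<beta>s) ! i) (vs ! \<sigma> i))"
      by (simp add: prod.distrib prod_lessThan_add_if)
    also have "cis \<theta> ^ p * cis (- \<theta>) ^ q = cis (\<theta> * (real p - real q))"
      by (simp only: Complex.DeMoivre cis_mult) (simp add: algebra_simps)
    finally show ?thesis .
  qed
  have "wedge (\<alpha>s @ \<beta>s) (map (rot j \<theta>) vs) = (\<Sum>\<sigma> | \<sigma> permutes {..<p + q}.
      of_int (sign \<sigma>) * (\<Prod>i<p + q. ((\<alpha>s @ \<beta>s) ! i) (map (rot j \<theta>) vs ! \<sigma> i)))"
    using assms True by (simp add: wedge_def)
  also have "\<dots> = (\<Sum>\<sigma> | \<sigma> permutes {..<p + q}. cis (\<theta> * (real p - real q)) *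
      (of_int (sign \<sigma>) * (\<Prod>i<p + q. ((\<alpha>s @ \<beta>s) ! i) (vs ! \<sigma> i))))"
    by (intro sum.cong) (auto simp: *)
  also have "\<dots> = cis (\<theta> * (real p - real q)) * wedge (\<alpha>s @ \<beta>s) vs"
    using assms True by (simp add: wedge_def sum_distrib_left)
  finally show ?thesis .
qed (use assms in \<open>simp add: wedge_def\<close>)

lemma Lambda_rot:
  assumes "\<eta> \<in> Lambda p q j"
  shows "\<eta> (map (rot j \<theta>) vs) = cis (\<theta> * (real p - real q)) * \<eta> vs"
proof -
  let ?T = "{\<eta>. \<forall>vs. \<eta> (map (rot j \<theta>) vs) = cis (\<theta> * (real p - real q)) * \<eta> vs}"
  have "Lambda p q j \<subseteq> ?T"
    unfolding Lambda_def
  proof (rule tensor.span_minimal)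
    show "tensor.subspace ?T"
      by (auto simp: tensor.subspace_def algebra_simps zero_fun_def)
  qed (auto simp: wedge_rot)
  then show ?thesis using assms by auto
qed

text \<open>A geometric sum over the powers of an \<open>N\<close>-th root of unity, which differs
  from 1 because \<open>d\<close> is not a multiple of \<open>N\<close>.\<close>

lemma sum_cis_eq_0:
  assumes "\<bar>d\<bar> < int N" "d \<noteq> 0"
  shows "(\<Sum>k<N. cis (2 * pi * real k / real N * of_int d)) = 0"
proof -
  define w where "w = cis (2 * pi * of_int d / real N)"
  have N: "N > 0" using assms by (cases N) auto
  have "w \<noteq> 1"
  proof
    assume "w = 1"
    then have "cos (2 * pi * of_int d / real N) = 1" by (auto simp: w_def complex_eq_iff)
    then obtain n :: int where "2 * pi * of_int d / real N = n * 2 * pi"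
      by (auto simp: cos_one_2pi_int)
    then have "real_of_int d = of_int (n * int N)" using N by (simp add: field_simps)
    then have d: "d = n * int N" by linarith
    then have "n \<noteq> 0" using assms by auto
    then have "1 * int N \<le> \<bar>n\<bar> * int N" by (intro mult_right_mono) auto
    then show False using assms(1) d by (simp add: abs_mult)
  qed
  moreover have "w ^ N = 1"
  proof -
    have "w ^ N = cis (2 * pi * of_int d)" using N by (simp add: w_def Complex.DeMoivre)
    also have "\<dots> = 1" by (rule cis_multiple_2pi) simp
    finally show ?thesis .
  qed
  moreover have "cis (2 * pi * real k / real N * of_int d) = w ^ k" for k
    by (simp add: w_def Complex.DeMoivre ac_simps)
  ultimately show ?thesis by (simp add: sum_gp_strict)
qed

text \<open>Rotating a form of type \<open>(p, q)\<close> by \<open>\<theta>\<close> multiplies it by \<open>cis (\<theta> * (p - q))\<close>, so the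
  discrete Fourier coefficients of the rotation action separate the types.\<close>

lemma type_projection_eqI:
  fixes j :: "'e::euclidean_space \<Rightarrow> 'e"
  assumes \<zeta>: "\<zeta> \<in> Lambda p q j"
    and rest: "\<eta> - \<zeta> \<in> tensor.span (\<Union>{Lambda p' q' j | p' q'. p' + q' = p + q \<and> (p', q') \<noteq> (p, q)})"
  shows "type_projection p q j \<eta> = \<zeta>"
proof -
  \<comment> \<open>Weights of two types of degree \<open>p + q\<close> differ by at most
    \<open>2 * (p + q)\<close>. With more sample angles than that, distinct weights cannot be
    confused.\<close>
  define N where "N = Suc (2 * (p + q))"
  define a where "a k = 2 * pi * real k / real N" for k
  define A where "A \<eta> vs = (\<Sum>k<N. cis (- (a k * (real p - real q))) * \<eta> (map (rot j (a k)) vs))"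
    for \<eta> :: "'e tensor" and vs
  have A_weight: "A \<zeta> vs = (\<Sum>k<N. cis (a k * (real p' - real q' - (real p - real q)))) * \<zeta> vs"
    if "\<zeta> \<in> Lambda p' q' j" for \<zeta> vs p' q'
    unfolding A_def sum_distrib_right
    by (rule sum.cong) (auto simp: Lambda_rot[OF that] cis_mult algebra_simps simp flip: mult.assoc)
  have A_keep: "A \<zeta> vs = of_nat N * \<zeta> vs" if "\<zeta> \<in> Lambda p q j" for \<zeta> vs
    using A_weight[OF that] by simp
  have A_kill: "A \<zeta> vs = 0"
    if "\<zeta> \<in> Lambda p' q' j" "p' + q' = p + q" "(p', q') \<noteq> (p, q)" for \<zeta> vs p' q'
  proof -
    have "\<bar>2 * (int p' - int p)\<bar> < int N" "2 * (int p' - int p) \<noteq> 0"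
      using that by (auto simp: N_def)
    have eq: "real p' - real q' - (real p - real q) = 2 * (real p' - real p)"
      using that(2) by (simp add: algebra_simps flip: of_nat_add)
    from sum_cis_eq_0[OF \<open>\<bar>2 * (int p' - int p)\<bar> < int N\<close> \<open>2 * (int p' - int p) \<noteq> 0\<close>] have "(\<Sum>k<N. cis (a k * (2 * (real p' - real p)))) = 0"
      by (simp add: a_def)
    then show ?thesis unfolding A_weight[OF that(1)] eq by simp
  qed
  have A_rest: "A \<zeta> vs = 0"
    if "\<zeta> \<in> tensor.span (\<Union>{Lambda p' q' j | p' q'. p' + q' = p + q \<and> (p', q') \<noteq> (p, q)})" for \<zeta> vs
  proof -
    have "tensor.span (\<Union>{Lambda p' q' j | p' q'. p' + q' = p + q \<and> (p', q') \<noteq> (p, q)}) \<subseteq> {\<zeta>. \<forall>vs. A \<zeta> vs = 0}"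
    proof (rule tensor.span_minimal)
      have "A (\<lambda>i. c * \<eta> i) vs = c * A \<eta> vs" "A (\<eta> + \<eta>') vs = A \<eta> vs + A \<eta>' vs" for c \<eta> \<eta>' vs
        by (simp_all add: A_def sum_distrib_left sum.distrib algebra_simps)
      then show "tensor.subspace {\<zeta>. \<forall>vs. A \<zeta> vs = 0}"
        by (auto simp: tensor.subspace_def) (simp add: A_def)
    qed (use A_kill in auto)
    then show ?thesis using that by auto
  qed
  have A_diff: "A (\<eta> - \<zeta>) vs = A \<eta> vs - A \<zeta> vs" for \<eta> \<zeta> vs
    by (simp add: A_def sum_subtractf algebra_simps)
  show ?thesis
    unfolding type_projection_def
  proof (rule the_equality)
    show "\<zeta> \<in> Lambda p q j \<and> \<eta> - \<zeta> \<in> tensor.span (\<Union>{Lambda p' q' j | p' q'. p' + q' = p + q \<and> (p', q') \<noteq> (p, q)})"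
      using assms by simp
  next
    fix \<zeta>' assume "\<zeta>' \<in> Lambda p q j \<and> \<eta> - \<zeta>' \<in> tensor.span (\<Union>{Lambda p' q' j | p' q'. p' + q' = p + q \<and> (p', q') \<noteq> (p, q)})"
    then have "of_nat N * \<zeta>' vs = of_nat N * \<zeta> vs" for vs
      using A_rest[of "\<eta> - \<zeta>'" vs] A_rest[OF rest, of vs] A_keep[of \<zeta>' vs] A_keep[OF \<zeta>, of vs]
      by (simp add: A_diff del: of_nat_mult)
    then show "\<zeta>' = \<zeta>" by (simp add: N_def fun_eq_iff del: of_nat_Suc)
  qed
qed

section \<open>Wedge products of degree one, two and three as explicit determinants\<close>

lemma wedge_1: "wedge [\<alpha>] vs = (case vs of [v] \<Rightarrow> \<alpha> v | _ \<Rightarrow> 0)"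
proof -
  have "{..<1::nat} = {0}" by auto
  then show ?thesis
    by (auto simp: wedge_def permutes_sing sign_id split: list.splits)
qed

lemma wedge_2: "wedge [\<alpha>, \<beta>] [v, w] = \<alpha> v * \<beta> w - \<alpha> w * \<beta> v"
proof -
  \<comment> \<open>Writing the index set by insertion lets
    \<open>sum_over_permutations_insert\<close> peel off one index at a time.\<close>
  have n: "{..<2::nat} = {0, 1}" by auto
  have f: "finite {1::nat}" "0 \<notin> {1::nat}" by auto
  show ?thesis
    unfolding wedge_def list.size One_nat_def[symmetric] add_0 one_add_one n sum_over_permutations_insert[OF f] permutes_sing
    by (simp add: sign_swap_id sign_id swap_id_eq)
qed

lemma wedge_3:
  "wedge [\<alpha>, \<beta>, \<gamma>] [u, v, w] =
    \<alpha> u * (\<beta> v * \<gamma> w - \<beta> w * \<gamma> v) - \<alpha> v * (\<beta> u * \<gamma> w - \<beta> w * \<gamma> u) + \<alpha> w * (\<beta> u * \<gamma> v - \<beta> v * \<gamma> u)"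
proof -
  have n: "{..<length [\<alpha>, \<beta>, \<gamma>]} = {0, 1, 2}" by auto
  have f: "finite {1::nat, 2}" "0 \<notin> {1::nat, 2}" "finite {2::nat}" "1 \<notin> {2::nat}" by auto
  show ?thesis
    unfolding wedge_def n sum_over_permutations_insert[OF f(1,2)] sum_over_permutations_insert[OF f(3,4)] permutes_sing
    by (simp add: sign_swap_id permutation_swap_id sign_compose sign_id swap_id_eq algebra_simps)
qed

lemma wedge_wrong_length: "length vs \<noteq> length \<alpha>s \<Longrightarrow> wedge \<alpha>s vs = 0"
  by (simp add: wedge_def)

section \<open>Bounded solutions of Cauchy--Riemann equations in the plane\<close>

text \<open>The function \<open>F - K s\<close> is an entire function of \<open>t - \<tau> s\<close> of linear growth,
  which leaves room only for an affine function.\<close>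

lemma bounded_Cauchy_Riemann:
  fixes F :: "real \<times> real \<Rightarrow> complex"
  assumes der: "\<And>p. (F has_derivative D p) (at p)"
    and CR: "\<And>p. D p (1, 0) + \<tau> * D p (0, 1) = K"
    and \<tau>: "Im \<tau> \<noteq> 0" and bdd: "\<And>p. norm (F p) \<le> M"
  shows "K = 0" and "F p = F q"
proof -
  \<comment> \<open>\<open>s w\<close> and \<open>t w\<close> are the real numbers solving
    \<open>of_real (t w) - \<tau> * of_real (s w) = w\<close>, which exist since
    \<open>Im \<tau> \<noteq> 0\<close>.\<close>
  define s where "s w = - Im w / Im \<tau>" for w
  define t where "t w = Re w + Re \<tau> * s w" for w
  define H where "H w = F (s w, t w) - K * of_real (s w)" for w
  have decomp: "of_real (t w) - \<tau> * of_real (s w) = w" for w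
    using \<tau> by (simp add: complex_eq_iff t_def s_def)
  have ds: "(s has_derivative s) (at w)" and dt: "(t has_derivative t) (at w)" for w
    unfolding s_def t_def by (auto intro!: derivative_eq_intros simp: fun_eq_iff divide_inverse)
  \<comment> \<open>The equation expresses the first partial derivative as \<open>K\<close> minus
    \<open>\<tau>\<close> times the second; subtracting \<open>K * of_real (s w)\<close> thus leaves
    a complex linear differential.\<close>
  have dH: "(H has_field_derivative D (s w, t w) (0, 1)) (at w)" for w
  proof -
    have "((\<lambda>w. F (s w, t w)) has_derivative (\<lambda>h. D (s w, t w) (s h, t h))) (at w)"
      by (rule has_derivative_compose[OF has_derivative_Pair[OF ds dt] der])
    then have "(H has_derivative (\<lambda>h. D (s w, t w) (s h, t h) - K * of_real (s h))) (at w)"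
      unfolding H_def by (intro has_derivative_diff has_derivative_mult_right has_derivative_of_real ds)
    moreover have "D (s w, t w) (s h, t h) - K * of_real (s h) = D (s w, t w) (0, 1) * h" for h
    proof -
      have "(s h, t h) = s h *\<^sub>R (1, 0) + t h *\<^sub>R (0, 1)" by simp
      then have "D (s w, t w) (s h, t h) = of_real (s h) * D (s w, t w) (1, 0) + of_real (t h) * D (s w, t w) (0, 1)"
        using has_derivative_linear[OF der[of "(s w, t w)"]]
        by (simp only: linear_add linear_scale scaleR_conv_of_real)
      also have "D (s w, t w) (1, 0) = K - \<tau> * D (s w, t w) (0, 1)"
        using CR[of "(s w, t w)"] by (simp add: algebra_simps)
      finally have "D (s w, t w) (s h, t h) - K * of_real (s h) = D (s w, t w) (0, 1) * (of_real (t h) - \<tau> * of_real (s h))"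
        by (simp add: algebra_simps)
      then show ?thesis by (simp add: decomp)
    qed
    ultimately show ?thesis by (simp add: has_field_derivative_def)
  qed
  have M: "M \<ge> 0" using bdd[of 0] norm_ge_zero order_trans by blast
  have growth: "norm (H w) \<le> (M + norm K / \<bar>Im \<tau>\<bar>) * norm w ^ 1" if "1 \<le> norm w" for w
  proof -
    have "norm (H w) \<le> norm (F (s w, t w)) + norm (K * of_real (s w))"
      unfolding H_def by (rule norm_triangle_ineq4)
    also have "\<dots> \<le> M * norm w + norm K * (norm w / \<bar>Im \<tau>\<bar>)"
    proof (rule add_mono)
      show "norm (F (s w, t w)) \<le> M * norm w"
        using bdd[of "(s w, t w)"] M that by (metis mult_left_mono mult.right_neutral order_trans)
      show "norm (K * of_real (s w)) \<le> norm K * (norm w / \<bar>Im \<tau>\<bar>)"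
        unfolding norm_mult norm_of_real s_def
        by (intro mult_left_mono) (auto simp: abs_divide abs_Im_le_cmod intro!: divide_right_mono)
    qed
    finally show ?thesis by (simp add: algebra_simps)
  qed
  obtain A B where AB: "H w = A + B * w" for w
    using Liouville_polynomial[of H 1 _ 1, OF _ growth] dH
    by (simp add: holomorphic_on_open field_differentiable_def) (metis)
  have F_eq: "F (u, v) = A + B * (of_real v - \<tau> * of_real u) + K * of_real u" for u v
  proof -
    define w where "w = of_real v - \<tau> * of_real u"
    have "s w = u" "t w = v" using \<tau> by (auto simp: w_def s_def t_def)
    then show ?thesis using AB[of w] by (simp add: H_def w_def algebra_simps)
  qed
  \<comment> \<open>An affine function bounded on the real line has slope zero. This is used first
    along the second coordinate, giving \<open>B = 0\<close>, and then along the first, giving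
    \<open>K = 0\<close>.\<close>
  have slope: "c = 0" if "\<And>r::real. norm (A + c * of_real r) \<le> M" for c
  proof (rule ccontr)
    assume "c \<noteq> 0"
    define r where "r = (M + norm A + 1) / norm c"
    have "r \<ge> 0" using M by (simp add: r_def)
    have "norm (c * of_real r) = M + norm A + 1"
      using \<open>c \<noteq> 0\<close> \<open>r \<ge> 0\<close> by (simp add: norm_mult) (simp add: r_def)
    moreover have "norm (c * of_real r) \<le> norm (A + c * of_real r) + norm A"
      using norm_triangle_ineq4[of "A + c * of_real r" A] by simp
    ultimately show False using that[of r] by simp
  qed
  have B: "B = 0"
    using slope bdd[of "(0, r)" for r] F_eq by simp
  show K: "K = 0"
    using slope bdd[of "(r, 0)" for r] F_eq B by simp
  show "F p = F q"
    using F_eq B K by (cases p, cases q) simp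
qed

text \<open>Multiplication by \<open>exp (- (\<i> * of_real (c * x)))\<close> cancels the
  zeroth-order term, because \<open>\<i> * (- \<i> * c) = c\<close>; as \<open>c\<close> is real
  this factor has modulus one and keeps the bound.\<close>

lemma bounded_twisted_Cauchy_Riemann:
  fixes F :: "real \<times> real \<Rightarrow> complex" and c :: real
  assumes der: "\<And>p. (F has_derivative D p) (at p)"
    and CR: "\<And>p. D p (1, 0) + \<i> * D p (0, 1) + of_real c * F p = 0"
    and bdd: "\<And>p. norm (F p) \<le> M"
  shows "F (t, x) = F (0, 0) * exp (\<i> * of_real (c * x))"
proof -
  define G where "G p = F p * exp (- (\<i> * of_real (c * snd p)))" for p
  define DG where "DG p h = D p h * exp (- (\<i> * of_real (c * snd p)))
      + F p * (- (\<i> * of_real (c * snd h)) * exp (- (\<i> * of_real (c * snd p))))" for p h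
  have dG: "(G has_derivative DG p) (at p)" for p
  proof -
    have "((\<lambda>p. exp (- (\<i> * of_real (c * snd p)))) has_derivative
        (\<lambda>h. - (\<i> * of_real (c * snd h)) * exp (- (\<i> * of_real (c * snd p))))) (at p)"
    proof -
      have *: "((\<lambda>p. - (\<i> * of_real (c * snd p))) has_derivative (\<lambda>h. - (\<i> * of_real (c * snd h)))) (at p)"
        by (auto intro!: derivative_eq_intros)
      have "(exp has_derivative (\<lambda>h. exp (- (\<i> * of_real (c * snd p))) * h)) (at (- (\<i> * of_real (c * snd p))))"
        using DERIV_exp by (auto simp: has_field_derivative_def)
      from has_derivative_compose[OF * this] show ?thesis by (simp add: mult.commute)
    qed
    from has_derivative_mult[OF der this] show ?thesis
      by (simp add: G_def[abs_def] DG_def[abs_def] add.commute)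
  qed
  have CRG: "DG p (1, 0) + \<i> * DG p (0, 1) = 0" for p
  proof -
    have "DG p (1, 0) + \<i> * DG p (0, 1) =
        (D p (1, 0) + \<i> * D p (0, 1) + of_real c * F p) * exp (- (\<i> * of_real (c * snd p)))"
      by (simp add: DG_def algebra_simps)
    then show ?thesis by (simp add: CR)
  qed
  have bddG: "norm (G p) \<le> M" for p
    using bdd[of p] by (simp add: G_def norm_mult)
  have "G (t, x) = G (0, 0)"
    by (rule bounded_Cauchy_Riemann(2)[OF dG CRG _ bddG]) simp
  then show ?thesis
    by (simp add: G_def exp_minus field_simps)
qed

section \<open>The invariant coframe\<close>

declare split_paired_All [simp del] split_paired_Ex [simp del]

text \<open>\<open>KT_J\<close> without its chart argument: the coordinate expression is the same in
  all charts, so it can be used on the whole covering space.\<close>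

definition std_J :: "real \<Rightarrow> coords \<Rightarrow> coords \<Rightarrow> coords" where
  "std_J a = (\<lambda>(t, x, y, z) (vt, vx, vy, vz).
     (- vx, vt, - (a * (vz - x * vy)), vy / a - a * x * (vz - x * vy)))"

lemma std_J_eq [simp]:
  "std_J a (t, x, y, z) (vt, vx, vy, vz) = (- vx, vt, - (a * (vz - x * vy)), vy / a - a * x * (vz - x * vy))"
  by (simp add: std_J_def)

lemma KT_J_std: "KT_J a c = std_J a"
  by (auto simp: fun_eq_iff KT_J_eq)

lemma linear_std_J: "linear (std_J a p)"
  using KT_J_frame(1)[of a undefined p] by (simp add: KT_J_std)

lemma std_J_square: "a \<noteq> 0 \<Longrightarrow> std_J a p (std_J a p v) = - v"
  by (cases p, cases v) (simp add: field_simps)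

text \<open>The frame is invariant under left multiplication, hence so is the structure defined
  through it.\<close>

lemma std_J_deck: "std_J a (deck g p) (deck_linear g v) = deck_linear g (std_J a p v)"
  by (cases g, cases p, cases v) (simp add: algebra_simps)

lemma smooth_on_std_J:
  assumes "open S"
  shows "smooth_on S (\<lambda>p. std_J a p v)"
proof -
  obtain vt vx vy vz where v: "v = (vt, vx, vy, vz)" by (cases v) auto
  define X :: "coords \<Rightarrow> real" where "X p = fst (snd p)" for p
  have "bounded_linear X"
    unfolding X_def by (intro bounded_linear_compose[OF bounded_linear_fst bounded_linear_snd])
  then have X: "smooth_on S X" by (rule smooth_on_bounded_linear[OF assms])
  have eq: "(\<lambda>p. std_J a p v) = (\<lambda>p. (- vx, vt, - (a * vz), vy / a) + (X p *\<^sub>R (0, 0, a * vy, - a * vz)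
      + (X p * X p) *\<^sub>R (0, 0, 0, a * vy)))"
    by (auto simp: fun_eq_iff v X_def algebra_simps)
  show ?thesis
    unfolding eq using X assms by (intro smooth_on_add smooth_on_const smooth_on_mult smooth_on_scaleR)
qed

lemma almost_complex_structure_KT:
  assumes "a \<noteq> 0"
  shows "almost_complex_structure KT_atlas (KT_J a)"
  unfolding almost_complex_structure_def
proof (intro conjI ballI allI)
  fix c c' x v assume "c \<in> KT_atlas" "c' \<in> KT_atlas" and x: "x \<in> overlap c c'"
  then obtain V V' where V: "open V" "inj_on KT_cover V" "open V'" "inj_on KT_cover V'"
    and c: "c = KT_chart V" "c' = KT_chart V'"
    unfolding KT_atlas_iff by blast
  obtain g where g: "x \<in> V" "deck g x \<in> V'"
    using x unfolding c overlap_KT_chart[OF V(2,4)] by blast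
  show "frechet_derivative (transition c c') (at x) (KT_J a c x v) =
      KT_J a c' (transition c c' x) (frechet_derivative (transition c c') (at x) v)"
    by (simp add: c frechet_derivative_transition[OF V g] transition_KT_chart[OF V(2,4) g] KT_J_std std_J_deck)
qed (use assms in \<open>auto simp: KT_J_std linear_std_J std_J_square KT_atlas_iff chart_image_KT_chart
    simp del: split_paired_All intro!: smooth_on_std_J\<close>)

definition phi1 :: "coords \<Rightarrow> complex" where
  "phi1 = (\<lambda>(vt, vx, vy, vz). Complex vt vx)"

definition phi2 :: "real \<Rightarrow> coords \<Rightarrow> coords \<Rightarrow> complex" where
  "phi2 a = (\<lambda>(t, x, y, z) (vt, vx, vy, vz). Complex vy (a * (vz - x * vy)))"

lemma phi1_eq [simp]: "phi1 (vt, vx, vy, vz) = Complex vt vx"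
  by (simp add: phi1_def)

lemma phi2_eq [simp]: "phi2 a (t, x, y, z) (vt, vx, vy, vz) = Complex vy (a * (vz - x * vy))"
  by (simp add: phi2_def)

lemma linear_phi1: "linear phi1" and linear_phi2: "linear (phi2 a p)"
  by (cases p, rule linearI, auto simp: complex_eq_iff algebra_simps)+

lemma phi1_deck: "phi1 (deck_linear g v) = phi1 v"
  by (cases g, cases v) simp

lemma phi2_deck: "phi2 a (deck g p) (deck_linear g v) = phi2 a p v"
  by (cases g, cases p, cases v) (simp add: algebra_simps)

lemma phi1_J [simp]: "phi1 (std_J a p v) = \<i> * phi1 v"
  by (cases p, cases v) (simp add: complex_eq_iff)

lemma phi2_J [simp]: "a \<noteq> 0 \<Longrightarrow> phi2 a p (std_J a p v) = \<i> * phi2 a p v"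
  by (cases p, cases v) (simp add: complex_eq_iff algebra_simps)

lemma phi_mem_covectors:
  assumes "a \<noteq> 0"
  shows "phi1 \<in> covectors10 (std_J a p)" "phi2 a p \<in> covectors10 (std_J a p)"
    "(\<lambda>v. cnj (phi1 v)) \<in> covectors01 (std_J a p)" "(\<lambda>v. cnj (phi2 a p v)) \<in> covectors01 (std_J a p)"
  using assms linear_compose[OF linear_phi1 linear_cnj] linear_compose[OF linear_phi2 linear_cnj]
  by (auto simp: covectors10_def covectors01_def linear_phi1 linear_phi2 o_def)

text \<open>Compatibility with \<open>std_J\<close> ties the value on \<open>D_x\<close> to that on
  \<open>D_t\<close>, and the value on \<open>D_y_plus_xD_z\<close> to that on \<open>D_z\<close>,
  so two coefficients remain.\<close>

lemma covectors10_std_J: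
  assumes "a \<noteq> 0"
  shows "covectors10 (std_J a p) = {\<lambda>v. c * phi1 v + d * phi2 a p v | c d. True}"
proof (intro set_eqI iffI)
  fix \<alpha> assume "\<alpha> \<in> covectors10 (std_J a p)"
  then have lin: "linear \<alpha>" and J: "\<And>v. \<alpha> (std_J a p v) = \<i> * \<alpha> v" by (auto simp: covectors10_def)
  obtain t x y z where p: "p = (t, x, y, z)" by (cases p) auto
  \<comment> \<open>On \<open>D_t\<close> the coframe takes the values 1 and 0, on
    \<open>D_z\<close> the values 0 and \<open>\<i> * a\<close>; this dictates both
    coefficients.\<close>
  define c d where "c = \<alpha> (1, 0, 0, 0)" and "d = \<alpha> (0, 0, 0, 1) / (\<i> * of_real a)"
  have x: "\<alpha> (0, 1, 0, 0) = \<i> * c"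
    using J[of "(1, 0, 0, 0)"] by (simp add: p c_def)
  have z: "\<alpha> (0, 0, 0, 1) = \<i> * of_real a * d"
    using assms by (simp add: d_def)
  have "\<alpha> ((- a) *\<^sub>R (0, 0, 1, x)) = \<i> * (\<i> * of_real a * d)"
    using J[of "(0, 0, 0, 1)"] by (simp add: p z)
  then have y: "\<alpha> (0, 0, 1, x) = d"
    using assms by (subst (asm) linear_scale[OF lin]) (simp add: scaleR_conv_of_real mult.assoc)
  have "\<alpha> v = c * phi1 v + d * phi2 a p v" for v
  proof -
    obtain vt vx vy vz where v: "v = (vt, vx, vy, vz)" by (cases v) auto
    have "v = vt *\<^sub>R (1, 0, 0, 0) + vx *\<^sub>R (0, 1, 0, 0) + vy *\<^sub>R (0, 0, 1, x) + (vz - x * vy) *\<^sub>R (0, 0, 0, 1)"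
      by (simp add: v)
    then have "\<alpha> v = vt *\<^sub>R c + vx *\<^sub>R (\<i> * c) + vy *\<^sub>R d + (vz - x * vy) *\<^sub>R (\<i> * of_real a * d)"
      by (simp only: linear_add[OF lin] linear_scale[OF lin] x y z c_def[symmetric])
    then show ?thesis
      by (simp add: v p complex_eq_iff algebra_simps)
  qed
  then have "\<alpha> = (\<lambda>v. c * phi1 v + d * phi2 a p v)" by (rule ext)
  then show "\<alpha> \<in> {\<lambda>v. c * phi1 v + d * phi2 a p v | c d. True}" by blast
next
  fix \<alpha> assume "\<alpha> \<in> {\<lambda>v. c * phi1 v + d * phi2 a p v | c d. True}"
  then obtain c d where "\<alpha> = (\<lambda>v. c * phi1 v + d * phi2 a p v)" by blast
  then show "\<alpha> \<in> covectors10 (std_J a p)"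
    using assms by (simp add: covectors10_def linear_iff algebra_simps linear_add[OF linear_phi1]
        linear_add[OF linear_phi2] linear_scale[OF linear_phi1] linear_scale[OF linear_phi2] scaleR_conv_of_real)
qed

lemma length_2_cases: "length vs = 2 \<Longrightarrow> (\<And>v w. vs = [v, w] \<Longrightarrow> P) \<Longrightarrow> P"
  by (auto simp: numeral_2_eq_2 length_Suc_conv)

lemma length_3_cases: "length vs = 3 \<Longrightarrow> (\<And>u v w. vs = [u, v, w] \<Longrightarrow> P) \<Longrightarrow> P"
  by (auto simp: numeral_3_eq_3 length_Suc_conv)

lemma wedge_2_ext:
  assumes "\<And>v w. \<eta> [v, w] = \<alpha> v * \<beta> w - \<alpha> w * \<beta> v" "\<And>vs. length vs \<noteq> 2 \<Longrightarrow> \<eta> vs = 0"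
  shows "\<eta> = wedge [\<alpha>, \<beta>]"
proof
  show "\<eta> vs = wedge [\<alpha>, \<beta>] vs" for vs
    by (cases "length vs = 2") (auto elim!: length_2_cases simp: wedge_2 assms wedge_wrong_length)
qed

section \<open>The generator of the canonical bundle and its tensor powers\<close>

definition Omega :: "real \<Rightarrow> coords \<Rightarrow> coords tensor" where
  "Omega a p = wedge [phi1, phi2 a p]"

lemma Omega_2: "Omega a p [v, w] = phi1 v * phi2 a p w - phi1 w * phi2 a p v"
  by (simp add: Omega_def wedge_2)

lemma Omega_wrong_length: "length vs \<noteq> 2 \<Longrightarrow> Omega a p vs = 0"
  by (simp add: Omega_def wedge_wrong_length)

lemma DIM_coords_div_2 [simp]: "DIM(coords) div 2 = 2"
  by simp

lemma span_singleton_tensor: "tensor.span {T} = {\<lambda>vs. c * T vs | c. True}"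
  by (auto simp: tensor.span_singleton)

text \<open>The wedge of two combinations of \<open>phi1\<close> and \<open>phi2\<close> is
  \<open>Omega\<close> times the determinant of the coefficients.\<close>

lemma canonical_std_J:
  assumes "a \<noteq> 0"
  shows "canonical (std_J a p) = {\<lambda>vs. c * Omega a p vs | c. True}"
proof -
  have "canonical (std_J a p) = tensor.span {Omega a p}"
    unfolding canonical_def Lambda_def DIM_coords_div_2
  proof (rule tensor.span_eq[THEN iffD2], intro conjI subsetI)
    fix \<eta> assume "\<eta> \<in> {wedge (\<alpha>s @ \<beta>s) | \<alpha>s \<beta>s. length \<alpha>s = 2 \<and> length \<beta>s = 0 \<and>
        set \<alpha>s \<subseteq> covectors10 (std_J a p) \<and> set \<beta>s \<subseteq> covectors01 (std_J a p)}"
    then obtain \<alpha> \<beta> where \<eta>: "\<eta> = wedge [\<alpha>, \<beta>]" "\<alpha> \<in> covectors10 (std_J a p)" "\<beta> \<in> covectors10 (std_J a p)"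
      by (auto elim!: length_2_cases)
    then obtain c d c' d' where "\<alpha> = (\<lambda>v. c * phi1 v + d * phi2 a p v)" "\<beta> = (\<lambda>v. c' * phi1 v + d' * phi2 a p v)"
      by (auto simp: covectors10_std_J[OF assms])
    then have "\<eta> = (\<lambda>vs. (c * d' - d * c') * Omega a p vs)"
      unfolding \<eta> by (intro wedge_2_ext[symmetric]) (auto simp: Omega_2 Omega_wrong_length algebra_simps)
    then show "\<eta> \<in> tensor.span {Omega a p}" by (auto simp: span_singleton_tensor)
  next
    fix \<eta> assume "\<eta> \<in> {Omega a p}"
    then have "\<eta> = wedge ([phi1, phi2 a p] @ [])" by (simp add: Omega_def)
    then show "\<eta> \<in> tensor.span {wedge (\<alpha>s @ \<beta>s) | \<alpha>s \<beta>s. length \<alpha>s = 2 \<and> length \<beta>s = 0 \<and>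
        set \<alpha>s \<subseteq> covectors10 (std_J a p) \<and> set \<beta>s \<subseteq> covectors01 (std_J a p)}"
      using phi_mem_covectors[OF assms, of p] by (intro tensor.span_base CollectI exI conjI) auto
  qed
  then show ?thesis by (simp add: span_singleton_tensor)
qed

primrec Omega_power :: "real \<Rightarrow> nat \<Rightarrow> coords \<Rightarrow> coords tensor" where
  "Omega_power a 0 p = (\<lambda>vs. if vs = [] then 1 else 0)"
| "Omega_power a (Suc m) p = tensor_product 2 (Omega a p) (Omega_power a m p)"

lemma Omega_power_1: "Omega_power a (Suc 0) p = Omega a p"
proof
  show "Omega_power a (Suc 0) p vs = Omega a p vs" for vs
    by (cases "length vs \<le> 2") (auto simp: tensor_product_def Omega_wrong_length)
qed

lemma canonical_power_std_J:
  assumes "a \<noteq> 0"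
  shows "canonical_power m (std_J a p) = {\<lambda>vs. c * Omega_power a m p vs | c. True}"
proof (induction m)
  case 0
  show ?case by (simp add: span_singleton_tensor)
next
  case (Suc m)
  have "canonical_power (Suc m) (std_J a p) = tensor.span {Omega_power a (Suc m) p}"
    unfolding canonical_power.simps DIM_coords_div_2
  proof (rule tensor.span_eq[THEN iffD2], intro conjI subsetI)
    fix \<eta> assume "\<eta> \<in> {tensor_product 2 \<eta> \<theta> | \<eta> \<theta>. \<eta> \<in> canonical (std_J a p) \<and> \<theta> \<in> canonical_power m (std_J a p)}"
    then obtain c d where "\<eta> = tensor_product 2 (\<lambda>vs. c * Omega a p vs) (\<lambda>vs. d * Omega_power a m p vs)"
      by (auto simp: canonical_std_J[OF assms] Suc)
    then have "\<eta> = (\<lambda>vs. (c * d) * Omega_power a (Suc m) p vs)"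
      by (simp add: tensor_product_def fun_eq_iff)
    then show "\<eta> \<in> tensor.span {Omega_power a (Suc m) p}" unfolding span_singleton_tensor by blast
  next
    fix \<eta> assume "\<eta> \<in> {Omega_power a (Suc m) p}"
    moreover have "Omega a p \<in> canonical (std_J a p)"
      unfolding canonical_std_J[OF assms] by (intro CollectI exI[of _ 1]) simp
    moreover have "Omega_power a m p \<in> canonical_power m (std_J a p)"
      unfolding Suc by (intro CollectI exI[of _ 1]) simp
    ultimately show "\<eta> \<in> tensor.span {tensor_product 2 \<eta> \<theta> | \<eta> \<theta>. \<eta> \<in> canonical (std_J a p) \<and> \<theta> \<in> canonical_power m (std_J a p)}"
      by (intro tensor.span_base) auto
  qed
  then show ?case by (simp add: span_singleton_tensor)
qed

lemma Omega_deck: "Omega a (deck g p) (map (deck_linear g) vs) = Omega a p vs"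
  by (cases "length vs = 2") (auto elim!: length_2_cases simp: Omega_2 phi1_deck phi2_deck Omega_wrong_length)

lemma Omega_power_deck: "Omega_power a m (deck g p) (map (deck_linear g) vs) = Omega_power a m p vs"
  by (induction m arbitrary: vs)
    (simp_all add: tensor_product_def Omega_deck take_map drop_map)

lemma phi2_conv_linear:
  "phi2 a p v = Complex (fst (snd (snd v))) (a * snd (snd (snd v)))
     + of_real (fst (snd p)) * (- (\<i> * of_real (a * fst (snd (snd v)))))"
  by (cases p, cases v) (simp add: complex_eq_iff algebra_simps)

lemma smooth_on_phi2: "open S \<Longrightarrow> smooth_on S (\<lambda>p. phi2 a p v)"
  unfolding phi2_conv_linear
  by (intro smooth_on_add smooth_on_const smooth_on_bounded_linear
      bounded_linear_mult_const bounded_linear_compose[OF bounded_linear_of_real]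
      bounded_linear_compose[OF bounded_linear_fst bounded_linear_snd])

lemma smooth_on_Omega:
  assumes "open S"
  shows "smooth_on S (\<lambda>p. Omega a p vs)"
proof (cases "length vs = 2")
  case True
  then obtain v w where "vs = [v, w]" by (rule length_2_cases)
  moreover have "Omega a p [v, w] = phi1 v * phi2 a p w + - phi1 w * phi2 a p v" for p
    by (simp add: Omega_2)
  ultimately show ?thesis
    using assms by (simp only:) (intro smooth_on_add smooth_on_mult smooth_on_const smooth_on_phi2)
qed (simp add: Omega_wrong_length smooth_on_const assms)

lemma smooth_on_Omega_power: "open S \<Longrightarrow> smooth_on S (\<lambda>p. Omega_power a m p vs)"
  by (induction m arbitrary: vs)
    (simp_all add: tensor_product_def smooth_on_const smooth_on_mult smooth_on_Omega)

text \<open>Copies of the pair \<open>D_t\<close>, \<open>D_z\<close>, on which \<open>Omega\<close>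
  has the constant nonzero value \<open>\<i> * a\<close>. Evaluation there recovers the coefficient
  function of a multiple of \<open>Omega_power\<close>.\<close>

definition test_vectors :: "nat \<Rightarrow> coords list" where
  "test_vectors m = concat (replicate m [(1, 0, 0, 0), (0, 0, 0, 1)])"

lemma Omega_power_test_vectors: "Omega_power a m p (test_vectors m) = (\<i> * of_real a) ^ m"
proof (induction m)
  case (Suc m)
  have "Omega a p [(1, 0, 0, 0), (0, 0, 0, 1)] = \<i> * of_real a"
    by (cases p) (simp add: Omega_2 complex_eq_iff)
  then show ?case using Suc by (simp add: test_vectors_def tensor_product_def numeral_2_eq_2)
qed (simp add: test_vectors_def)

section \<open>Splitting a complex-valued linear form by type\<close>

definition part10 :: "('e \<Rightarrow> 'e) \<Rightarrow> ('e \<Rightarrow> complex) \<Rightarrow> 'e \<Rightarrow> complex" where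
  "part10 j D v = (D v - \<i> * D (j v)) / 2"

text \<open>Applied to the differential of a function, this is the Cauchy-Riemann operator on
  functions.\<close>

definition part01 :: "('e \<Rightarrow> 'e) \<Rightarrow> ('e \<Rightarrow> complex) \<Rightarrow> 'e \<Rightarrow> complex" where
  "part01 j D v = (D v + \<i> * D (j v)) / 2"

lemma part10_add_part01: "part10 j D v + part01 j D v = D v"
  by (simp add: part10_def part01_def field_simps)

lemma part10_mem:
  assumes "linear D" "linear j" "\<And>v. j (j v) = - v"
  shows "part10 j D \<in> covectors10 j"
  using assms
  by (auto simp: covectors10_def part10_def linear_iff linear_neg[OF assms(1)] field_simps scaleR_conv_of_real)

lemma part01_mem:
  assumes "linear D" "linear j" "\<And>v. j (j v) = - v"
  shows "part01 j D \<in> covectors01 j"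
  using assms
  by (auto simp: covectors01_def part01_def linear_iff linear_neg[OF assms(1)] field_simps scaleR_conv_of_real)

lemma covectors01_add:
  assumes "\<alpha> \<in> covectors01 j" "\<beta> \<in> covectors01 j"
  shows "(\<lambda>v. \<alpha> v + c * \<beta> v) \<in> covectors01 j"
  using assms by (auto simp: covectors01_def linear_iff algebra_simps)

section \<open>Sections as invariant fields on the covering space\<close>

text \<open>The zero values off the chart images match the normalisation demanded in
  \<open>sections\<close>.\<close>

definition section_of :: "(coords \<Rightarrow> coords tensor) \<Rightarrow> (real set \<times> (real^3^3) set, coords) tensor_field" where
  "section_of G c p = (if c \<in> KT_atlas \<and> p \<in> chart_image c then G p else (\<lambda>_. 0))"

lemma deck_zero [simp]: "deck (0, 0, 0, 0) p = p" "deck_linear (0, 0, 0, 0) = (\<lambda>v. v)"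
  by (cases p, simp) (auto simp: fun_eq_iff)

text \<open>The transition maps are deck transformations, so compatibility under pull-back becomes
  deck invariance of one field on the covering space.\<close>

lemma sections_KT:
  "s \<in> sections KT_atlas (KT_J a) F \<longleftrightarrow>
    (\<exists>G. s = section_of G \<and> (\<forall>p. G p \<in> F (std_J a p)) \<and> (\<forall>vs. smooth_on UNIV (\<lambda>p. G p vs)) \<and>
      (\<forall>g p vs. G (deck g p) (map (deck_linear g) vs) = G p vs))" (is "_ \<longleftrightarrow> (\<exists>G. ?R G)")
proof
  assume s: "s \<in> sections KT_atlas (KT_J a) F"
  define ball_chart where "ball_chart p = KT_chart (ball p (1/2))" for p
  have ball_atlas: "ball_chart p \<in> KT_atlas" for p
    unfolding KT_atlas_iff ball_chart_def using inj_on_KT_cover_ball by blast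
  have ball_image: "chart_image (ball_chart p) = ball p (1/2)" for p
    by (simp add: ball_chart_def chart_image_KT_chart inj_on_KT_cover_ball)
  \<comment> \<open>The value at \<open>p\<close> is read in the chart on the ball centred at
    \<open>p\<close>.\<close>
  define G where "G p = s (ball_chart p) p" for p
  have glue: "s (KT_chart V) p vs = s (KT_chart V') (deck g p) (map (deck_linear g) vs)"
    if V: "open V" "inj_on KT_cover V" "open V'" "inj_on KT_cover V'" "p \<in> V" "deck g p \<in> V'" for V V' p g vs
  proof -
    have "p \<in> overlap (KT_chart V) (KT_chart V')" using that by (auto simp: overlap_KT_chart)
    moreover have "KT_chart V \<in> KT_atlas" "KT_chart V' \<in> KT_atlas" using V unfolding KT_atlas_iff by blast+
    ultimately have "s (KT_chart V) p vs = s (KT_chart V') (transition (KT_chart V) (KT_chart V') p)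
        (map (frechet_derivative (transition (KT_chart V) (KT_chart V')) (at p)) vs)"
      using s unfolding sections_def by blast
    then show ?thesis
      using V by (simp add: frechet_derivative_transition transition_KT_chart)
  qed
  \<comment> \<open>Two charts whose images contain \<open>p\<close> are compared through the
    identity deck element, so the value at \<open>p\<close> does not depend on the chart.\<close>
  have s_eq: "s c p = G p" if "c \<in> KT_atlas" "p \<in> chart_image c" for c p
  proof
    fix vs
    obtain V where V: "c = KT_chart V" "open V" "inj_on KT_cover V"
      using \<open>c \<in> KT_atlas\<close> unfolding KT_atlas_iff by blast
    then show "s c p vs = G p vs"
      using glue[of V "ball p (1/2)" p "(0, 0, 0, 0)" vs] that
      by (simp add: G_def ball_chart_def inj_on_KT_cover_ball chart_image_KT_chart)
  qed
  have "s c p = section_of G c p" for c p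
    using s s_eq by (auto simp: section_of_def sections_def)
  then have "s = section_of G" by (simp add: fun_eq_iff)
  moreover have "G p \<in> F (std_J a p)" for p
    using s ball_atlas[of p] ball_image[of p] by (auto simp: sections_def local_sections_def G_def KT_J_std)
  moreover have "smooth_on UNIV (\<lambda>p. G p vs)" for vs
  proof (rule smooth_on_local)
    fix p
    have "smooth_on (ball p (1/2)) (\<lambda>q. s (ball_chart p) q vs)"
      using s ball_atlas[of p] ball_image[of p] by (auto simp: sections_def local_sections_def)
    then have "smooth_on (ball p (1/2)) (\<lambda>q. G q vs)"
      by (rule smooth_on_cong[rotated 2]) (use s_eq[OF ball_atlas[of p]] ball_image in auto)
    then show "\<exists>U. open U \<and> p \<in> U \<and> smooth_on U (\<lambda>p. G p vs)"
      by (intro exI[of _ "ball p (1/2)"]) auto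
  qed
  moreover have "G (deck g p) (map (deck_linear g) vs) = G p vs" for g p vs
    using glue[of "ball p (1/2)" "ball (deck g p) (1/2)" p g vs]
    by (simp add: G_def ball_chart_def inj_on_KT_cover_ball)
  ultimately show "\<exists>G. ?R G" by blast
next
  assume "\<exists>G. ?R G"
  then obtain G where G: "s = section_of G" "\<And>p. G p \<in> F (std_J a p)" "\<And>vs. smooth_on UNIV (\<lambda>p. G p vs)"
    "\<And>g p vs. G (deck g p) (map (deck_linear g) vs) = G p vs" by blast
  have s_eq: "s c p = G p" if "c \<in> KT_atlas" "p \<in> chart_image c" for c p
    using that by (simp add: G(1) section_of_def)
  show "s \<in> sections KT_atlas (KT_J a) F"
    unfolding sections_def mem_Collect_eq
  proof (intro conjI ballI allI impI)
    show "s c p = (\<lambda>_. 0)" if "c \<notin> KT_atlas \<or> p \<notin> chart_image c" for c p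
      using that by (auto simp: G(1) section_of_def)
    show "s c \<in> local_sections (chart_image c) (KT_J a c) F" if c: "c \<in> KT_atlas" for c
    proof -
      have "open (chart_image c)" using c unfolding KT_atlas_iff by (auto simp: chart_image_KT_chart)
      then have "smooth_on (chart_image c) (\<lambda>p. s c p vs)" for vs
        by (rule smooth_on_cong[OF _ _ smooth_on_subset[OF G(3)[of vs] subset_UNIV]]) (simp add: s_eq[OF c])
      then show ?thesis
        using G(2) by (simp add: local_sections_def KT_J_std s_eq[OF c])
    qed
  next
    fix c c' p vs assume c: "c \<in> KT_atlas" "c' \<in> KT_atlas" and p: "p \<in> overlap c c'"
    then obtain V V' where V: "open V" "inj_on KT_cover V" "open V'" "inj_on KT_cover V'"
      and c_eq: "c = KT_chart V" "c' = KT_chart V'"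
      unfolding KT_atlas_iff by blast
    obtain g where g: "p \<in> V" "deck g p \<in> V'"
      using p unfolding c_eq overlap_KT_chart[OF V(2,4)] by blast
    have "s c p vs = G p vs" using c g V by (simp add: s_eq c_eq chart_image_KT_chart)
    also have "\<dots> = G (deck g p) (map (deck_linear g) vs)" by (simp add: G(4))
    also have "\<dots> = s c' (transition c c' p) (map (frechet_derivative (transition c c') (at p)) vs)"
      using c g V by (simp add: s_eq c_eq chart_image_KT_chart transition_KT_chart frechet_derivative_transition)
    finally show "s c p vs = s c' (transition c c' p) (map (frechet_derivative (transition c c') (at p)) vs)" .
  qed
qed

lemma exists_chart: "\<exists>c\<in>KT_atlas. p \<in> chart_image c"
proof
  show "KT_chart (ball p (1/2)) \<in> KT_atlas" unfolding KT_atlas_iff using inj_on_KT_cover_ball by blast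
  show "p \<in> chart_image (KT_chart (ball p (1/2)))" by (simp add: chart_image_KT_chart inj_on_KT_cover_ball)
qed

lemma cdim_eq_1:
  assumes "s0 \<in> V" "s0 \<noteq> 0" "V \<subseteq> {\<lambda>c x vs. C * s0 c x vs | C. True}"
  shows "cdim V = 1"
proof -
  have span: "V \<subseteq> tensor_field.span {s0}"
    using assms(3) by (auto simp: tensor_field.span_singleton)
  have "tensor_field.dim V = 1"
    by (rule tensor_field.dim_unique[of "{s0}"]) (use assms span in auto)
  then show ?thesis using span by (auto simp: cdim_def one_enat_def)
qed

lemma cdim_eq_0:
  assumes "V \<subseteq> {0}"
  shows "cdim V = 0"
proof -
  have "tensor_field.dim V = 0"
    by (rule tensor_field.dim_unique[of "{}"]) (use assms tensor_field.independent_empty in auto)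
  moreover have "V \<subseteq> tensor_field.span {}" using assms by simp
  ultimately show ?thesis unfolding cdim_def zero_enat_def by (metis finite.emptyI)
qed

text \<open>The compact unit cube meets every deck orbit.\<close>

lemma bounded_invariant:
  fixes f :: "coords \<Rightarrow> complex"
  assumes cont: "continuous_on UNIV f" and inv: "\<And>g p. f (deck g p) = f p"
  obtains M where "\<And>p. norm (f p) \<le> M"
proof -
  define K :: "coords set" where "K = {0..1} \<times> {0..1} \<times> {0..1} \<times> {0..1}"
  have "compact K" unfolding K_def by (intro compact_Times compact_Icc)
  then have "bounded (f ` K)"
    by (intro compact_imp_bounded compact_continuous_image continuous_on_subset[OF cont]) auto
  then obtain M where M: "\<And>p. p \<in> K \<Longrightarrow> norm (f p) \<le> M" unfolding bounded_iff by blast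
  have "norm (f p) \<le> M" for p
  proof -
    obtain t x y z where p: "p = (t, x, y, z)" by (cases p) auto
    \<comment> \<open>Moving \<open>x\<close> into the unit interval shears \<open>z\<close> by
      \<open>k * y\<close>; hence the floor of \<open>z + of_int k * y\<close> in the last
      component.\<close>
    define k where "k = - \<lfloor>x\<rfloor>"
    have "deck (- \<lfloor>t\<rfloor>, k, - \<lfloor>y\<rfloor>, - \<lfloor>z + of_int k * y\<rfloor>) p = (frac t, frac x, frac y, frac (z + of_int k * y))"
      by (simp add: p k_def frac_def)
    moreover have "(frac t, frac x, frac y, frac (z + of_int k * y)) \<in> K"
      by (simp add: K_def less_imp_le[OF frac_lt_1])
    ultimately show ?thesis using M inv by metis
  qed
  then show ?thesis using that by blast
qed

text \<open>For fixed \<open>t\<close> and \<open>x\<close> this is a Cauchy-Riemann equation with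
  constant coefficient \<open>\<tau> = x + \<i> / a\<close>, whose imaginary part
  \<open>1 / a\<close> is nonzero.\<close>

lemma fiber_Cauchy_Riemann:
  fixes f :: "coords \<Rightarrow> complex"
  assumes a: "a \<noteq> 0" and f: "\<And>p. (f has_derivative D p) (at p)" and bdd: "\<And>p. norm (f p) \<le> M"
    and CR: "\<And>y z. D (t, x, y, z) (0, 0, 1, x) + \<i> / of_real a * D (t, x, y, z) (0, 0, 0, 1) = K"
  shows "K = 0" and "f (t, x, y, z) = f (t, x, 0, 0)"
proof -
  define F where "F q = f (t, x, fst q, snd q)" for q
  define DF where "DF q h = D (t, x, fst q, snd q) (0, 0, fst h, snd h)" for q h
  have F: "(F has_derivative DF q) (at q)" for q
    unfolding F_def DF_def
    by (rule has_derivative_compose[OF _ f]) (auto intro!: derivative_eq_intros simp: zero_prod_def)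
  have "DF q (1, 0) + (of_real x + \<i> / of_real a) * DF q (0, 1) = K" for q
  proof -
    have "D (t, x, fst q, snd q) (0, 0, 1, x) = D (t, x, fst q, snd q) ((0, 0, 1, 0) + x *\<^sub>R (0, 0, 0, 1))"
      by simp
    also have "\<dots> = DF q (1, 0) + of_real x * DF q (0, 1)"
      unfolding linear_add[OF has_derivative_linear[OF f]] linear_scale[OF has_derivative_linear[OF f]]
      by (simp add: DF_def scaleR_conv_of_real)
    finally show ?thesis
      using CR[of "fst q" "snd q"] by (simp add: DF_def algebra_simps)
  qed
  note CR' = bounded_Cauchy_Riemann[OF F this _ bdd[of "(t, x, fst q, snd q)" for q, folded F_def]]
  show "K = 0" by (rule CR'(1)) (use a in \<open>simp add: Im_divide\<close>)
  have "F (y, z) = F (0, 0)" by (rule CR'(2)) (use a in \<open>simp add: Im_divide\<close>)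
  then show "f (t, x, y, z) = f (t, x, 0, 0)" by (simp add: F_def)
qed

text \<open>The second equation removes the dependence on \<open>y\<close> and \<open>z\<close>; the
  first then determines the remaining function of \<open>t\<close> and \<open>x\<close> up to a
  constant.\<close>

lemma invariant_Cauchy_Riemann:
  fixes f :: "coords \<Rightarrow> complex" and c :: real
  assumes a: "a \<noteq> 0" and f: "\<And>p. (f has_derivative D p) (at p)" and inv: "\<And>g p. f (deck g p) = f p"
    and CR1: "\<And>p. D p (1, 0, 0, 0) + \<i> * D p (0, 1, 0, 0) + of_real c * f p = 0"
    and CR2: "\<And>t x y z. D (t, x, y, z) (0, 0, 1, x) + \<i> / of_real a * D (t, x, y, z) (0, 0, 0, 1) = 0"
  obtains C where "\<And>p. f p = C * exp (\<i> * of_real (c * fst (snd p)))" "C = 0 \<or> exp (\<i> * of_real c) = 1"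
proof -
  have cont: "continuous_on UNIV f"
    using f by (meson continuous_at_imp_continuous_on has_derivative_continuous)
  obtain M where M: "\<And>p. norm (f p) \<le> M" using bounded_invariant[OF cont inv] by blast
  define F where "F q = f (fst q, snd q, 0, 0)" for q
  define DF where "DF q h = D (fst q, snd q, 0, 0) (fst h, snd h, 0, 0)" for q h
  have F: "(F has_derivative DF q) (at q)" for q
    unfolding F_def DF_def
    by (rule has_derivative_compose[OF _ f]) (auto intro!: derivative_eq_intros simp: zero_prod_def)
  have "F (t, x) = F (0, 0) * exp (\<i> * of_real (c * x))" for t x
    by (rule bounded_twisted_Cauchy_Riemann[OF F]) (use CR1 M in \<open>auto simp: DF_def F_def\<close>)
  then have eq: "f (t, x, y, z) = F (0, 0) * exp (\<i> * of_real (c * x))" for t x y z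
  proof -
    have "f (t, x, y, z) = f (t, x, 0, 0)"
      by (rule fiber_Cauchy_Riemann(2)[where f = f and D = D and K = 0 and a = a and M = M])
        (rule a f M CR2)+
    moreover have "F (t, x) = F (0, 0) * exp (\<i> * of_real (c * x))" by fact
    ultimately show ?thesis by (simp only: F_def fst_conv snd_conv)
  qed
  show ?thesis
  proof (rule that)
    show "f p = F (0, 0) * exp (\<i> * of_real (c * fst (snd p)))" for p
      using eq by (cases p) simp
    \<comment> \<open>The deck transformation shifting \<open>x\<close> by 1 multiplies the wave by
      \<open>exp (\<i> * of_real c)\<close>.\<close>
    have "f (deck (0, 1, 0, 0) (0, 0, 0, 0)) = f (0, 0, 0, 0)" by (rule inv)
    then show "F (0, 0) = 0 \<or> exp (\<i> * of_real c) = 1" by (simp add: eq)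
  qed
qed

section \<open>Non-integrability\<close>

text \<open>Differentiating the two holomorphy equations and using symmetry of second derivatives
  computes the commutator of the (0,1)-fields; the only surviving term comes from the coefficient
  \<open>x\<close>.\<close>

lemma D_z_annihilates:
  assumes a: "a \<noteq> 0" and U: "open U" and w: "smooth_on U w" and y: "y \<in> U"
    and J: "\<And>y v. y \<in> U \<Longrightarrow> frechet_derivative w (at y) (std_J a y v) = \<i> * frechet_derivative w (at y) v"
  shows "frechet_derivative w (at y) (0, 0, 0, 1) = (0 :: complex)"
proof -
  define D where "D y = frechet_derivative w (at y)" for y
  define D2 where "D2 u y = frechet_derivative (\<lambda>z. D z u) (at y)" for u y
  have C2: "Ck_on (Suc (Suc 0)) U w" using w unfolding smooth_on_def by blast
  have D: "(w has_derivative D y) (at y)" if "y \<in> U" for y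
    unfolding D_def by (rule smooth_on_imp_has_derivative[OF w that])
  have D2: "((\<lambda>z. D z u) has_derivative D2 u y) (at y)" if "y \<in> U" for y u
  proof -
    have "Ck_on (Suc 0) U (\<lambda>z. D z u)" using C2 unfolding D_def Ck_on.simps(2)[of "Suc 0"] by blast
    from Ck_on_has_derivative[OF this that] show ?thesis by (simp add: D2_def)
  qed
  have cont: "continuous_on U (\<lambda>y. D2 u y v)" for u v
    using C2 unfolding D2_def D_def Ck_on.simps by blast
  have sym: "D2 u y v = D2 v y u" for u v
    by (rule second_derivative_symmetric[OF U y D D2 D2 cont cont])
  note linear_D = has_derivative_linear[OF D]
  let ?t = "(1, 0, 0, 0) :: coords" and ?x = "(0, 1, 0, 0) :: coords"
    and ?y = "(0, 0, 1, 0) :: coords" and ?z = "(0, 0, 0, 1) :: coords"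
  define X where "X p = fst (snd p)" for p :: coords
  have X: "(X has_derivative X) (at p)" for p
    unfolding X_def by (auto intro!: derivative_eq_intros)
  have E1: "D p ?x = \<i> * D p ?t" if "p \<in> U" for p
    using J[OF that, of ?t] by (cases p) (simp add: D_def)
  have E2: "D p ?y + (of_real (X p) + \<i> / of_real a) * D p ?z = 0" if "p \<in> U" for p
  proof -
    have "D p (std_J a p ?z) = \<i> * D p ?z" using J[OF that, of ?z] by (simp add: D_def)
    moreover have "std_J a p ?z = (- a) *\<^sub>R (?y + X p *\<^sub>R ?z)" by (cases p) (simp add: X_def)
    ultimately have "- (of_real a * (D p ?y + of_real (X p) * D p ?z)) = \<i> * D p ?z"
      by (simp only: linear_add[OF linear_D[OF that]] linear_scale[OF linear_D[OF that]] scaleR_conv_of_real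
          of_real_minus mult_minus_left)
    note eq = this
    have "of_real a * (D p ?y + (of_real (X p) + \<i> / of_real a) * D p ?z)
        = of_real a * (D p ?y + of_real (X p) * D p ?z) + \<i> * D p ?z"
      using a by (simp add: field_simps)
    also have "\<dots> = 0" unfolding eq[symmetric] by simp
    finally have "of_real a * (D p ?y + (of_real (X p) + \<i> / of_real a) * D p ?z) = 0" .
    then show ?thesis using a by simp
  qed
  have F1: "D2 ?x y v = \<i> * D2 ?t y v" for v
  proof -
    have "((\<lambda>p. D p ?x) has_derivative (\<lambda>v. \<i> * D2 ?t y v)) (at y)"
      by (rule has_derivative_transform_within_open[OF has_derivative_mult_right[OF D2[OF y]] U y]) (simp add: E1)
    from has_derivative_unique[OF D2[OF y] this] show ?thesis by (rule fun_cong)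
  qed
  \<comment> \<open>The last summand is the derivative of the variable coefficient
    \<open>X p\<close> in \<open>E2\<close>.\<close>
  have F2: "D2 ?y y v + (of_real (X y) + \<i> / of_real a) * D2 ?z y v + of_real (X v) * D y ?z = 0" for v
  proof -
    have "((\<lambda>p. of_real (X p) + \<i> / of_real a :: complex) has_derivative (\<lambda>v. of_real (X v))) (at y)"
      by (auto intro!: derivative_eq_intros X)
    from has_derivative_add[OF D2[OF y, of ?y] has_derivative_mult[OF this D2[OF y, of ?z]]]
    have "((\<lambda>p. 0) has_derivative (\<lambda>v. D2 ?y y v + ((of_real (X y) + \<i> / of_real a) * D2 ?z y v + of_real (X v) * D y ?z))) (at y)"
      by (rule has_derivative_transform_within_open[OF _ U y]) (simp add: E2)
    from fun_cong[OF has_derivative_unique[OF this has_derivative_const], of v]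
    show ?thesis by (simp add: add.assoc)
  qed
  have t: "D2 ?y y ?t + (of_real (X y) + \<i> / of_real a) * D2 ?z y ?t = 0"
    using F2[of ?t] by (simp add: X_def)
  \<comment> \<open>By symmetry, differentiating along \<open>?x\<close> is \<open>\<i>\<close>
    times differentiating along \<open>?t\<close>, where \<open>X\<close> vanishes. So
    \<open>F2\<close> at \<open>?x\<close> is \<open>\<i>\<close> times the equation
    \<open>t\<close> plus \<open>D y ?z\<close>.\<close>
  have "D2 u y ?x = \<i> * D2 u y ?t" for u
    unfolding sym[of u ?x] sym[of u ?t] by (rule F1)
  then have "\<i> * (D2 ?y y ?t + (of_real (X y) + \<i> / of_real a) * D2 ?z y ?t) + D y ?z = 0"
    using F2[of ?x] by (simp add: X_def algebra_simps)
  then have "D y ?z = 0" unfolding t by simp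
  then show ?thesis by (simp add: D_def)
qed

text \<open>Holomorphic coordinates would have differentials with trivial common kernel, but
  \<open>D_z_annihilates\<close> puts a nonzero vector into it.\<close>

lemma not_integrable_KT:
  assumes a: "a \<noteq> 0"
  shows "\<not> integrable_structure KT_atlas (KT_J a)"
proof
  assume int: "integrable_structure KT_atlas (KT_J a)"
  obtain c where c: "c \<in> KT_atlas" "0 \<in> chart_image c" using exists_chart by blast
  show False
    using bspec[OF bspec[OF int[unfolded integrable_structure_def Let_def DIM_coords_div_2 KT_J_std] c(1)] c(2)]
  proof (elim exE conjE)
    fix U and w :: "nat \<Rightarrow> coords \<Rightarrow> complex"
    assume U: "open U" "0 \<in> U" and w: "\<forall>i<2. smooth_on U (w i)"
      "\<forall>i<2. \<forall>y\<in>U. \<forall>v. frechet_derivative (w i) (at y) (std_J a y v) = \<i> * frechet_derivative (w i) (at y) v"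
      "\<forall>y\<in>U. \<forall>v. (\<forall>i<2. frechet_derivative (w i) (at y) v = 0) \<longrightarrow> v = 0"
    have "\<forall>i<2. frechet_derivative (w i) (at 0) (0, 0, 0, 1) = 0"
    proof (intro allI impI)
      fix i :: nat assume i: "i < 2"
      show "frechet_derivative (w i) (at 0) (0, 0, 0, 1) = 0"
        by (rule D_z_annihilates[OF a U(1) w(1)[rule_format, OF i] U(2) w(2)[rule_format, OF i]])
    qed
    then have "(0, 0, 0, 1 :: real) = (0 :: coords)" using w(3) U(2) by blast
    then show False by (simp add: zero_prod_def)
  qed
qed

section \<open>The operators on the canonical bundle and its powers\<close>

lemma wedge_3_ext:
  assumes "\<And>u v w. \<eta> [u, v, w] = wedge [\<alpha>, \<beta>, \<gamma>] [u, v, w]" "\<And>vs. length vs \<noteq> 3 \<Longrightarrow> \<eta> vs = 0"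
  shows "\<eta> = wedge [\<alpha>, \<beta>, \<gamma>]"
proof
  show "\<eta> vs = wedge [\<alpha>, \<beta>, \<gamma>] vs" for vs
    by (cases "length vs = 3") (auto elim!: length_3_cases simp: assms wedge_wrong_length)
qed

lemma wedge_3_add: "wedge [\<lambda>v. \<alpha> v + c * \<beta> v, \<gamma>, \<delta>] [u, v, w]
    = wedge [\<alpha>, \<gamma>, \<delta>] [u, v, w] + c * wedge [\<beta>, \<gamma>, \<delta>] [u, v, w]"
  by (simp add: wedge_3 algebra_simps)

text \<open>The alternating sum is the expansion of a three by three determinant along the row of
  \<open>\<beta>\<close>.\<close>

lemma alternate_wedge:
  "alternate 2 (tensor_product 1 (wedge [\<beta>]) (Omega a p)) = wedge [\<beta>, phi1, phi2 a p]"
proof (rule wedge_3_ext)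
  show "alternate 2 (tensor_product 1 (wedge [\<beta>]) (Omega a p)) [u, v, w] = wedge [\<beta>, phi1, phi2 a p] [u, v, w]" for u v w
    by (simp add: alternate_def tensor_product_def omit_def wedge_1 wedge_3 Omega_2 numeral_2_eq_2 algebra_simps)
qed (simp add: alternate_def)

text \<open>The tensor \<open>- \<i> * a * dx \<otimes> dy\<close>. It is the same at all points
  because the coefficients of \<open>phi2\<close> are affine in \<open>x\<close>.\<close>

definition dphi2 :: "real \<Rightarrow> coords \<Rightarrow> coords \<Rightarrow> complex" where
  "dphi2 a u w = of_real (fst (snd u)) * (- (\<i> * of_real (a * fst (snd (snd w)))))"

lemma has_derivative_phi2: "((\<lambda>y. phi2 a y w) has_derivative (\<lambda>u. dphi2 a u w)) (at p)"
  unfolding dphi2_def phi2_conv_linear by (auto intro!: derivative_eq_intros)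

text \<open>Substitute \<open>dx = (phi1 - cnj phi1) / (2 * \<i>)\<close> and
  \<open>dy = (phi2 + cnj phi2) / 2\<close>.\<close>

lemma dphi2_eq:
  "dphi2 a u w = - (of_real a / 4 * ((phi1 u - cnj (phi1 u)) * (phi2 a p w + cnj (phi2 a p w))))"
  by (cases p, cases u, cases w) (simp add: dphi2_def complex_eq_iff)

text \<open>The directional derivative of \<open>Omega\<close> along \<open>u\<close>, not yet
  alternated; its alternating sum is the exterior derivative.\<close>

definition dOmega :: "real \<Rightarrow> coords \<Rightarrow> coords \<Rightarrow> coords \<Rightarrow> complex" where
  "dOmega a u v w = phi1 v * dphi2 a u w - phi1 w * dphi2 a u v"

lemma has_derivative_Omega: "((\<lambda>y. Omega a y [v, w]) has_derivative (\<lambda>u. dOmega a u v w)) (at p)"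
  unfolding Omega_2 dOmega_def by (intro has_derivative_diff has_derivative_mult_right has_derivative_phi2)

text \<open>This sorts the exterior derivative of \<open>Omega\<close> by type: the first wedge is
  of type (2,1) and produces the term with \<open>a / 4\<close> in the operator, the second is of
  type (1,2).\<close>

lemma dOmega_alternating:
  "dOmega a u v w - dOmega a v u w + dOmega a w u v =
    of_real (a / 4) * wedge [\<lambda>v. cnj (phi1 v), phi1, phi2 a p] [u, v, w]
    - of_real (a / 4) * wedge [phi1, \<lambda>v. cnj (phi1 v), \<lambda>v. cnj (phi2 a p v)] [u, v, w]"
  unfolding wedge_3 dOmega_def dphi2_eq[of a _ _ p] by (simp add: algebra_simps)

text \<open>The Leibniz rule for a function times the form \<open>Omega\<close>.\<close>

lemma ext_deriv_canonical:
  assumes f: "(f has_derivative D) (at p)"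
    and U: "open U" "p \<in> U" and s: "\<And>y. y \<in> U \<Longrightarrow> s y = (\<lambda>vs. f y * Omega a y vs)"
  shows "ext_deriv 2 s p [u, v, w] =
    wedge [D, phi1, phi2 a p] [u, v, w] + f p * (dOmega a u v w - dOmega a v u w + dOmega a w u v)"
proof -
  have "frechet_derivative (\<lambda>y. s y [v, w]) (at p) u = D u * Omega a p [v, w] + f p * dOmega a u v w" for u v w
  proof -
    have "((\<lambda>y. f y * Omega a y [v, w]) has_derivative (\<lambda>u. f p * dOmega a u v w + D u * Omega a p [v, w])) (at p)"
      by (rule has_derivative_mult[OF f has_derivative_Omega])
    then have "((\<lambda>y. s y [v, w]) has_derivative (\<lambda>u. f p * dOmega a u v w + D u * Omega a p [v, w])) (at p)"
      by (rule has_derivative_transform_within_open[OF _ U]) (simp add: s)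
    from fun_cong[OF frechet_derivative_at[OF this], of u]
    show ?thesis by (simp only: add.commute[of "D u * _"])
  qed
  note frechet = this
  show ?thesis
    by (simp add: ext_deriv_def omit_def numeral_2_eq_2 wedge_3 frechet Omega_2 algebra_simps)
qed

lemma wedge_mem_Lambda:
  "length \<alpha>s = p \<Longrightarrow> length \<beta>s = q \<Longrightarrow> set \<alpha>s \<subseteq> covectors10 j \<Longrightarrow> set \<beta>s \<subseteq> covectors01 j \<Longrightarrow>
    wedge (\<alpha>s @ \<beta>s) \<in> Lambda p q j"
  unfolding Lambda_def by (intro tensor.span_base) blast

text \<open>The single closure condition yields sums with \<open>k = 1\<close> and scalar multiples
  with \<open>b\<close> zero.\<close>

lemma subspace_wedge_1:
  assumes zero: "(\<lambda>v. 0) \<in> B" and add: "\<And>b c k. b \<in> B \<Longrightarrow> c \<in> B \<Longrightarrow> (\<lambda>v. b v + k * c v) \<in> B"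
  shows "tensor.subspace {wedge [b] | b. b \<in> B}"
  unfolding tensor.subspace_def
proof (intro conjI ballI allI)
  have "0 = wedge [\<lambda>v. 0]" by (auto simp: wedge_1 fun_eq_iff split: list.splits)
  then show "0 \<in> {wedge [b] | b. b \<in> B}" using zero by blast
next
  fix \<eta> \<theta> assume "\<eta> \<in> {wedge [b] | b. b \<in> B}" "\<theta> \<in> {wedge [b] | b. b \<in> B}"
  then obtain b c where bc: "\<eta> = wedge [b]" "\<theta> = wedge [c]" "b \<in> B" "c \<in> B" by auto
  then have "\<eta> + \<theta> = wedge [\<lambda>v. b v + 1 * c v]" by (auto simp: wedge_1 fun_eq_iff split: list.splits)
  then show "\<eta> + \<theta> \<in> {wedge [b] | b. b \<in> B}" using add[OF bc(3,4), of 1] by blast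
next
  fix k \<eta> assume "\<eta> \<in> {wedge [b] | b. b \<in> B}"
  then obtain b where b: "\<eta> = wedge [b]" "b \<in> B" by auto
  have "(\<lambda>i. k * \<eta> i) = wedge [\<lambda>v. 0 + k * b v]" by (auto simp: b wedge_1 fun_eq_iff split: list.splits)
  then show "(\<lambda>i. k * \<eta> i) \<in> {wedge [b] | b. b \<in> B}" using add[OF zero b(2), of k] by blast
qed

lemma Lambda_1_0: "Lambda 1 0 j = {wedge [\<alpha>] | \<alpha>. \<alpha> \<in> covectors10 j}"
proof -
  have "tensor.subspace {wedge [\<alpha>] | \<alpha>. \<alpha> \<in> covectors10 j}"
    by (rule subspace_wedge_1) (auto simp: covectors10_def linear_iff algebra_simps)
  moreover have "{wedge (\<alpha>s @ \<beta>s) | \<alpha>s \<beta>s. length \<alpha>s = 1 \<and> length \<beta>s = 0 \<and>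
      set \<alpha>s \<subseteq> covectors10 j \<and> set \<beta>s \<subseteq> covectors01 j} = {wedge [\<alpha>] | \<alpha>. \<alpha> \<in> covectors10 j}"
    by (force simp: length_Suc_conv)
  ultimately show ?thesis unfolding Lambda_def by (simp only: tensor.span_eq_iff)
qed

lemma Lambda_0_1: "Lambda 0 1 j = {wedge [\<beta>] | \<beta>. \<beta> \<in> covectors01 j}"
proof -
  have "tensor.subspace {wedge [\<beta>] | \<beta>. \<beta> \<in> covectors01 j}"
    by (rule subspace_wedge_1) (auto simp: covectors01_def linear_iff algebra_simps)
  moreover have "{wedge (\<alpha>s @ \<beta>s) | \<alpha>s \<beta>s. length \<alpha>s = 0 \<and> length \<beta>s = 1 \<and>
      set \<alpha>s \<subseteq> covectors10 j \<and> set \<beta>s \<subseteq> covectors01 j} = {wedge [\<beta>] | \<beta>. \<beta> \<in> covectors01 j}"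
    by (force simp: length_Suc_conv)
  ultimately show ?thesis unfolding Lambda_def by (simp only: tensor.span_eq_iff)
qed

lemma Lambda_mem_other_types:
  "\<eta> \<in> Lambda p' q' j \<Longrightarrow> p' + q' = n \<Longrightarrow> (p', q') \<noteq> (p, q) \<Longrightarrow>
    \<eta> \<in> \<Union>{Lambda p' q' j | p' q'. p' + q' = n \<and> (p', q') \<noteq> (p, q)}"
  by blast

text \<open>The (2,1)-part of the exterior derivative is a (0,1)-covector wedged with
  \<open>Omega\<close>; inverting \<open>alternate\<close> turns that wedge into a tensor
  product.\<close>

lemma dbar_canonical_eq:
  assumes a: "a \<noteq> 0" and f: "(f has_derivative D) (at p)"
    and U: "open U" "p \<in> U" and s: "\<And>y. y \<in> U \<Longrightarrow> s y = (\<lambda>vs. f y * Omega a y vs)"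
  shows "dbar_canonical (std_J a) s p = tensor_product 1
    (wedge [\<lambda>v. part01 (std_J a p) D v + of_real (a / 4) * f p * cnj (phi1 v)]) (Omega a p)"
proof -
  let ?j = "std_J a p"
  define \<beta> where "\<beta> = (\<lambda>v. part01 ?j D v + of_real (a / 4) * f p * cnj (phi1 v))"
  define \<zeta> where "\<zeta> = wedge [\<beta>, phi1, phi2 a p]"
  define r where "r = of_real (a / 4) * f p"
  have lin: "linear D" using has_derivative_linear[OF f] .
  have \<beta>: "\<beta> \<in> covectors01 ?j"
    unfolding \<beta>_def using part01_mem[OF lin linear_std_J std_J_square[OF a]] phi_mem_covectors[OF a]
    by (intro covectors01_add) auto
  have p10: "part10 ?j D \<in> covectors10 ?j"
    by (rule part10_mem[OF lin linear_std_J std_J_square[OF a]])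
  define \<eta> where "\<eta> = ext_deriv 2 s p"
  \<comment> \<open>The two terms on the right have types (3,0) and (1,2), so \<open>\<zeta>\<close>
    is what the projection to type (2,1) retains.\<close>
  have diff: "\<eta> - \<zeta> = wedge ([part10 ?j D, phi1, phi2 a p] @ [])
      + (\<lambda>vs. (- r) * wedge ([phi1] @ [\<lambda>v. cnj (phi1 v), \<lambda>v. cnj (phi2 a p v)]) vs)"
  proof
    fix vs :: "coords list"
    show "(\<eta> - \<zeta>) vs = (wedge ([part10 ?j D, phi1, phi2 a p] @ [])
      + (\<lambda>vs. (- r) * wedge ([phi1] @ [\<lambda>v. cnj (phi1 v), \<lambda>v. cnj (phi2 a p v)]) vs)) vs"
    proof (cases "length vs = 3")
      case True
      then obtain u v w where vs: "vs = [u, v, w]" by (rule length_3_cases)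
      have "wedge [D, phi1, phi2 a p] vs = wedge [part10 ?j D, phi1, phi2 a p] vs + wedge [part01 ?j D, phi1, phi2 a p] vs"
        using wedge_3_add[of "part10 ?j D" 1 "part01 ?j D" phi1 "phi2 a p" u v w]
        by (simp add: vs part10_add_part01)
      moreover have "\<zeta> vs = wedge [part01 ?j D, phi1, phi2 a p] vs
          + r * wedge [\<lambda>v. cnj (phi1 v), phi1, phi2 a p] vs"
        unfolding vs \<zeta>_def \<beta>_def r_def[symmetric] by (rule wedge_3_add)
      moreover have "\<eta> vs = wedge [D, phi1, phi2 a p] vs + r * wedge [\<lambda>v. cnj (phi1 v), phi1, phi2 a p] vs
          - r * wedge [phi1, \<lambda>v. cnj (phi1 v), \<lambda>v. cnj (phi2 a p v)] vs"
      proof -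
        have "\<eta> vs = wedge [D, phi1, phi2 a p] [u, v, w] + f p * (dOmega a u v w - dOmega a v u w + dOmega a w u v)"
          unfolding vs \<eta>_def using f U s by (rule ext_deriv_canonical)
        then show ?thesis
          unfolding dOmega_alternating[of a u v w p] r_def vs by (simp add: algebra_simps)
      qed
      ultimately show ?thesis by simp
    next
      case False
      then show ?thesis by (simp add: \<eta>_def \<zeta>_def ext_deriv_def wedge_wrong_length)
    qed
  qed
  have dbar: "dbar 2 0 (std_J a) s p = \<zeta>"
    unfolding dbar_def
  proof (rule type_projection_eqI)
    have "\<zeta> = wedge ([phi1, phi2 a p] @ [\<beta>])"
      unfolding \<zeta>_def append.simps
      by (rule wedge_3_ext) (simp_all add: wedge_3 wedge_wrong_length algebra_simps)
    then show "\<zeta> \<in> Lambda 2 (Suc 0) ?j"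
      using phi_mem_covectors[OF a, of p] \<beta> by (simp only:) (rule wedge_mem_Lambda; simp)
    have "wedge ([part10 ?j D, phi1, phi2 a p] @ []) \<in> Lambda 3 0 ?j"
      using phi_mem_covectors[OF a, of p] p10 by (intro wedge_mem_Lambda) auto
    moreover have "wedge ([phi1] @ [\<lambda>v. cnj (phi1 v), \<lambda>v. cnj (phi2 a p v)]) \<in> Lambda 1 2 ?j"
      using phi_mem_covectors[OF a, of p] by (intro wedge_mem_Lambda) auto
    ultimately have "\<eta> - \<zeta> \<in> tensor.span (\<Union>{Lambda p' q' ?j | p' q'. p' + q' = 2 + Suc 0 \<and> (p', q') \<noteq> (2, Suc 0)})"
      unfolding diff
      by (intro tensor.span_add tensor.span_scale tensor.span_base)
        (erule Lambda_mem_other_types; simp)+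
    then show "ext_deriv (2 + 0) s p - \<zeta> \<in> tensor.span (\<Union>{Lambda p' q' ?j | p' q'. p' + q' = 2 + Suc 0 \<and> (p', q') \<noteq> (2, Suc 0)})"
      by (simp add: \<eta>_def)
  qed
  define T where "T = tensor.span {tensor_product 1 \<beta> \<eta> | \<beta> \<eta>. \<beta> \<in> Lambda 0 1 ?j \<and> \<eta> \<in> canonical ?j}"
  text \<open>Contracting the first argument of \<open>\<beta> \<and> \<eta>\<close> with the (0,1)-part of a vector recovers \<open>\<beta> \<otimes> \<eta>\<close>.\<close>
  define C where "C \<sigma> vs = (if length vs = 3 then (\<sigma> vs + \<i> * \<sigma> (?j (hd vs) # tl vs)) / 2 else 0)"
    for \<sigma> :: "coords tensor" and vs
  have C: "C (alternate 2 \<tau>) = \<tau>" if "\<tau> \<in> T" for \<tau>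
  proof -
    have "T \<subseteq> {\<tau>. C (alternate 2 \<tau>) = \<tau>}"
      unfolding T_def
    proof (rule tensor.span_minimal)
      have "alternate 2 (\<tau> + \<tau>') = alternate 2 \<tau> + alternate 2 \<tau>'"
        "alternate 2 (\<lambda>i. c * \<tau> i) = (\<lambda>i. c * alternate 2 \<tau> i)" for \<tau> \<tau>' :: "coords tensor" and c
        by (auto simp: alternate_def fun_eq_iff sum.distrib sum_distrib_left algebra_simps)
      moreover have "C (\<sigma> + \<sigma>') = C \<sigma> + C \<sigma>'" "C (\<lambda>i. c * \<sigma> i) = (\<lambda>i. c * C \<sigma> i)" for \<sigma> \<sigma>' c
        by (auto simp: C_def fun_eq_iff field_simps)
      moreover have "C (alternate 2 0) = 0"
        by (auto simp: C_def alternate_def fun_eq_iff)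
      ultimately show "tensor.subspace {\<tau>. C (alternate 2 \<tau>) = \<tau>}"
        by (auto simp: tensor.subspace_def)
      show "{tensor_product 1 \<beta> \<eta> | \<beta> \<eta>. \<beta> \<in> Lambda 0 1 ?j \<and> \<eta> \<in> canonical ?j} \<subseteq> {\<tau>. C (alternate 2 \<tau>) = \<tau>}"
      proof
        fix \<tau> assume "\<tau> \<in> {tensor_product 1 \<beta> \<eta> | \<beta> \<eta>. \<beta> \<in> Lambda 0 1 ?j \<and> \<eta> \<in> canonical ?j}"
        then obtain b' c where \<tau>': "\<tau> = tensor_product 1 (wedge [b']) (\<lambda>vs. c * Omega a p vs)" "b' \<in> covectors01 ?j"
          unfolding Lambda_0_1 canonical_std_J[OF a] by blast
        define b where "b v = c * b' v" for v
        have bJ: "b (?j v) = - \<i> * b v" for v using \<tau>'(2) by (simp add: b_def covectors01_def)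
        have \<tau>: "\<tau> = tensor_product 1 (wedge [b]) (Omega a p)"
          by (auto simp: \<tau>'(1) b_def tensor_product_def wedge_1 fun_eq_iff split: list.splits)
        have "C (alternate 2 \<tau>) vs = \<tau> vs" for vs
        proof (cases "length vs = 3")
          case True
          then obtain u v w where vs: "vs = [u, v, w]" by (rule length_3_cases)
          show ?thesis
            unfolding \<tau> alternate_wedge
            by (simp add: C_def vs wedge_3 bJ a tensor_product_def wedge_1 Omega_2 algebra_simps)
              (simp add: field_simps)
        next
          case False
          then show ?thesis
            unfolding \<tau> by (cases vs) (auto simp: C_def tensor_product_def wedge_1 Omega_wrong_length)
        qed
        then show "\<tau> \<in> {\<tau>. C (alternate 2 \<tau>) = \<tau>}" by (simp add: fun_eq_iff)
      qed
    qed
    then show ?thesis using that by auto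
  qed
  have "tensor_product 1 (wedge [\<beta>]) (Omega a p) \<in> T"
    unfolding T_def
  proof (intro tensor.span_base CollectI exI conjI)
    show "Omega a p \<in> canonical ?j" unfolding canonical_std_J[OF a] by (intro CollectI exI[of _ 1]) simp
    show "wedge [\<beta>] \<in> Lambda 0 1 ?j" using \<beta> unfolding Lambda_0_1 by blast
  qed simp
  note mem = this
  show ?thesis
    unfolding dbar_canonical_def DIM_coords_div_2 dbar T_def[symmetric] \<beta>_def[symmetric]
  proof (rule the_equality)
    show "tensor_product 1 (wedge [\<beta>]) (Omega a p) \<in> T \<and> alternate 2 (tensor_product 1 (wedge [\<beta>]) (Omega a p)) = \<zeta>"
      using mem alternate_wedge \<zeta>_def by blast
  next
    \<comment> \<open>Uniqueness: \<open>C\<close> is a left inverse of \<open>alternate 2\<close>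
      on \<open>T\<close>.\<close>
    fix \<tau> assume "\<tau> \<in> T \<and> alternate 2 \<tau> = \<zeta>"
    then show "\<tau> = tensor_product 1 (wedge [\<beta>]) (Omega a p)"
      using C[of \<tau>] C[OF mem] by (simp only: alternate_wedge \<zeta>_def)
  qed
qed

lemma tensor_1_Cons: "tensor_product 1 (wedge [\<beta>]) \<theta> (v # vs) = \<beta> v * \<theta> vs"
  and tensor_1_Nil: "tensor_product 1 (wedge [\<beta>]) \<theta> [] = 0"
  by (simp_all add: tensor_product_def wedge_1)

text \<open>The definite description is meaningful because every local factorisation gives the same
  value: the product rule for the coefficients adds up the terms in \<open>a / 4\<close>.\<close>

lemma dbar_power_eq:
  assumes a: "a \<noteq> 0" and U: "open U" "p \<in> U" and f: "smooth_on U f"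
    and s: "\<And>y. y \<in> U \<Longrightarrow> s y = (\<lambda>vs. f y * Omega_power a (Suc m) y vs)"
  shows "dbar_power (Suc m) (std_J a) s p = tensor_product 1
    (wedge [\<lambda>v. part01 (std_J a p) (frechet_derivative f (at p)) v
      + of_nat (Suc m) * of_real (a / 4) * f p * cnj (phi1 v)]) (Omega_power a (Suc m) p)"
  using U f s
proof (induction m arbitrary: U f s)
  case 0
  have "dbar_canonical (std_J a) s p = tensor_product 1
    (wedge [\<lambda>v. part01 (std_J a p) (frechet_derivative f (at p)) v + of_real (a / 4) * f p * cnj (phi1 v)]) (Omega a p)"
    using 0 by (intro dbar_canonical_eq[OF a smooth_on_imp_has_derivative[OF "0.prems"(3,2)] "0.prems"(1,2)])
      (simp only: Omega_power_1)
  then show ?case by (simp only: Omega_power_1 dbar_power.simps of_nat_Suc of_nat_0 add_0_right mult_1)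
next
  case (Suc m)
  let ?j = "std_J a p"
  let ?B = "\<lambda>m f v. part01 ?j (frechet_derivative f (at p)) v + of_nat m * of_real (a / 4) * f p * cnj (phi1 v)"
  note has_derivative = smooth_on_imp_has_derivative
  \<comment> \<open>Any admissible factorisation gives the claimed value; existence of one is shown
    afterwards.\<close>
  have leibniz: "leibniz 2 (dbar_canonical (std_J a) s\<^sub>1 p) (s\<^sub>2 p) (s\<^sub>1 p) (dbar_power (Suc m) (std_J a) s\<^sub>2 p)
      = tensor_product 1 (wedge [?B (Suc (Suc m)) f]) (Omega_power a (Suc (Suc m)) p)"
    if V: "open V" "p \<in> V" and s1: "s\<^sub>1 \<in> local_sections V (std_J a) canonical"
      and s2: "s\<^sub>2 \<in> local_sections V (std_J a) (canonical_power (Suc m))"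
      and prod: "\<forall>y\<in>V. s y = tensor_product 2 (s\<^sub>1 y) (s\<^sub>2 y)" for V s\<^sub>1 s\<^sub>2
  proof -
    \<comment> \<open>Evaluating at the test vectors and dividing by the value of the generator
      yields the coefficients of both factors, visibly as smooth functions.\<close>
    define f1 where "f1 y = s\<^sub>1 y (test_vectors 1) * (1 / (\<i> * of_real a))" for y
    define f2 where "f2 y = s\<^sub>2 y (test_vectors (Suc m)) * (1 / (\<i> * of_real a) ^ Suc m)" for y
    have s1_eq: "s\<^sub>1 y = (\<lambda>vs. f1 y * Omega a y vs)" if "y \<in> V" for y
    proof -
      have "s\<^sub>1 y \<in> canonical (std_J a y)" using s1 that by (simp add: local_sections_def)
      then obtain c where "s\<^sub>1 y = (\<lambda>vs. c * Omega a y vs)" by (auto simp: canonical_std_J[OF a])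
      moreover have "Omega a y (test_vectors 1) = \<i> * of_real a"
        using Omega_power_test_vectors[of a "Suc 0" y] by (simp only: Omega_power_1 One_nat_def power_Suc0_right)
      ultimately show ?thesis using a by (simp add: f1_def)
    qed
    have s2_eq: "s\<^sub>2 y = (\<lambda>vs. f2 y * Omega_power a (Suc m) y vs)" if "y \<in> V" for y
    proof -
      have "s\<^sub>2 y \<in> canonical_power (Suc m) (std_J a y)" using s2 that by (simp add: local_sections_def)
      then obtain c where "s\<^sub>2 y = (\<lambda>vs. c * Omega_power a (Suc m) y vs)"
        unfolding canonical_power_std_J[OF a] by blast
      then show ?thesis using a by (simp only: f2_def Omega_power_test_vectors) simp
    qed
    have f1: "smooth_on V f1" and f2: "smooth_on V f2"
      unfolding f1_def f2_def using s1 s2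
      by (intro smooth_on_mult smooth_on_const V; simp add: local_sections_def)+
    have f_eq: "f y = f1 y * f2 y" if "y \<in> U" "y \<in> V" for y
    proof -
      have "f y * Omega_power a (Suc (Suc m)) y vs = f1 y * f2 y * Omega_power a (Suc (Suc m)) y vs" for vs
      proof -
        have "s y vs = tensor_product 2 (s\<^sub>1 y) (s\<^sub>2 y) vs" using prod that by simp
        then show ?thesis
          unfolding Suc.prems(4)[OF that(1)] s1_eq[OF that(2)] s2_eq[OF that(2)]
          by (simp add: tensor_product_def)
      qed
      from this[of "test_vectors (Suc (Suc m))"] show ?thesis
        unfolding Omega_power_test_vectors using a by simp
    qed
    have d1: "dbar_canonical (std_J a) s\<^sub>1 p = tensor_product 1 (wedge [?B 1 f1]) (Omega a p)"
      using dbar_canonical_eq[OF a has_derivative[OF f1 V(2)] V s1_eq] by simp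
    have d2: "dbar_power (Suc m) (std_J a) s\<^sub>2 p = tensor_product 1 (wedge [?B (Suc m) f2]) (Omega_power a (Suc m) p)"
      by (rule Suc.IH[OF V f2 s2_eq])
    have "((\<lambda>y. f1 y * f2 y) has_derivative (\<lambda>v. f1 p * frechet_derivative f2 (at p) v + frechet_derivative f1 (at p) v * f2 p)) (at p)"
      by (rule has_derivative_mult[OF has_derivative[OF f1 V(2)] has_derivative[OF f2 V(2)]])
    then have "(f has_derivative (\<lambda>v. f1 p * frechet_derivative f2 (at p) v + frechet_derivative f1 (at p) v * f2 p)) (at p)"
      \<comment> \<open>The factorisation of \<open>f\<close> holds only where both domains meet,
        which is still a neighbourhood of \<open>p\<close>.\<close>
      by (rule has_derivative_transform_within_open[where s = "U \<inter> V"])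
        (use Suc.prems(1,2) V f_eq in \<open>simp_all add: open_Int\<close>)
    from frechet_derivative_at[OF this]
    have D: "frechet_derivative f (at p) = (\<lambda>v. f1 p * frechet_derivative f2 (at p) v + frechet_derivative f1 (at p) v * f2 p)"
      by simp
    \<comment> \<open>Leibniz rule for the covector factors; the multiplicities 1 and
      \<open>Suc m\<close> of the term in \<open>a / 4\<close> add up to
      \<open>Suc (Suc m)\<close>.\<close>
    have B: "?B (Suc (Suc m)) f v = f2 p * ?B 1 f1 v + f1 p * ?B (Suc m) f2 v" for v
      by (simp add: D f_eq[OF Suc.prems(2) V(2)] part01_def field_simps)
    have factor: "(b * x) * (g * y) + (h * x) * (c * y) = (g * b + h * c) * (x * y)"
      for b c g h x y :: complex
      by (simp add: algebra_simps)
    show ?thesis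
    proof
      fix vs
      show "leibniz 2 (dbar_canonical (std_J a) s\<^sub>1 p) (s\<^sub>2 p) (s\<^sub>1 p) (dbar_power (Suc m) (std_J a) s\<^sub>2 p) vs
        = tensor_product 1 (wedge [?B (Suc (Suc m)) f]) (Omega_power a (Suc (Suc m)) p) vs"
      proof (cases vs)
        case Nil
        then show ?thesis by (simp only: leibniz_def tensor_1_Nil list.case)
      next
        case (Cons v us)
        have "leibniz 2 (dbar_canonical (std_J a) s\<^sub>1 p) (s\<^sub>2 p) (s\<^sub>1 p) (dbar_power (Suc m) (std_J a) s\<^sub>2 p) vs
          = (?B 1 f1 v * Omega a p (take 2 us)) * (f2 p * Omega_power a (Suc m) p (drop 2 us))
            + (f1 p * Omega a p (take 2 us)) * (?B (Suc m) f2 v * Omega_power a (Suc m) p (drop 2 us))"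
          by (simp only: Cons leibniz_def list.case d1 d2 tensor_1_Cons s1_eq[OF V(2)] s2_eq[OF V(2)])
        also have "\<dots> = ?B (Suc (Suc m)) f v * (Omega a p (take 2 us) * Omega_power a (Suc m) p (drop 2 us))"
          unfolding B by (rule factor)
        also have "\<dots> = tensor_product 1 (wedge [?B (Suc (Suc m)) f]) (Omega_power a (Suc (Suc m)) p) vs"
          by (simp only: Cons tensor_1_Cons Omega_power.simps(2)[of a "Suc m"] tensor_product_def[of 2])
        finally show ?thesis .
      qed
    qed
  qed
  \<comment> \<open>An explicit factorisation: \<open>Omega\<close> itself, with the whole
    coefficient \<open>f\<close> moved to the second factor.\<close>
  let ?s1 = "Omega a" and ?s2 = "\<lambda>y vs. f y * Omega_power a (Suc m) y vs"
  have s1: "?s1 \<in> local_sections U (std_J a) canonical"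
    unfolding local_sections_def canonical_std_J[OF a]
    by (auto intro!: exI[of _ 1] smooth_on_Omega Suc.prems)
  have s2: "?s2 \<in> local_sections U (std_J a) (canonical_power (Suc m))"
    unfolding local_sections_def mem_Collect_eq
  proof (intro conjI ballI allI)
    show "?s2 y \<in> canonical_power (Suc m) (std_J a y)" for y
      unfolding canonical_power_std_J[OF a] by (rule CollectI, rule exI[of _ "f y"]) simp
    show "smooth_on U (\<lambda>y. ?s2 y vs)" for vs
      by (intro smooth_on_mult smooth_on_Omega_power Suc.prems)
  qed
  have prod: "\<forall>y\<in>U. s y = tensor_product 2 (?s1 y) (?s2 y)"
    using Suc.prems(4) by (simp add: tensor_product_def fun_eq_iff)
  show ?case
    unfolding dbar_power.simps DIM_coords_div_2
  proof (rule the_equality)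
    show "\<exists>V s\<^sub>1 s\<^sub>2. open V \<and> p \<in> V \<and> s\<^sub>1 \<in> local_sections V (std_J a) canonical \<and>
        s\<^sub>2 \<in> local_sections V (std_J a) (canonical_power (Suc m)) \<and>
        (\<forall>y\<in>V. s y = tensor_product 2 (s\<^sub>1 y) (s\<^sub>2 y)) \<and>
        tensor_product 1 (wedge [?B (Suc (Suc m)) f]) (Omega_power a (Suc (Suc m)) p) =
          leibniz 2 (dbar_canonical (std_J a) s\<^sub>1 p) (s\<^sub>2 p) (s\<^sub>1 p) (dbar_power (Suc m) (std_J a) s\<^sub>2 p)"
      using Suc.prems(1,2) s1 s2 prod leibniz[OF Suc.prems(1,2) s1 s2 prod, symmetric] by blast
  next
    fix \<tau>
    assume "\<exists>V s\<^sub>1 s\<^sub>2. open V \<and> p \<in> V \<and> s\<^sub>1 \<in> local_sections V (std_J a) canonical \<and>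
        s\<^sub>2 \<in> local_sections V (std_J a) (canonical_power (Suc m)) \<and>
        (\<forall>y\<in>V. s y = tensor_product 2 (s\<^sub>1 y) (s\<^sub>2 y)) \<and>
        \<tau> = leibniz 2 (dbar_canonical (std_J a) s\<^sub>1 p) (s\<^sub>2 p) (s\<^sub>1 p) (dbar_power (Suc m) (std_J a) s\<^sub>2 p)"
    then show "\<tau> = tensor_product 1 (wedge [?B (Suc (Suc m)) f]) (Omega_power a (Suc (Suc m)) p)"
      using leibniz by blast
  qed
qed

section \<open>Plurigenera\<close>

text \<open>Evaluation on these two frame vectors turns covector equations into scalar ones; the
  factor 1/2 is why \<open>m * a / 4\<close> later becomes \<open>m * a / 2\<close>.\<close>

lemma part01_frame:
  fixes D :: "coords \<Rightarrow> complex"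
  assumes "linear D"
  shows "part01 (std_J a (t, x, y, z)) D (1, 0, 0, 0) = (D (1, 0, 0, 0) + \<i> * D (0, 1, 0, 0)) / 2"
    and "part01 (std_J a (t, x, y, z)) D (0, 0, 1, x) = (D (0, 0, 1, x) + \<i> / of_real a * D (0, 0, 0, 1)) / 2"
proof -
  show "part01 (std_J a (t, x, y, z)) D (1, 0, 0, 0) = (D (1, 0, 0, 0) + \<i> * D (0, 1, 0, 0)) / 2"
    by (simp add: part01_def)
  have "D (std_J a (t, x, y, z) (0, 0, 1, x)) = D ((1 / a) *\<^sub>R (0, 0, 0, 1))" by simp
  also have "\<dots> = (1 / a) *\<^sub>R D (0, 0, 0, 1)" by (rule linear_scale[OF assms])
  finally show "part01 (std_J a (t, x, y, z)) D (0, 0, 1, x) = (D (0, 0, 1, x) + \<i> / of_real a * D (0, 0, 0, 1)) / 2"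
    by (simp add: part01_def scaleR_conv_of_real)
qed

lemma exp_imaginary_eq_1: "exp (\<i> * of_real c) = 1 \<longleftrightarrow> (\<exists>n::int. c = of_int (2 * n) * pi)"
  by (simp add: exp_eq_1)

section \<open>Plane waves and the generating pluricanonical sections\<close>

definition plane_wave :: "real \<Rightarrow> coords \<Rightarrow> complex" where
  "plane_wave c p = exp (\<i> * of_real (c * fst (snd p)))"

lemma smooth_on_plane_wave: "open S \<Longrightarrow> smooth_on S (plane_wave c)"
  unfolding plane_wave_def
  by (intro smooth_on_exp_linear bounded_linear_const_mult bounded_linear_compose[OF bounded_linear_of_real]
      bounded_linear_compose[OF bounded_linear_fst bounded_linear_snd])

lemma plane_wave_deck:
  assumes "exp (\<i> * of_real c) = 1"
  shows "plane_wave c (deck g p) = plane_wave c p"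
proof -
  obtain d k l n t x y z where gp: "g = (d, k, l, n)" "p = (t, x, y, z)" by (cases g, cases p) auto
  obtain N :: int where N: "c = of_int (2 * N) * pi" using assms exp_imaginary_eq_1 by blast
  have "exp (\<i> * of_real (c * of_int k)) = 1"
    unfolding exp_imaginary_eq_1 by (rule exI[of _ "N * k"]) (simp add: N)
  then show ?thesis by (simp add: gp plane_wave_def distrib_left exp_add)
qed

text \<open>The differential is \<open>\<i> * c * dx\<close> times the wave, and the (0,1)-part of
  \<open>\<i> * dx\<close> is \<open>- cnj phi1 / 2\<close>.\<close>

lemma part01_plane_wave:
  "part01 (std_J a p) (frechet_derivative (plane_wave c) (at p)) v = - (of_real (c / 2) * plane_wave c p * cnj (phi1 v))"
proof -
  have *: "((\<lambda>p. \<i> * of_real (c * fst (snd p))) has_derivative (\<lambda>h. \<i> * of_real (c * fst (snd h)))) (at p)"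
    by (auto intro!: derivative_eq_intros)
  have "(exp has_derivative (\<lambda>h. exp (\<i> * of_real (c * fst (snd p))) * h)) (at (\<i> * of_real (c * fst (snd p))))"
    using DERIV_exp by (auto simp: has_field_derivative_def)
  from frechet_derivative_at[OF has_derivative_compose[OF * this]]
  have D: "frechet_derivative (plane_wave c) (at p) = (\<lambda>h. plane_wave c p * (\<i> * of_real (c * fst (snd h))))"
    unfolding plane_wave_def by simp
  obtain t x y z vt vx vy vz where pv: "p = (t, x, y, z)" "v = (vt, vx, vy, vz)" by (cases p, cases v) auto
  have "\<i> * of_real (c * vx) + \<i> * (\<i> * of_real (c * vt)) = - (of_real c * cnj (Complex vt vx))"
    by (simp add: complex_eq_iff)
  then have "plane_wave c p * (\<i> * of_real (c * vx) + \<i> * (\<i> * of_real (c * vt))) / 2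
      = - (of_real (c / 2) * plane_wave c p * cnj (Complex vt vx))"
    by (simp only:) simp
  then show ?thesis
    unfolding part01_def D by (simp add: pv algebra_simps)
qed

text \<open>The frequency \<open>m * a / 2\<close> is the one for which
  \<open>part01_plane_wave\<close> cancels the zeroth-order term of
  \<open>dbar_power_eq\<close>.\<close>

definition twisted_power :: "real \<Rightarrow> nat \<Rightarrow> coords \<Rightarrow> coords tensor" where
  "twisted_power a m p = (\<lambda>vs. plane_wave (real m * a / 2) p * Omega_power a m p vs)"

lemma plurigenus_section_unique:
  assumes a: "a \<noteq> 0" and m: "m = Suc n"
    and s: "s \<in> sections KT_atlas (KT_J a) (canonical_power m)"
    and hol: "\<And>c p. c \<in> KT_atlas \<Longrightarrow> p \<in> chart_image c \<Longrightarrow> dbar_power m (KT_J a c) (s c) p = (\<lambda>_. 0)"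
  obtains C where "s = (\<lambda>c p vs. C * section_of (twisted_power a m) c p vs)"
    "C = 0 \<or> exp (\<i> * of_real (real m * a / 2)) = 1"
proof -
  obtain G where G: "s = section_of G" "\<And>p. G p \<in> canonical_power m (std_J a p)"
    "\<And>vs. smooth_on UNIV (\<lambda>p. G p vs)" "\<And>g p vs. G (deck g p) (map (deck_linear g) vs) = G p vs"
    using s unfolding sections_KT by blast
  define f where "f p = G p (test_vectors m) * (1 / (\<i> * of_real a) ^ m)" for p
  have G_eq: "G p = (\<lambda>vs. f p * Omega_power a m p vs)" for p
  proof -
    obtain c where "G p = (\<lambda>vs. c * Omega_power a m p vs)"
      using G(2)[of p] unfolding canonical_power_std_J[OF a] by blast
    then show ?thesis using a by (simp only: f_def Omega_power_test_vectors) simp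
  qed
  have f: "smooth_on UNIV f" unfolding f_def by (intro smooth_on_mult smooth_on_const G(3)) auto
  define D where "D p = frechet_derivative f (at p)" for p
  have D: "(f has_derivative D p) (at p)" for p
    unfolding D_def by (rule smooth_on_imp_has_derivative[OF f UNIV_I])
  have inv: "f (deck g p) = f p" for g p
    using G(4)[of g p "test_vectors m"] a unfolding G_eq Omega_power_deck Omega_power_test_vectors by simp
  have CR: "part01 (std_J a p) (D p) v + of_nat m * of_real (a / 4) * f p * cnj (phi1 v) = 0" for p v
  proof -
    obtain c where c: "c \<in> KT_atlas" "p \<in> chart_image c" using exists_chart by blast
    have "open (chart_image c)" using c(1) unfolding KT_atlas_iff by (auto simp: chart_image_KT_chart)
    moreover have "s c y = (\<lambda>vs. f y * Omega_power a (Suc n) y vs)" if "y \<in> chart_image c" for y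
      using that c by (simp add: G(1) section_of_def G_eq m)
    ultimately have "dbar_power m (std_J a) (s c) p = tensor_product 1
        (wedge [\<lambda>v. part01 (std_J a p) (D p) v + of_nat m * of_real (a / 4) * f p * cnj (phi1 v)]) (Omega_power a m p)"
      unfolding m D_def by (intro dbar_power_eq[OF a _ c(2) smooth_on_subset[OF f subset_UNIV]])
    note dbar = this
    \<comment> \<open>Filling all slots but the first with test vectors leaves the covector equation
      times the nonzero number \<open>(\<i> * a) ^ m\<close>.\<close>
    have "dbar_power m (std_J a) (s c) p (v # test_vectors m) = 0"
      using hol[OF c] by (simp add: KT_J_std)
    then have "(part01 (std_J a p) (D p) v + of_nat m * of_real (a / 4) * f p * cnj (phi1 v)) * (\<i> * of_real a) ^ m = 0"
      unfolding dbar tensor_1_Cons Omega_power_test_vectors .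
    then show ?thesis using a by simp
  qed
  have CR1: "D p (1, 0, 0, 0) + \<i> * D p (0, 1, 0, 0) + of_real (real m * a / 2) * f p = 0" for p
  proof -
    obtain t x y z where p: "p = (t, x, y, z)" by (cases p) auto
    show ?thesis
      using CR[of p "(1, 0, 0, 0)"] unfolding p part01_frame[OF has_derivative_linear[OF D]]
      by (simp add: field_simps complex_of_real_def[symmetric] one_complex.code[symmetric])
  qed
  have CR2: "D (t, x, y, z) (0, 0, 1, x) + \<i> / of_real a * D (t, x, y, z) (0, 0, 0, 1) = 0" for t x y z
    using CR[of "(t, x, y, z)" "(0, 0, 1, x)"] unfolding part01_frame[OF has_derivative_linear[OF D]]
    by (simp add: zero_complex.code[symmetric])
  obtain C where C: "\<And>p. f p = C * exp (\<i> * of_real (real m * a / 2 * fst (snd p)))"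
    "C = 0 \<or> exp (\<i> * of_real (real m * a / 2)) = 1"
    using invariant_Cauchy_Riemann[where f = f and D = D, OF a D inv CR1 CR2] by blast
  show ?thesis
  proof (rule that[of C])
    have "G p vs = C * twisted_power a m p vs" for p vs
      using fun_cong[OF G_eq[of p], of vs] unfolding C(1)[of p] twisted_power_def plane_wave_def
      by (simp only: mult.assoc)
    then show "s = (\<lambda>c p vs. C * section_of (twisted_power a m) c p vs)"
      unfolding G(1) section_of_def by (intro ext) simp
  qed (fact C(2))
qed

lemma twisted_power_section:
  assumes a: "a \<noteq> 0" and m: "m = Suc n" and per: "exp (\<i> * of_real (real m * a / 2)) = 1"
  shows "section_of (twisted_power a m) \<in> sections KT_atlas (KT_J a) (canonical_power m)"
    and "c \<in> KT_atlas \<Longrightarrow> p \<in> chart_image c \<Longrightarrow>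
      dbar_power m (KT_J a c) (section_of (twisted_power a m) c) p = (\<lambda>_. 0)"
proof -
  show "section_of (twisted_power a m) \<in> sections KT_atlas (KT_J a) (canonical_power m)"
    unfolding sections_KT
  proof (intro exI conjI allI)
    show "twisted_power a m p \<in> canonical_power m (std_J a p)" for p
      unfolding canonical_power_std_J[OF a] twisted_power_def by blast
    show "smooth_on UNIV (\<lambda>p. twisted_power a m p vs)" for vs
      unfolding twisted_power_def by (intro smooth_on_mult smooth_on_plane_wave smooth_on_Omega_power) auto
    show "twisted_power a m (deck g p) (map (deck_linear g) vs) = twisted_power a m p vs" for g p vs
      by (simp only: twisted_power_def Omega_power_deck plane_wave_deck[OF per])
  qed simp
  assume c: "c \<in> KT_atlas" "p \<in> chart_image c"
  have "open (chart_image c)" using c(1) unfolding KT_atlas_iff by (auto simp: chart_image_KT_chart)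
  moreover have "section_of (twisted_power a m) c y = (\<lambda>vs. plane_wave (real m * a / 2) y * Omega_power a m y vs)"
    if "y \<in> chart_image c" for y
    using that c by (simp add: section_of_def twisted_power_def)
  ultimately have "dbar_power m (std_J a) (section_of (twisted_power a m) c) p = tensor_product 1
      (wedge [\<lambda>v. part01 (std_J a p) (frechet_derivative (plane_wave (real m * a / 2)) (at p)) v
        + of_nat m * of_real (a / 4) * plane_wave (real m * a / 2) p * cnj (phi1 v)]) (Omega_power a m p)"
    unfolding m using c(2) by (intro dbar_power_eq[OF a]) (auto intro: smooth_on_plane_wave)
  also have "\<dots> = tensor_product 1 (wedge [\<lambda>v. 0]) (Omega_power a m p)"
    by (simp add: part01_plane_wave)
  also have "\<dots> = (\<lambda>_. 0)"
    by (auto simp: tensor_product_def wedge_1 fun_eq_iff split: list.splits)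
  finally show "dbar_power m (KT_J a c) (section_of (twisted_power a m) c) p = (\<lambda>_. 0)"
    by (simp add: KT_J_std)
qed

text \<open>All solutions are multiples of one field, and periodicity of its plane wave decides
  whether a nonzero multiple descends to the quotient.\<close>

lemma plurigenus_KT:
  assumes a: "a \<noteq> 0" and m: "m = Suc n"
  shows "plurigenus KT_atlas (KT_J a) m = (if exp (\<i> * of_real (real m * a / 2)) = 1 then 1 else 0)"
proof -
  define V where "V = {s \<in> sections KT_atlas (KT_J a) (canonical_power m).
     \<forall>c\<in>KT_atlas. \<forall>p\<in>chart_image c. dbar_power m (KT_J a c) (s c) p = (\<lambda>_. 0)}"
  let ?s0 = "section_of (twisted_power a m)"
  have "cdim V = (if exp (\<i> * of_real (real m * a / 2)) = 1 then 1 else 0)"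
  proof (cases "exp (\<i> * of_real (real m * a / 2)) = 1")
    case True
    have "cdim V = 1"
    proof (rule cdim_eq_1)
      show "?s0 \<in> V" using twisted_power_section[OF a m True] by (simp add: V_def)
      obtain c where "c \<in> KT_atlas" "0 \<in> chart_image c" using exists_chart by blast
      then have "?s0 c 0 (test_vectors m) \<noteq> 0"
        using a by (simp add: section_of_def twisted_power_def Omega_power_test_vectors plane_wave_def)
      then show "?s0 \<noteq> 0" by auto
      show "V \<subseteq> {\<lambda>c x vs. C * ?s0 c x vs | C. True}"
        using plurigenus_section_unique[OF a m] unfolding V_def by blast
    qed
    then show ?thesis using True by simp
  next
    case False
    have "s = 0" if "s \<in> V" for s
    proof -
      obtain C where "s = (\<lambda>c p vs. C * ?s0 c p vs)" "C = 0 \<or> exp (\<i> * of_real (real m * a / 2)) = 1"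
        using plurigenus_section_unique[OF a m] \<open>s \<in> V\<close> unfolding V_def by blast
      then show ?thesis using False by (simp add: zero_fun_def)
    qed
    then have "V \<subseteq> {0}" by blast
    then show ?thesis using False by (simp add: cdim_eq_0)
  qed
  then show ?thesis by (simp only: plurigenus_def V_def)
qed

text \<open>For given \<open>m\<close>, periodicity means that \<open>m * a\<close> is an integer
  multiple of \<open>4 * pi\<close>.\<close>

lemma periodic_iff_rational:
  assumes "a \<noteq> 0"
  shows "(\<exists>n. exp (\<i> * of_real (real (Suc n) * a / 2)) = 1) \<longleftrightarrow> (\<exists>q\<in>\<rat>. a = pi * q)"
proof
  assume "\<exists>n. exp (\<i> * of_real (real (Suc n) * a / 2)) = 1"
  then obtain n and N :: int where "real (Suc n) * a / 2 = of_int (2 * N) * pi"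
    unfolding exp_imaginary_eq_1 by blast
  then have "a = pi * (of_int (4 * N) / of_nat (Suc n))" by (simp add: field_simps)
  moreover have "real_of_int (4 * N) / of_nat (Suc n) \<in> \<rat>"
    by (intro Rats_divide Rats_of_int Rats_of_nat)
  ultimately show "\<exists>q\<in>\<rat>. a = pi * q" by blast
next
  assume "\<exists>q\<in>\<rat>. a = pi * q"
  then obtain q where "q \<in> \<rat>" "a = pi * q" by blast
  then obtain i :: int and k :: nat where k: "k \<noteq> 0" "a = pi * (of_int i / of_nat k)"
    unfolding Rats_eq_int_div_nat by blast
  \<comment> \<open>The exponent \<open>Suc n\<close> is \<open>4 * k\<close>: the denominator
    \<open>k\<close> is cleared and the factor 4 turns half of \<open>Suc n * a\<close> into a
    multiple of \<open>2 * pi\<close>.\<close>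
  define n where "n = 4 * k - 1"
  have n: "real (Suc n) = 4 * real k" using k(1) by (simp add: n_def)
  have "real (Suc n) * a / 2 = of_int (2 * i) * pi"
    unfolding n using k by (simp add: field_simps)
  then show "\<exists>n. exp (\<i> * of_real (real (Suc n) * a / 2)) = 1"
    unfolding exp_imaginary_eq_1 by blast
qed

text \<open>Positive plurigenera are 0 or 1, contributing \<open>-\<infinity>\<close> or 0 to the
  upper limit; one value 1 recurs at all multiples of its index.\<close>

lemma kodaira_dim_KT:
  assumes a: "a \<noteq> 0"
  shows "kodaira_dim KT_atlas (KT_J a) = (if \<exists>q\<in>\<rat>. a = pi * q then 0 else -\<infinity>)"
proof (cases "\<exists>n. exp (\<i> * of_real (real (Suc n) * a / 2)) = 1")
  case False
  have "plurigenus KT_atlas (KT_J a) m = 0" if "m \<ge> 1" for m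
  proof -
    obtain n where m: "m = Suc n" using \<open>m \<ge> 1\<close> by (cases m) auto
    then show ?thesis using plurigenus_KT[OF a m] False by simp
  qed
  then show ?thesis
    using False unfolding kodaira_dim_def periodic_iff_rational[OF a] by simp
next
  case True
  then obtain n where n: "exp (\<i> * of_real (real (Suc n) * a / 2)) = 1" by blast
  define u where "u m = log_enat (plurigenus KT_atlas (KT_J a) m) / ereal (ln (real m))" for m
  \<comment> \<open>The bound \<open>m \<ge> 2\<close> makes the denominator
    \<open>ln (real m)\<close> positive.\<close>
  have u_cases: "u m = (if exp (\<i> * of_real (real m * a / 2)) = 1 then 0 else -\<infinity>)" if "m \<ge> 2" for m
  proof -
    obtain n' where m: "m = Suc n'" using \<open>m \<ge> 2\<close> by (cases m) auto
    have "ln (real m) > 0" using \<open>m \<ge> 2\<close> by simp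
    then show ?thesis
      unfolding u_def plurigenus_KT[OF a m] by (simp add: log_enat_def one_enat_def zero_enat_def)
  qed
  have "limsup u \<le> 0"
    by (rule Limsup_bounded, rule eventually_sequentiallyI[of 2]) (simp add: u_cases)
  moreover have "0 \<le> limsup u"
    unfolding limsup_INF_SUP
  proof (rule INF_greatest)
    fix k :: nat
    \<comment> \<open>A multiple of the period index beyond \<open>k\<close>; the summand 2 keeps
      \<open>m\<close> in the range of \<open>u_cases\<close>.\<close>
    define m where "m = (k + 2) * Suc n"
    obtain N :: int where N: "real (Suc n) * a / 2 = of_int (2 * N) * pi"
      using n exp_imaginary_eq_1 by blast
    have "real m * a / 2 = real (k + 2) * (real (Suc n) * a / 2)" by (simp add: m_def algebra_simps)
    also have "\<dots> = of_int (2 * (int (k + 2) * N)) * pi" unfolding N by simp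
    finally have "exp (\<i> * of_real (real m * a / 2)) = 1" unfolding exp_imaginary_eq_1 by blast
    moreover have "k + 2 \<le> m" unfolding m_def by simp
    ultimately have "u m = 0" "m \<in> {k..}" by (simp_all add: u_cases)
    then show "0 \<le> Sup (u ` {k..})" by (metis SUP_upper)
  qed
  ultimately have "limsup u = 0" by simp
  moreover have "plurigenus KT_atlas (KT_J a) (Suc n) \<noteq> 0" using plurigenus_KT[OF a refl, of n] n by simp
  then have "\<not> (\<forall>m\<ge>1. plurigenus KT_atlas (KT_J a) m = 0)" by (metis One_nat_def Suc_le_mono le0)
  ultimately show ?thesis
    using True unfolding kodaira_dim_def periodic_iff_rational[OF a] u_def by simp
qed

section \<open>Holomorphic one-forms\<close>

lemma wedge_2_add: "wedge [\<lambda>v. \<alpha> v + c * \<beta> v, \<gamma>] [v, w] = wedge [\<alpha>, \<gamma>] [v, w] + c * wedge [\<beta>, \<gamma>] [v, w]"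
  by (simp add: wedge_2 algebra_simps)

lemma Lambda_add: "\<eta> \<in> Lambda p q j \<Longrightarrow> \<theta> \<in> Lambda p q j \<Longrightarrow> \<eta> + \<theta> \<in> Lambda p q j"
  unfolding Lambda_def by (rule tensor.span_add)

lemma Lambda_scale: "\<eta> \<in> Lambda p q j \<Longrightarrow> (\<lambda>vs. c * \<eta> vs) \<in> Lambda p q j"
  unfolding Lambda_def by (rule tensor.span_scale)

text \<open>The structure equation for \<open>phi2\<close> sorted by type: (1,1) in the first
  bracket, (0,2) and (2,0) in the second.\<close>

lemma dphi2_alternating:
  "dphi2 a v w - dphi2 a w v =
    of_real (a / 4) * (wedge [\<lambda>v. cnj (phi1 v), phi2 a p] [v, w] + wedge [\<lambda>v. cnj (phi2 a p v), phi1] [v, w])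
    + of_real (a / 4) * (wedge [\<lambda>v. cnj (phi1 v), \<lambda>v. cnj (phi2 a p v)] [v, w] - wedge [phi1, phi2 a p] [v, w])"
  unfolding wedge_2 dphi2_eq[of a _ _ p] by (simp add: algebra_simps)

text \<open>The Leibniz rule; \<open>phi1\<close> has constant coefficients and contributes no
  derivative of its own.\<close>

lemma ext_deriv_form:
  assumes f: "(f has_derivative Df) (at p)" and g: "(g has_derivative Dg) (at p)"
    and U: "open U" "p \<in> U" and s: "\<And>y. y \<in> U \<Longrightarrow> s y = wedge [\<lambda>v. f y * phi1 v + g y * phi2 a y v]"
  shows "ext_deriv 1 s p [v, w] =
    wedge [Df, phi1] [v, w] + wedge [Dg, phi2 a p] [v, w] + g p * (dphi2 a v w - dphi2 a w v)"
proof -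
  have "frechet_derivative (\<lambda>y. s y [w]) (at p) v = Df v * phi1 w + (g p * dphi2 a v w + Dg v * phi2 a p w)" for v w
  proof -
    have "((\<lambda>y. f y * phi1 w + g y * phi2 a y w) has_derivative
        (\<lambda>v. Df v * phi1 w + (g p * dphi2 a v w + Dg v * phi2 a p w))) (at p)"
      by (intro has_derivative_add has_derivative_mult_left has_derivative_mult f g has_derivative_phi2)
    then have "((\<lambda>y. s y [w]) has_derivative (\<lambda>v. Df v * phi1 w + (g p * dphi2 a v w + Dg v * phi2 a p w))) (at p)"
      by (rule has_derivative_transform_within_open[OF _ U]) (simp add: s wedge_1)
    from fun_cong[OF frechet_derivative_at[OF this], of v] show ?thesis by (rule sym)
  qed
  note frechet = this
  show ?thesis
    by (simp add: ext_deriv_def omit_def wedge_2 frechet algebra_simps)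
qed

text \<open>The two (1,1)-terms of the structure equation for \<open>phi2\<close> are absorbed into
  the (0,1)-covectors standing next to \<open>phi1\<close> and \<open>phi2\<close>.\<close>

lemma dbar_form:
  assumes a: "a \<noteq> 0" and f: "(f has_derivative Df) (at p)" and g: "(g has_derivative Dg) (at p)"
    and U: "open U" "p \<in> U" and s: "\<And>y. y \<in> U \<Longrightarrow> s y = wedge [\<lambda>v. f y * phi1 v + g y * phi2 a y v]"
  shows "dbar 1 0 (std_J a) s p =
    wedge [\<lambda>v. part01 (std_J a p) Df v + of_real (a / 4) * g p * cnj (phi2 a p v), phi1]
    + wedge [\<lambda>v. part01 (std_J a p) Dg v + of_real (a / 4) * g p * cnj (phi1 v), phi2 a p]"
proof -
  let ?j = "std_J a p" and ?c1 = "\<lambda>v. cnj (phi1 v)" and ?c2 = "\<lambda>v. cnj (phi2 a p v)"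
  define r where "r = of_real (a / 4) * g p"
  define A B where "A = (\<lambda>v. part01 ?j Df v + r * ?c2 v)" and "B = (\<lambda>v. part01 ?j Dg v + r * ?c1 v)"
  define \<eta> where "\<eta> = ext_deriv 1 s p"
  define \<zeta> where "\<zeta> = wedge [A, phi1] + wedge [B, phi2 a p]"
  note lin = has_derivative_linear[OF f] has_derivative_linear[OF g]
  note phi = phi_mem_covectors[OF a, of p]
  have p10: "part10 ?j Df \<in> covectors10 ?j" "part10 ?j Dg \<in> covectors10 ?j"
    and p01: "part01 ?j Df \<in> covectors01 ?j" "part01 ?j Dg \<in> covectors01 ?j"
    by (simp_all add: part10_mem part01_mem lin linear_std_J std_J_square[OF a])
  have AB: "A \<in> covectors01 ?j" "B \<in> covectors01 ?j"
    unfolding A_def B_def using p01 phi by (auto intro!: covectors01_add)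
  \<comment> \<open>What remains has types (2,0), (2,0), (0,2) and (2,0).\<close>
  have diff: "\<eta> - \<zeta> = wedge ([part10 ?j Df, phi1] @ []) + (wedge ([part10 ?j Dg, phi2 a p] @ [])
      + ((\<lambda>vs. r * wedge ([] @ [?c1, ?c2]) vs) + (\<lambda>vs. (- r) * wedge ([phi1, phi2 a p] @ []) vs)))" (is "_ = ?rest")
  proof
    fix vs :: "coords list"
    show "(\<eta> - \<zeta>) vs = ?rest vs"
    proof (cases "length vs = 2")
      case True
      then obtain v w where vs: "vs = [v, w]" by (rule length_2_cases)
      have split: "wedge [Df, phi1] vs = wedge [part10 ?j Df, phi1] vs + wedge [part01 ?j Df, phi1] vs"
        "wedge [Dg, phi2 a p] vs = wedge [part10 ?j Dg, phi2 a p] vs + wedge [part01 ?j Dg, phi2 a p] vs"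
        using wedge_2_add[of "part10 ?j Df" 1 "part01 ?j Df" phi1 v w]
          wedge_2_add[of "part10 ?j Dg" 1 "part01 ?j Dg" "phi2 a p" v w]
        by (simp_all add: vs part10_add_part01)
      have "\<zeta> vs = wedge [part01 ?j Df, phi1] vs + r * wedge [?c2, phi1] vs
          + (wedge [part01 ?j Dg, phi2 a p] vs + r * wedge [?c1, phi2 a p] vs)"
        unfolding \<zeta>_def A_def B_def vs plus_fun_apply wedge_2_add ..
      moreover have "\<eta> vs = wedge [Df, phi1] vs + wedge [Dg, phi2 a p] vs
          + r * (wedge [?c1, phi2 a p] vs + wedge [?c2, phi1] vs) + r * (wedge [?c1, ?c2] vs - wedge [phi1, phi2 a p] vs)"
      proof -
        have "\<eta> vs = wedge [Df, phi1] [v, w] + wedge [Dg, phi2 a p] [v, w] + g p * (dphi2 a v w - dphi2 a w v)"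
          unfolding vs \<eta>_def using f g U s by (rule ext_deriv_form)
        then show ?thesis
          unfolding dphi2_alternating[of a v w p] r_def vs by (simp add: algebra_simps)
      qed
      ultimately show ?thesis unfolding split by (simp add: algebra_simps)
    next
      case False
      then show ?thesis by (simp add: \<eta>_def \<zeta>_def ext_deriv_def wedge_wrong_length)
    qed
  qed
  have "type_projection 1 (Suc 0) ?j \<eta> = \<zeta>"
  proof (rule type_projection_eqI)
    have "wedge ([phi1] @ [A]) \<in> Lambda 1 (Suc 0) ?j" "wedge ([phi2 a p] @ [B]) \<in> Lambda 1 (Suc 0) ?j"
      using phi AB by (auto intro!: wedge_mem_Lambda simp del: append.simps)
    \<comment> \<open>\<open>Lambda\<close> lists (1,0)-covectors first, so the factors are
      interchanged at the cost of a sign.\<close>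
    then have "(\<lambda>vs. (- 1) * wedge ([phi1] @ [A]) vs) + (\<lambda>vs. (- 1) * wedge ([phi2 a p] @ [B]) vs) \<in> Lambda 1 (Suc 0) ?j"
      by (intro Lambda_add Lambda_scale)
    moreover have "(\<lambda>vs. (- 1) * wedge ([\<alpha>] @ [\<beta>]) vs) = wedge [\<beta>, \<alpha>]" for \<alpha> \<beta> :: "coords \<Rightarrow> complex"
      by (rule wedge_2_ext) (simp_all add: wedge_2 wedge_wrong_length)
    ultimately show "\<zeta> \<in> Lambda 1 (Suc 0) ?j" unfolding \<zeta>_def by simp
    have "wedge ([part10 ?j Df, phi1] @ []) \<in> Lambda 2 0 ?j" "wedge ([part10 ?j Dg, phi2 a p] @ []) \<in> Lambda 2 0 ?j"
      "wedge ([phi1, phi2 a p] @ []) \<in> Lambda 2 0 ?j" "wedge ([] @ [?c1, ?c2]) \<in> Lambda 0 2 ?j"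
      by (rule wedge_mem_Lambda; use phi p10 in simp)+
    then show "\<eta> - \<zeta> \<in> tensor.span (\<Union>{Lambda p' q' ?j | p' q'. p' + q' = 1 + Suc 0 \<and> (p', q') \<noteq> (1, Suc 0)})"
      unfolding diff
      by (intro tensor.span_add tensor.span_scale tensor.span_base)
        (erule Lambda_mem_other_types; simp)+
  qed
  then show ?thesis
    by (simp only: dbar_def \<eta>_def \<zeta>_def A_def B_def r_def add_0_right)
qed

lemma dbar_form_eq_0D:
  assumes a: "a \<noteq> 0" and A: "A \<in> covectors01 (std_J a p)" and B: "B \<in> covectors01 (std_J a p)"
    and zero: "wedge [A, phi1] + wedge [B, phi2 a p] = (\<lambda>_. 0)"
  shows "A v = 0" and "B v = 0"
proof -
  have AJ: "A (std_J a p v) = - \<i> * A v" and BJ: "B (std_J a p v) = - \<i> * B v" for v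
    using A B by (auto simp: covectors01_def)
  have "A v * phi1 w + B v * phi2 a p w = 0" for w
  proof -
    let ?z = "wedge [A, phi1] + wedge [B, phi2 a p]"
    \<comment> \<open>Replacing \<open>v\<close> by twice its (0,1)-part doubles \<open>A\<close>
      and \<open>B\<close> and annihilates \<open>phi1\<close> and \<open>phi2\<close> in that
      slot.\<close>
    have "?z [v, w] + \<i> * ?z [std_J a p v, w] = 2 * (A v * phi1 w + B v * phi2 a p w)"
      by (simp add: wedge_2 AJ BJ a algebra_simps)
    then have "2 * (A v * phi1 w + B v * phi2 a p w) = 0" unfolding zero by simp
    then show ?thesis by (simp only: mult_eq_0_iff) simp
  qed
  note eq = this
  show "A v = 0" using eq[of "(1, 0, 0, 0)"] by (cases p) (simp add: complex_eq_iff)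
  show "B v = 0" using eq[of "(0, 0, 0, 1)"] a by (cases p) (simp add: complex_eq_iff)
qed

text \<open>The coefficient \<open>g\<close> solves the same system as a canonical section and
  enters the fibre equation of \<open>f\<close> as an inhomogeneity; boundedness of \<open>f\<close>
  eliminates it, and \<open>f\<close> is then constant.\<close>

lemma hodge_section_unique:
  assumes a: "a \<noteq> 0" and s: "s \<in> sections KT_atlas (KT_J a) (Lambda 1 0)"
    and hol: "\<And>c p. c \<in> KT_atlas \<Longrightarrow> p \<in> chart_image c \<Longrightarrow> dbar 1 0 (KT_J a c) (s c) p = (\<lambda>_. 0)"
  obtains C where "s = (\<lambda>c p vs. C * section_of (\<lambda>p. wedge [phi1]) c p vs)"
proof -
  obtain G where G: "s = section_of G" "\<And>p. G p \<in> Lambda 1 0 (std_J a p)"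
    "\<And>vs. smooth_on UNIV (\<lambda>p. G p vs)" "\<And>g p vs. G (deck g p) (map (deck_linear g) vs) = G p vs"
    using s unfolding sections_KT by blast
  define f where "f p = G p [(1, 0, 0, 0)]" for p
  define g where "g p = G p [(0, 0, 0, 1)] * (1 / (\<i> * of_real a))" for p
  have G_eq: "G p = wedge [\<lambda>v. f p * phi1 v + g p * phi2 a p v]" for p
  proof -
    obtain c d where cd: "G p = wedge [\<lambda>v. c * phi1 v + d * phi2 a p v]"
      using G(2)[of p] unfolding Lambda_1_0 covectors10_std_J[OF a] by blast
    have "phi1 (1, 0, 0, 0) = 1" "phi2 a p (1, 0, 0, 0) = 0" "phi1 (0, 0, 0, 1) = 0" "phi2 a p (0, 0, 0, 1) = \<i> * of_real a"
      by (cases p; simp add: complex_eq_iff)+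
    then have "f p = c" "g p = d" using a by (simp_all add: f_def g_def cd wedge_1)
    then show ?thesis by (simp add: cd)
  qed
  have f: "smooth_on UNIV f" unfolding f_def by (rule G(3))
  have g: "smooth_on UNIV g" unfolding g_def by (intro smooth_on_mult smooth_on_const G(3)) auto
  define Df Dg where "Df p = frechet_derivative f (at p)" and "Dg p = frechet_derivative g (at p)" for p
  have Df: "(f has_derivative Df p) (at p)" and Dg: "(g has_derivative Dg p) (at p)" for p
    unfolding Df_def Dg_def using smooth_on_imp_has_derivative[OF f UNIV_I] smooth_on_imp_has_derivative[OF g UNIV_I] by auto
  have fixed: "deck_linear h (1, 0, 0, 0) = (1, 0, 0, 0)" "deck_linear h (0, 0, 0, 1) = (0, 0, 0, 1)" for h
    by (cases h; simp)+
  have inv_f: "f (deck h p) = f p" and inv_g: "g (deck h p) = g p" for h p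
    using G(4)[of h p "[(1, 0, 0, 0)]"] G(4)[of h p "[(0, 0, 0, 1)]"] by (simp_all add: f_def g_def fixed)
  let ?A = "\<lambda>p v. part01 (std_J a p) (Df p) v + of_real (a / 4) * g p * cnj (phi2 a p v)"
  let ?B = "\<lambda>p v. part01 (std_J a p) (Dg p) v + of_real (a / 4) * g p * cnj (phi1 v)"
  have AB: "?A p v = 0" "?B p v = 0" for p v
  proof -
    obtain c where c: "c \<in> KT_atlas" "p \<in> chart_image c" using exists_chart by blast
    have "open (chart_image c)" using c(1) unfolding KT_atlas_iff by (auto simp: chart_image_KT_chart)
    moreover have "s c y = wedge [\<lambda>v. f y * phi1 v + g y * phi2 a y v]" if "y \<in> chart_image c" for y
      using that c by (simp add: G(1) section_of_def G_eq)
    ultimately have "wedge [?A p, phi1] + wedge [?B p, phi2 a p] = (\<lambda>_. 0)"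
      using dbar_form[OF a Df Dg, of "chart_image c" p "s c"] c(2) hol[OF c] by (simp add: KT_J_std)
    note dbar = this
    note phi = phi_mem_covectors[OF a, of p]
    have p01: "part01 (std_J a p) (Df p) \<in> covectors01 (std_J a p)"
        "part01 (std_J a p) (Dg p) \<in> covectors01 (std_J a p)"
      by (simp_all add: part01_mem linear_std_J std_J_square[OF a] has_derivative_linear[OF Df] has_derivative_linear[OF Dg])
    note mem = covectors01_add[OF p01(1) phi(4), of "of_real (a / 4) * g p"]
      covectors01_add[OF p01(2) phi(3), of "of_real (a / 4) * g p"]
    show "?A p v = 0" "?B p v = 0" using dbar_form_eq_0D[OF a mem dbar] by blast+
  qed
  have frame: "phi1 (1, 0, 0, 0) = 1" "phi2 a p (1, 0, 0, 0) = 0" "phi1 (0, 0, 1, x) = 0" "phi2 a (t, x, y, z) (0, 0, 1, x) = 1"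
    for p t x y z by (cases p; simp add: complex_eq_iff)+
  note part01_f = part01_frame[OF has_derivative_linear[OF Df]]
    and part01_g = part01_frame[OF has_derivative_linear[OF Dg]]
  have g1: "Dg p (1, 0, 0, 0) + \<i> * Dg p (0, 1, 0, 0) + of_real (a / 2) * g p = 0" for p
  proof -
    obtain t x y z where p: "p = (t, x, y, z)" by (cases p) auto
    show ?thesis using AB(2)[of p "(1, 0, 0, 0)"] unfolding p part01_g frame by (simp add: field_simps)
  qed
  have g2: "Dg (t, x, y, z) (0, 0, 1, x) + \<i> / of_real a * Dg (t, x, y, z) (0, 0, 0, 1) = 0" for t x y z
    using AB(2)[of "(t, x, y, z)" "(0, 0, 1, x)"] unfolding part01_g frame by simp
  have f1: "Df p (1, 0, 0, 0) + \<i> * Df p (0, 1, 0, 0) + of_real 0 * f p = 0" for p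
  proof -
    obtain t x y z where p: "p = (t, x, y, z)" by (cases p) auto
    show ?thesis using AB(1)[of p "(1, 0, 0, 0)"] unfolding p part01_f frame by simp
  qed
  have f2: "Df (t, x, y, z) (0, 0, 1, x) + \<i> / of_real a * Df (t, x, y, z) (0, 0, 0, 1) = - (of_real (a / 2) * g (t, x, y, z))"
    for t x y z
    using AB(1)[of "(t, x, y, z)" "(0, 0, 1, x)"] unfolding part01_f frame
    by (simp add: field_simps add_eq_0_iff)
  obtain C where C: "\<And>p. g p = C * exp (\<i> * of_real (a / 2 * fst (snd p)))"
    using invariant_Cauchy_Riemann[where f = g and D = Dg, OF a Dg inv_g g1 g2] by blast
  have "continuous_on UNIV f"
    using Df by (meson continuous_at_imp_continuous_on has_derivative_continuous)
  then obtain M where M: "\<And>p. norm (f p) \<le> M"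
    using bounded_invariant[of f] inv_f by blast
  have g0: "g p = 0" for p
  proof -
    \<comment> \<open>Since \<open>g\<close> depends on \<open>x\<close> only, the right-hand side
      of \<open>f2\<close> is constant on the plane \<open>t = x = 0\<close>. Its vanishing there
      gives \<open>C = 0\<close>.\<close>
    have "- (of_real (a / 2) * g (0, 0, 0, 0)) = 0"
    proof (rule fiber_Cauchy_Riemann(1)[where f = f and D = Df and M = M])
      show "Df (0, 0, y, z) (0, 0, 1, 0) + \<i> / of_real a * Df (0, 0, y, z) (0, 0, 0, 1) = - (of_real (a / 2) * g (0, 0, 0, 0))" for y z
        using f2[of 0 0 y z] by (simp add: C)
    qed (rule a Df M)+
    then show ?thesis using a by (simp add: C)
  qed
  have f2': "Df (t, x, y, z) (0, 0, 1, x) + \<i> / of_real a * Df (t, x, y, z) (0, 0, 0, 1) = 0" for t x y z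
    using f2 by (simp add: g0)
  obtain C' where C': "\<And>p. f p = C' * exp (\<i> * of_real (0 * fst (snd p)))"
    using invariant_Cauchy_Riemann[where f = f and D = Df, OF a Df inv_f f1 f2'] by blast
  show ?thesis
  proof (rule that[of C'])
    have "G p vs = C' * wedge [phi1] vs" for p vs
      using fun_cong[OF G_eq[of p], of vs] unfolding C'[of p] g0[of p]
      by (simp add: wedge_1 split: list.splits)
    then show "s = (\<lambda>c p vs. C' * section_of (\<lambda>p. wedge [phi1]) c p vs)"
      unfolding G(1) section_of_def by (intro ext) simp
  qed
qed

text \<open>The invariant form \<open>phi1\<close> has constant coefficients, hence lies in the
  kernel, and it spans the kernel by \<open>hodge_section_unique\<close>.\<close>

lemma hodge10_KT:
  assumes a: "a \<noteq> 0"
  shows "hodge10 KT_atlas (KT_J a) = 1"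
  unfolding hodge10_def
proof (rule cdim_eq_1)
  let ?s0 = "section_of (\<lambda>p. wedge [phi1])"
  obtain c where "c \<in> KT_atlas" "0 \<in> chart_image c" using exists_chart by blast
  then have "?s0 c 0 [(1, 0, 0, 0)] \<noteq> 0"
    by (simp add: section_of_def wedge_1 complex_eq_iff)
  then show "?s0 \<noteq> 0" by auto
  show "{\<gamma> \<in> sections KT_atlas (KT_J a) (Lambda 1 0).
      \<forall>c\<in>KT_atlas. \<forall>x\<in>chart_image c. dbar 1 0 (KT_J a c) (\<gamma> c) x = (\<lambda>_. 0)}
    \<subseteq> {\<lambda>c x vs. C * ?s0 c x vs | C. True}"
    using hodge_section_unique[OF a] by blast
  have "?s0 \<in> sections KT_atlas (KT_J a) (Lambda 1 0)"
    unfolding sections_KT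
  proof (intro exI conjI allI)
    show "wedge [phi1] \<in> Lambda 1 0 (std_J a p)" for p
      unfolding Lambda_1_0 using phi_mem_covectors[OF a] by blast
    show "wedge [phi1] (map (deck_linear g) vs) = wedge [phi1] vs" for g and vs :: "coords list"
      by (auto simp: wedge_1 phi1_deck split: list.splits)
  qed (auto intro: smooth_on_const)
  moreover have "dbar 1 0 (KT_J a c) (?s0 c) p = (\<lambda>_. 0)" if c: "c \<in> KT_atlas" "p \<in> chart_image c" for c p
  proof -
    have "open (chart_image c)" using c(1) unfolding KT_atlas_iff by (auto simp: chart_image_KT_chart)
    moreover have "?s0 c y = wedge [\<lambda>v. 1 * phi1 v + 0 * phi2 a y v]" if "y \<in> chart_image c" for y
      using that c by (simp add: section_of_def)
    ultimately have "dbar 1 0 (std_J a) (?s0 c) p = wedge [\<lambda>v. part01 (std_J a p) (\<lambda>v. 0) v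
        + of_real (a / 4) * 0 * cnj (phi2 a p v), phi1] + wedge [\<lambda>v. part01 (std_J a p) (\<lambda>v. 0) v
        + of_real (a / 4) * 0 * cnj (phi1 v), phi2 a p]"
      by (intro dbar_form[OF a has_derivative_const has_derivative_const _ c(2)])
    also have "\<dots> = wedge [\<lambda>v. 0, phi1] + wedge [\<lambda>v. 0, phi2 a p]" by (simp add: part01_def)
    also have "\<dots> = (\<lambda>_. 0)"
    proof
      show "(wedge [\<lambda>v. 0, phi1] + wedge [\<lambda>v. 0, phi2 a p]) vs = 0" for vs :: "coords list"
        by (cases "length vs = 2") (auto elim!: length_2_cases simp: wedge_2 wedge_wrong_length)
    qed
    finally show ?thesis by (simp add: KT_J_std)
  qed
  ultimately show "?s0 \<in> {\<gamma> \<in> sections KT_atlas (KT_J a) (Lambda 1 0).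
      \<forall>c\<in>KT_atlas. \<forall>x\<in>chart_image c. dbar 1 0 (KT_J a c) (\<gamma> c) x = (\<lambda>_. 0)}"
    by simp
qed

theorem proposition6p1:
  fixes a :: real
  assumes "a \<noteq> 0"
  shows "smooth_atlas KT KT_atlas \<and>
    almost_complex_structure KT_atlas (KT_J a) \<and>
    \<not> integrable_structure KT_atlas (KT_J a) \<and>
    hodge10 KT_atlas (KT_J a) = 1 \<and>
    kodaira_dim KT_atlas (KT_J a) = (if \<exists>q\<in>\<rat>. a = pi * q then 0 else -\<infinity>)"
  using smooth_atlas_KT almost_complex_structure_KT[OF assms] not_integrable_KT[OF assms]
    hodge10_KT[OF assms] kodaira_dim_KT[OF assms] by blast

end
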